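(* Up to translations and reflection with respect to the $x$-axis, the solutions of the equation $$\left\langle\begin{pmatrix}0&0\\0&-1\end{pmatrix}Y+\begin{pmatrix}1\\0\end{pmatrix},N_Y\right\rangle=k_Y^{1/3}$$ for curves $Y$ in $\mathbb{R}^2$ are the following curves: (1) The line $y=0$. (2) Curves formed by the graphs of the functions $f_1$ and $-f_2$, where $f_1$ and $f_2$ are functions defined on $[0,+\infty)$, oscillating around the $x$-axis, satisfying the following properties: (a) $f_1(0)=f_2(0)\ge0$ and $f_1'(0)=f_2'(0)=+\infty$; (b) for $i=1,2$ there are three sequences $\{x_n^{(i)}\}_{n=1}^\infty$, $\{y_n^{(i)}\}_{n=1}^\infty$ and $\{z_n^{(i)}\}_{n=1}^\infty$ in $(0,\infty)$, increasing to $+\infty$ as $n\to+\infty$, such that (i) $x_n^{(i)}<y_n^{(i)}<z_n^{(i)}<x_{n+1}^{(i)}$ for any $n$; (ii) $x_n^{(i)}$ is a local maximum point of $f_i$ with $f_i(x_n^{(i)})>0$ when $n$ is odd, and is a local minimum point of $f_i$ with $f_i(x_n^{(i)})<0$ when $n$ is even; (iii) $y_1^{(i)},y_2^{(i)},\dots$ are all the inflection points of $f_i$; (iv) $z_1^{(i)},z_2^{(i)},\dots$ are all the positive zeroes of $f_i$; (v) $f_i$ is monotone between $x_n^{(i)}$ and $x_{n+1}^{(i)}$; (vi) $\{|f_i(x_n^{(i)})|\}_{n=1}^\infty$, $\{|f_i(y_n^{(i)})|=|f_i'(y_n^{(i)})|\}_{n=1}^\infty$ and $\{|f_i'(z_n^{(i)})|\}_{n=1}^\infty$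 decrease to $0$ as $n\to\infty$; (vii) $y_n^{(i)}-x_n^{(i)}<x_{n+1}^{(i)}-y_n^{(i)}$ and $x_{n+1}^{(i)}-z_n^{(i)}<z_{n+1}^{(i)}-x_{n+1}^{(i)}$ for any $n$; moreover, $x_{n+1}^{(i)}-y_n^{(i)}$ and $z_{n+1}^{(i)}-x_{n+1}^{(i)}$ tend to $\infty$ as $n\to\infty$. Moreover, when $f_1(0)=f_2(0)=0$, the curve is symmetric with respect to the $x$-axis, that is, $f_1=f_2$. (3) The graph of a function $f$ on $(-\infty,+\infty)$ oscillating around the $x$-axis. More precisely, there are three sequences $\{x_n\}_{n=1}^\infty$, $\{y_n\}_{n=1}^\infty$ and $\{z_n\}_{n=1}^\infty$ in $(0,\infty)$, increasing to $+\infty$ as $n\to+\infty$, such that (a) $f$ decreases to $-\infty$ as $x\to-\infty$ on $(-\infty,x_1]$ (that is, $f(x)$ decreases as $x$ decreases, with limit $-\infty$); (b) $x_n<y_n<z_n<x_{n+1}$ for any $n$; (c) $x_n$ is a local maximum point of $f$ with $f(x_n)>0$ when $n$ is odd, and is a local minimum point of $f$ with $f(x_n)<0$ when $n$ is even; (d) $y_1,y_2,\dots$ are all the inflection points of $f$; (e) $z_1,z_2,\dots$ are all the zeroes of $f$ greater than $x_1$; (f) $f$ is monotone between $x_n$ and $x_{n+1}$; (g) $\{|f(x_n)|\}_{n=1}^\infty$, $\{|f(y_n)|=|f'(y_n)|\}_{n=1}^\infty$ and $\{|f'(z_n)|\}_{n=1}^\infty$ decrease to $0$ as $n\to\infty$;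 (h) $y_n-x_n<x_{n+1}-y_n$ and $x_{n+1}-z_n<z_{n+1}-x_{n+1}$ for any $n$; moreover, $x_{n+1}-y_n$ and $z_{n+1}-x_{n+1}$ tend to $+\infty$ as $n\to\infty$.
   Context: Points of $\mathbb{R}^2$ are written as $(x,y)$. Curves are smooth immersed curves. For a curve $Y=Y(u)$, put $T=Y_u/\|Y_u\|$, $N_Y=JT$ with $J=\begin{pmatrix}0&-1\\1&0\end{pmatrix}$ (unit normal), and $k_Y=\det(Y_u,Y_{uu})/\|Y_u\|^3$ (curvature with respect to $N_Y$). $\langle\cdot,\cdot\rangle$ is the Euclidean inner product and $k^{1/3}$ is the real (odd) cube root. Solutions are regarded as geometric curves (up to reparametrization), connected and maximally extended. An infinite derivative at $0$ means that the one-sided derivative tends to $+\infty$ as $x\to0^+$, i.e. the curve has a vertical tangent there. Reflection with respect to the $x$-axis is the map $(x,y)\mapsto(x,-y)$.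
   Formalization: In (2)(a) the condition is f_1(0) = -f_2(0) ≥ 0, since the graphs of f_1 and -f_2 must meet at x = 0; in (2)(b)(iv), when f_i(0) < 0, the z_n are all the zeroes of f_i greater than x_1, because f_i then has a further zero before x_1. *)

theory Defs
  imports "HOL-Analysis.Analysis"
begin

definition vderiv :: "(real \<Rightarrow> 'a::real_normed_vector) \<Rightarrow> real \<Rightarrow> 'a" where
  "vderiv g = (\<lambda>u. vector_derivative g (at u))"

(* C-infinity on I; only used for open I, so that two-sided derivatives are adequate. *)
definition smooth_on :: "real set \<Rightarrow> (real \<Rightarrow> 'a::real_normed_vector) \<Rightarrow> bool" where
  "smooth_on I g \<longleftrightarrow> (\<forall>n. \<forall>u\<in>I. ((vderiv ^^ n) g) differentiable (at u))"

definition unit_tangent :: "(real \<Rightarrow> real^2) \<Rightarrow> real \<Rightarrow> real^2" where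
  "unit_tangent Y u = vderiv Y u /\<^sub>R norm (vderiv Y u)"

definition J :: "real^2^2" where
  "J = vector [vector [0, -1], vector [1, 0]]"

definition unit_normal :: "(real \<Rightarrow> real^2) \<Rightarrow> real \<Rightarrow> real^2" where
  "unit_normal Y u = J *v unit_tangent Y u"

(* The inner vectors are the rows of the matrix, hence the transpose. *)
definition curvature :: "(real \<Rightarrow> real^2) \<Rightarrow> real \<Rightarrow> real" where
  "curvature Y u =
     det (transpose (vector [vderiv Y u, vderiv (vderiv Y) u] :: real^2^2)) / norm (vderiv Y u) ^ 3"

definition immersed_curve :: "real set \<Rightarrow> (real \<Rightarrow> real^2) \<Rightarrow> bool" where
  "immersed_curve I Y \<longleftrightarrow>
     open I \<and> connected I \<and> I \<noteq> {} \<and> smooth_on I Y \<and> (\<forall>u\<in>I. vderiv Y u \<noteq> 0)"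

(* "root 3" is the odd real cube root, also for negative arguments. *)
definition solution :: "real set \<Rightarrow> (real \<Rightarrow> real^2) \<Rightarrow> bool" where
  "solution I Y \<longleftrightarrow> immersed_curve I Y \<and>
     (\<forall>u\<in>I. ((vector [vector [0, 0], vector [0, -1]] :: real^2^2) *v Y u + vector [1, 0])
               \<bullet> unit_normal Y u = root 3 (curvature Y u))"

(* Maximality of the geometric curve: a solution Z contains Y if Y is, up to a smooth change of
   parameter p, a restriction of Z. Extending the function Y itself would not be enough, since
   a short arc can be parametrized by the whole line. *)
definition maximal_solution :: "real set \<Rightarrow> (real \<Rightarrow> real^2) \<Rightarrow> bool" where
  "maximal_solution I Y \<longleftrightarrow> solution I Y \<and>
     (\<forall>K Z p. solution K Z \<and> smooth_on I p \<and> (\<forall>u\<in>I. vderiv p u \<noteq> 0) \<and>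
              p ` I \<subseteq> K \<and> (\<forall>u\<in>I. Y u = Z (p u)) \<longrightarrow> p ` I = K)"

definition reflect_x :: "real^2 \<Rightarrow> real^2" where
  "reflect_x q = vector [q $ 1, - (q $ 2)]"

(* Y runs through the curve c, parametrized by the whole line, exactly once and without
   backtracking. The change of parameter is only required to be a homeomorphism because the
   concatenation of two branches below is not a regular parametrization at its vertical tangent. *)
definition parametrizes :: "real set \<Rightarrow> (real \<Rightarrow> real^2) \<Rightarrow> (real \<Rightarrow> real^2) \<Rightarrow> bool" where
  "parametrizes I Y c \<longleftrightarrow> (\<exists>h h'. homeomorphism I UNIV h h' \<and> (\<forall>u\<in>I. Y u = c (h u)))"

definition graph_curve :: "(real \<Rightarrow> real) \<Rightarrow> real \<Rightarrow> real^2" where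
  "graph_curve f t = vector [t, f t]"

(* The graphs of f1 and - f2 over {0..}, joined at t = 0 when f1 0 = - f2 0. *)
definition two_branch_curve :: "(real \<Rightarrow> real) \<Rightarrow> (real \<Rightarrow> real) \<Rightarrow> real \<Rightarrow> real^2" where
  "two_branch_curve f1 f2 t = (if 0 \<le> t then vector [t, f1 t] else vector [- t, - f2 (- t)])"

definition local_max_at :: "(real \<Rightarrow> real) \<Rightarrow> real \<Rightarrow> bool" where
  "local_max_at f a \<longleftrightarrow> (\<forall>\<^sub>F t in at a. f t \<le> f a)"

definition local_min_at :: "(real \<Rightarrow> real) \<Rightarrow> real \<Rightarrow> bool" where
  "local_min_at f a \<longleftrightarrow> (\<forall>\<^sub>F t in at a. f a \<le> f t)"

(* The second derivative changes sign at a. *)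
definition inflection_at :: "(real \<Rightarrow> real) \<Rightarrow> real \<Rightarrow> bool" where
  "inflection_at f a \<longleftrightarrow>
     ((\<forall>\<^sub>F t in at_left a. deriv (deriv f) t < 0) \<and> (\<forall>\<^sub>F t in at_right a. deriv (deriv f) t > 0)) \<or>
     ((\<forall>\<^sub>F t in at_left a. deriv (deriv f) t > 0) \<and> (\<forall>\<^sub>F t in at_right a. deriv (deriv f) t < 0))"

(* Sequences are indexed by n \<ge> 1; their values at index 0 are irrelevant. *)
definition increases_to_infinity :: "(nat \<Rightarrow> real) \<Rightarrow> bool" where
  "increases_to_infinity a \<longleftrightarrow> strict_mono_on {1..} a \<and> filterlim a at_top sequentially"

definition decreases_to_zero :: "(nat \<Rightarrow> real) \<Rightarrow> bool" where
  "decreases_to_zero a \<longleftrightarrow> strict_antimono_on {1..} a \<and> a \<longlonglongrightarrow> 0"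

(* The properties of f on the open domain D that are common to both kinds of oscillating curves;
   the description of the zeroes by z differs between them and is added separately. *)
definition oscillation ::
    "real set \<Rightarrow> (real \<Rightarrow> real) \<Rightarrow> (nat \<Rightarrow> real) \<Rightarrow> (nat \<Rightarrow> real) \<Rightarrow> (nat \<Rightarrow> real) \<Rightarrow> bool" where
  "oscillation D f x y z \<longleftrightarrow>
     smooth_on D f \<and>
     (\<forall>n\<ge>1. 0 < x n \<and> 0 < y n \<and> 0 < z n) \<and>
     increases_to_infinity x \<and> increases_to_infinity y \<and> increases_to_infinity z \<and>
     (\<forall>n\<ge>1. x n < y n \<and> y n < z n \<and> z n < x (n + 1)) \<and>
     (\<forall>n\<ge>1. (odd n \<longrightarrow> local_max_at f (x n) \<and> f (x n) > 0) \<and>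
            (even n \<longrightarrow> local_min_at f (x n) \<and> f (x n) < 0)) \<and>
     y ` {1..} = {t \<in> D. inflection_at f t} \<and>
     (\<forall>n\<ge>1. mono_on {x n..x (n + 1)} f \<or> antimono_on {x n..x (n + 1)} f) \<and>
     decreases_to_zero (\<lambda>n. \<bar>f (x n)\<bar>) \<and>
     (\<forall>n\<ge>1. \<bar>f (y n)\<bar> = \<bar>deriv f (y n)\<bar>) \<and> decreases_to_zero (\<lambda>n. \<bar>f (y n)\<bar>) \<and>
     decreases_to_zero (\<lambda>n. \<bar>deriv f (z n)\<bar>) \<and>
     (\<forall>n\<ge>1. y n - x n < x (n + 1) - y n \<and> x (n + 1) - z n < z (n + 1) - x (n + 1)) \<and>
     filterlim (\<lambda>n. x (n + 1) - y n) at_top sequentially \<and>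
     filterlim (\<lambda>n. z (n + 1) - x (n + 1)) at_top sequentially"

(* A branch that starts below the axis crosses it once on its way up to the first maximum x 1,
   so in that case z can only list the zeroes greater than x 1. *)
definition half_line_branch :: "(real \<Rightarrow> real) \<Rightarrow> bool" where
  "half_line_branch f \<longleftrightarrow>
     filterlim (deriv f) at_top (at_right 0) \<and>
     (\<exists>x y z. oscillation {0<..} f x y z \<and>
        (0 \<le> f 0 \<longrightarrow> z ` {1..} = {t. 0 < t \<and> f t = 0}) \<and>
        (f 0 < 0 \<longrightarrow> z ` {1..} = {t. x 1 < t \<and> f t = 0}))"

(* f2 0 = - f1 0 because both f1 and - f2 start at the point of the curve with vertical tangent. *)
definition two_branch_profile :: "(real \<Rightarrow> real) \<Rightarrow> (real \<Rightarrow> real) \<Rightarrow> bool" where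
  "two_branch_profile f1 f2 \<longleftrightarrow>
     f1 0 = - f2 0 \<and> 0 \<le> f1 0 \<and> half_line_branch f1 \<and> half_line_branch f2 \<and>
     (f1 0 = 0 \<longrightarrow> (\<forall>t\<ge>0. f1 t = f2 t))"

definition entire_profile :: "(real \<Rightarrow> real) \<Rightarrow> bool" where
  "entire_profile f \<longleftrightarrow>
     (\<exists>x y z. oscillation UNIV f x y z \<and>
        strict_mono_on {..x 1} f \<and> filterlim f at_bot at_bot \<and>
        z ` {1..} = {t. x 1 < t \<and> f t = 0})"

end

(* The curve is governed by the bounded Lipschitz system for its tangent angle and the angle
   \<phi> = arctan y. Between vertical tangents it is the graph of a solution of f'' = -(f + f')^3.
   The energy f^4/4 + f'^2/2 decreases along it, and a corrected energy does so at a rate that is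
   bounded below away from the origin, so the graph tends to 0 to the right; it oscillates because
   the half-planes of the signs of f, f' and f + f' are traversed cyclically. The inequalities between
   the lengths of the phases of an oscillation come from comparing the speeds at equal heights.
   At most one vertical tangent can occur, since both branches from it run to the right and the energy,
   hence the slope, stays bounded along them.
   If there is none, the energy is unbounded to the left, which forces the slope to blow up as soon as the
   graph meets the axis at high energy; hence the graph tends to -infinity or +infinity there. Such a
   graph exists by shooting between the two ways of acquiring a vertical tangent. *)
theory Submission
  imports Defs
begin

subsection \<open>Smooth functions\<close>

text \<open>Neither coordinate can serve as a global parameter: a solution need not be a graph, and
  its height has no a priori bound. The cube root makes the speed cancel: for velocity
  \<open>(a, b)\<close> at height \<open>y\<close> the equation reads
  \<open>a * b' - b * a' = - ((b + y * a) ^ 3)\<close>. In terms of the angles the bracket is the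
  speed times sin (\<theta> + \<phi>) / cos \<phi>, and a time change by cos^3 \<phi> clears the
  denominator. Every solution is thus a reparametrized piece of a complete flow line. Completeness
  in time does not yet make a flow line a maximal geometric curve, since it might end at a point of
  the plane in infinite time. Maximality rests on |x| tending to infinity at both ends, which is
  known only after the classification; hence flow lines are classified first and maximality is
  deduced from the result. The delicate end is the left end of an entire graph: the slope must not
  blow up at finite height, and the height must not diverge at finite x. The second is excluded by a
  slope bound that comes out of the first.\<close>

primrec ck_on :: "nat \<Rightarrow> real set \<Rightarrow> (real \<Rightarrow> 'a::real_normed_vector) \<Rightarrow> bool" where
  "ck_on 0 I g \<longleftrightarrow> (\<forall>u\<in>I. g differentiable (at u))"
| "ck_on (Suc n) I g \<longleftrightarrow>
     (\<exists>g'. (\<forall>u\<in>I. (g has_vector_derivative g' u) (at u)) \<and> ck_on n I g')"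

lemma ck_on_SucD: "ck_on (Suc n) I g \<Longrightarrow> ck_on n I g"
proof (induction n arbitrary: g)
  case 0
  then show ?case by (auto simp: differentiableI_vector)
next
  case (Suc n)
  then show ?case by (metis ck_on.simps(2))
qed

lemma ck_on_cong:
  assumes "open I" "ck_on n I f" "\<And>u. u \<in> I \<Longrightarrow> f u = h u"
  shows "ck_on n I h"
proof -
  have *: "(h has_vector_derivative f') (at u)" if "u \<in> I" "(f has_vector_derivative f') (at u)" for u f'
    using has_vector_derivative_transform_within_open[OF that(2) assms(1) that(1)] assms(3) by simp
  show ?thesis
  proof (cases n)
    case 0
    then show ?thesis
      using assms(2) * by (metis ck_on.simps(1) differentiableI_vector vector_derivative_works)
  next
    case (Suc m)
    then show ?thesis using assms(2) * by auto
  qed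
qed

text \<open>Iterates of \<open>vderiv\<close> are awkward under products and compositions.
  \<open>ck_on\<close> leaves the derivative existential, so each closure property is an induction
  that supplies a witness. Level \<open>n\<close> stands for n + 1 derivatives. Openness of
  \<open>I\<close> makes derivatives at points of \<open>I\<close> depend only on the values on
  \<open>I\<close>.\<close>

lemma smooth_on_iff_ck_on:
  assumes "open I"
  shows "smooth_on I g \<longleftrightarrow> (\<forall>n. ck_on n I g)"
proof
  have *: "ck_on n I g" if "\<And>k. k \<le> n \<Longrightarrow> \<forall>u\<in>I. (vderiv ^^ k) g differentiable (at u)"
    for n and g :: "real \<Rightarrow> 'a"
    using that
  proof (induction n arbitrary: g)
    case 0
    then show ?case by auto
  next
    case (Suc n)
    have "\<forall>u\<in>I. (g has_vector_derivative vderiv g u) (at u)"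
      using Suc.prems[of 0] by (simp add: vderiv_def vector_derivative_works)
    moreover have "ck_on n I (vderiv g)"
    proof (rule Suc.IH)
      fix k assume "k \<le> n"
      then show "\<forall>u\<in>I. (vderiv ^^ k) (vderiv g) differentiable (at u)"
        using Suc.prems[of "Suc k"] by (simp add: funpow_swap1)
    qed
    ultimately show ?case by auto
  qed
  assume "smooth_on I g"
  then show "\<forall>n. ck_on n I g" using * by (simp add: smooth_on_def)
next
  have *: "\<forall>u\<in>I. (vderiv ^^ n) g differentiable (at u)" if "ck_on n I g"
    for n and g :: "real \<Rightarrow> 'a"
    using that
  proof (induction n arbitrary: g)
    case 0
    then show ?case by auto
  next
    case (Suc n)
    then obtain g' where g': "\<forall>u\<in>I. (g has_vector_derivative g' u) (at u)" "ck_on n I g'" by auto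
    have "ck_on n I (vderiv g)"
      using g' by (intro ck_on_cong[OF assms g'(2)]) (auto simp: vderiv_def vector_derivative_at)
    then show ?case using Suc.IH by (simp add: funpow_swap1)
  qed
  assume "\<forall>n. ck_on n I g"
  then show "smooth_on I g" using * by (simp add: smooth_on_def)
qed

lemma ck_on_const: "ck_on n I (\<lambda>u. c)"
proof (induction n arbitrary: c)
  case (Suc n)
  show ?case unfolding ck_on.simps by (intro exI[of _ "\<lambda>u. 0"] conjI Suc) auto
qed simp

lemma ck_on_linear:
  assumes "bounded_linear l"
  shows "ck_on n I f \<Longrightarrow> ck_on n I (\<lambda>u. l (f u))"
proof (induction n arbitrary: f)
  case 0
  then show ?case
    using bounded_linear.has_vector_derivative[OF assms]
    by (metis ck_on.simps(1) differentiableI_vector vector_derivative_works)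
next
  case (Suc n)
  then obtain f' where "\<forall>u\<in>I. (f has_vector_derivative f' u) (at u)" "ck_on n I f'" by auto
  then show ?case
    using Suc.IH[of f'] bounded_linear.has_vector_derivative[OF assms]
    by (auto intro!: exI[of _ "\<lambda>u. l (f' u)"])
qed

lemma ck_on_add: "ck_on n I f \<Longrightarrow> ck_on n I g \<Longrightarrow> ck_on n I (\<lambda>u. f u + g u)"
proof (induction n arbitrary: f g)
  case 0
  then show ?case by (auto intro: differentiable_add)
next
  case (Suc n)
  then obtain f' g' where "\<forall>u\<in>I. (f has_vector_derivative f' u) (at u)" "ck_on n I f'"
    "\<forall>u\<in>I. (g has_vector_derivative g' u) (at u)" "ck_on n I g'" by auto
  then show ?case
    using Suc.IH[of f' g'] by (auto intro!: exI[of _ "\<lambda>u. f' u + g' u"] has_vector_derivative_add)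
qed

lemma ck_on_scaleR:
  "ck_on n I f \<Longrightarrow> ck_on n I g \<Longrightarrow> ck_on n I (\<lambda>u. f u *\<^sub>R g u)"
proof (induction n arbitrary: f g)
  case 0
  then show ?case by (auto intro: differentiable_scaleR)
next
  case (Suc n)
  then obtain f' g' where d: "\<forall>u\<in>I. (f has_vector_derivative f' u) (at u)" "ck_on n I f'"
    "\<forall>u\<in>I. (g has_vector_derivative g' u) (at u)" "ck_on n I g'" by auto
  have "ck_on n I (\<lambda>u. f u *\<^sub>R g' u + f' u *\<^sub>R g u)"
    using Suc.prems[THEN ck_on_SucD] d by (intro ck_on_add Suc.IH)
  then show ?case
    unfolding ck_on.simps using d
    by (intro exI[of _ "\<lambda>u. f u *\<^sub>R g' u + f' u *\<^sub>R g u"])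
       (auto intro!: has_vector_derivative_scaleR simp: has_real_derivative_iff_has_vector_derivative)
qed

lemma ck_on_mult: "ck_on n I f \<Longrightarrow> ck_on n I g \<Longrightarrow> ck_on n I (\<lambda>u. f u * g u :: real)"
  using ck_on_scaleR[of n I f g] by simp

lemma ck_on_minus: "ck_on n I f \<Longrightarrow> ck_on n I (\<lambda>u. - f u)"
  using ck_on_linear[OF bounded_linear_minus[OF bounded_linear_ident]] by auto

lemma ck_on_power: "ck_on n I f \<Longrightarrow> ck_on n I (\<lambda>u. f u ^ k :: real)"
  by (induction k) (auto intro: ck_on_const ck_on_mult)

lemma ck_on_real_SucI:
  "(\<And>u. u \<in> I \<Longrightarrow> (f has_real_derivative f' u) (at u)) \<Longrightarrow> ck_on n I f' \<Longrightarrow> ck_on (Suc n) I f"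
  by (auto simp: has_real_derivative_iff_has_vector_derivative)

lemma ck_on_real_SucE:
  assumes "ck_on (Suc n) I f"
  obtains f' where "\<And>u. u \<in> I \<Longrightarrow> (f has_real_derivative f' u) (at u)" "ck_on n I f'"
  using assms by (auto simp: has_real_derivative_iff_has_vector_derivative)

lemma ck_on_sin_cos:
  "ck_on n I f \<Longrightarrow> ck_on n I (\<lambda>u. sin (f u) :: real) \<and> ck_on n I (\<lambda>u. cos (f u) :: real)"
proof (induction n arbitrary: f)
  case 0
  show ?case unfolding ck_on.simps
  proof (intro conjI ballI)
    fix u assume "u \<in> I"
    then obtain d where d: "(f has_real_derivative d) (at u)"
      using 0 by (auto elim: real_differentiableE)
    show "(\<lambda>u. sin (f u)) differentiable (at u)" "(\<lambda>u. cos (f u)) differentiable (at u)"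
      using DERIV_chain2[OF DERIV_sin d] DERIV_chain2[OF DERIV_cos d]
      by (auto simp: real_differentiable_def)
  qed
next
  case (Suc n)
  then obtain f' where d: "\<And>u. u \<in> I \<Longrightarrow> (f has_real_derivative f' u) (at u)" "ck_on n I f'"
    using ck_on_real_SucE[OF Suc.prems] by blast
  have sc: "ck_on n I (\<lambda>u. sin (f u))" "ck_on n I (\<lambda>u. cos (f u))"
    using Suc.IH[OF ck_on_SucD[OF Suc.prems]] by blast+
  have *: "ck_on n I (\<lambda>u. cos (f u) * f' u)" "ck_on n I (\<lambda>u. - sin (f u) * f' u)"
    by (intro ck_on_mult ck_on_minus d(2) sc)+
  show ?case
    by (intro conjI ck_on_real_SucI[OF _ *(1)] ck_on_real_SucI[OF _ *(2)] DERIV_chain2[OF DERIV_sin]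
        DERIV_chain2[OF DERIV_cos] d(1))
qed

lemmas ck_on_sin = ck_on_sin_cos[THEN conjunct1]
lemmas ck_on_cos = ck_on_sin_cos[THEN conjunct2]

lemma ck_on_inverse:
  "ck_on n I f \<Longrightarrow> \<forall>u\<in>I. f u \<noteq> 0 \<Longrightarrow> ck_on n I (\<lambda>u. inverse (f u) :: real)"
proof (induction n arbitrary: f)
  case 0
  then show ?case by (auto intro: differentiable_inverse)
next
  case (Suc n)
  then obtain f' where d: "\<And>u. u \<in> I \<Longrightarrow> (f has_real_derivative f' u) (at u)" "ck_on n I f'"
    using ck_on_real_SucE[OF Suc.prems(1)] by blast
  have "ck_on n I (\<lambda>u. inverse (f u))"
    using Suc.IH[OF ck_on_SucD[OF Suc.prems(1)]] Suc.prems(2) by blast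
  then have *: "ck_on n I (\<lambda>u. - (f' u * inverse (f u) ^ 2))"
    by (intro ck_on_mult ck_on_minus ck_on_power d(2))
  show ?case
    using d(1) Suc.prems(2)
    by (intro ck_on_real_SucI[OF _ *])
       (auto intro!: derivative_eq_intros DERIV_inverse_fun simp: power2_eq_square)
qed

lemma ck_on_sqrt:
  "ck_on n I f \<Longrightarrow> \<forall>u\<in>I. 0 < f u \<Longrightarrow> ck_on n I (\<lambda>u. sqrt (f u))"
proof (induction n arbitrary: f)
  case 0
  show ?case
  proof (simp, rule ballI)
    fix u assume u: "u \<in> I"
    then obtain f' where "(f has_real_derivative f') (at u)"
      using 0 by (metis ck_on.simps(1) real_differentiableE)
    then have "((\<lambda>u. sqrt (f u)) has_real_derivative inverse (sqrt (f u)) / 2 * f') (at u)"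
      using DERIV_chain2[OF DERIV_real_sqrt] 0 u by blast
    then show "(\<lambda>u. sqrt (f u)) differentiable (at u)"
      by (auto simp: real_differentiable_def)
  qed
next
  case (Suc n)
  then obtain f' where d: "\<And>u. u \<in> I \<Longrightarrow> (f has_real_derivative f' u) (at u)" "ck_on n I f'"
    using ck_on_real_SucE[OF Suc.prems(1)] by blast
  have "ck_on n I (\<lambda>u. sqrt (f u))"
    using Suc.IH[OF ck_on_SucD[OF Suc.prems(1)]] Suc.prems(2) by blast
  then have *: "ck_on n I (\<lambda>u. inverse (sqrt (f u)) * (1/2) * f' u)"
    using d(2) Suc.prems(2)
    by (intro ck_on_mult ck_on_inverse ck_on_const) auto
  show ?case
  proof (rule ck_on_real_SucI[OF _ *])
    fix u assume "u \<in> I"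
    then show "((\<lambda>u. sqrt (f u)) has_real_derivative inverse (sqrt (f u)) * (1/2) * f' u) (at u)"
      using DERIV_chain2[OF DERIV_real_sqrt] d(1)[of u] Suc.prems(2) by fastforce
  qed
qed

section \<open>Plane curves by coordinates, and smoothness of solutions of the differential
  equations\<close>

lemma has_vector_derivative_vec2:
  fixes a b :: "real \<Rightarrow> real"
  assumes "(a has_real_derivative a') (at u)" "(b has_real_derivative b') (at u)"
  shows "((\<lambda>u. vector [a u, b u] :: real^2) has_vector_derivative vector [a', b']) (at u)"
proof -
  have v: "(\<lambda>u. vector [a u, b u] :: real^2) =
      (\<lambda>u. a u *\<^sub>R vector [1, 0] + b u *\<^sub>R vector [0, 1])"
    by (intro ext) (simp add: vec_eq_iff forall_2)
  have "((\<lambda>u. a u *\<^sub>R e + b u *\<^sub>R e') has_vector_derivative a' *\<^sub>R e + b' *\<^sub>R e') (at u)"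
    for e e' :: "real^2"
    using assms by (auto intro!: derivative_eq_intros)
  moreover have "(vector [a', b'] :: real^2) = a' *\<^sub>R vector [1, 0] + b' *\<^sub>R vector [0, 1]"
    by (simp add: vec_eq_iff forall_2)
  ultimately show ?thesis by (subst v, simp only:)
qed

lemma has_real_derivative_nth:
  fixes Y :: "real \<Rightarrow> real^'n"
  shows "(Y has_vector_derivative Y') (at u) \<Longrightarrow> ((\<lambda>u. Y u $ i) has_real_derivative Y' $ i) (at u)"
  using bounded_linear.has_vector_derivative[OF bounded_linear_vec_nth]
  by (simp add: has_real_derivative_iff_has_vector_derivative)

lemma ck_on_vec2:
  fixes a b :: "real \<Rightarrow> real"
  assumes "ck_on n I a" "ck_on n I b"
  shows "ck_on n I (\<lambda>u. vector [a u, b u] :: real^2)"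
proof -
  have v: "(\<lambda>u. vector [a u, b u] :: real^2) =
      (\<lambda>u. a u *\<^sub>R vector [1, 0] + b u *\<^sub>R vector [0, 1])"
    by (intro ext) (simp add: vec_eq_iff forall_2)
  show ?thesis
    by (subst v, intro assms ck_on_add ck_on_scaleR ck_on_const)
qed

lemma smooth_on_imp_derivative:
  "smooth_on I g \<Longrightarrow> u \<in> I \<Longrightarrow> (g has_vector_derivative vderiv g u) (at u)"
  unfolding smooth_on_def vderiv_def vector_derivative_works[symmetric]
  by (metis funpow_0)

lemma smooth_on_vderiv: "smooth_on I g \<Longrightarrow> smooth_on I (vderiv g)"
  unfolding smooth_on_def by (metis funpow_swap1 funpow.simps(2) o_apply)

text \<open>Bootstrapping: the right sides are as smooth as \<theta>, \<phi> and \<open>r\<close>,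
  so \<theta> and \<phi> gain one derivative at each step. The coordinate \<open>x\<close> does not
  occur in the right sides and follows afterwards.\<close>

lemma smooth_on_ode:
  fixes th ph x r :: "real \<Rightarrow> real"
  assumes "open I" "smooth_on I r"
    and "\<And>u. u \<in> I \<Longrightarrow> (th has_real_derivative r u * - (sin (th u + ph u) ^ 3)) (at u)"
    and "\<And>u. u \<in> I \<Longrightarrow> (ph has_real_derivative r u * (sin (th u) * cos (ph u) ^ 5)) (at u)"
    and "\<And>u. u \<in> I \<Longrightarrow> (x has_real_derivative r u * (cos (th u) * cos (ph u) ^ 3)) (at u)"
  shows "smooth_on I th \<and> smooth_on I ph \<and> smooth_on I x"
proof -
  have r: "ck_on n I r" for n using assms smooth_on_iff_ck_on by blast
  have *: "ck_on n I th \<and> ck_on n I ph" for n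
  proof (induction n)
    case 0
    then show ?case using assms by (auto simp: real_differentiable_def)
  next
    case (Suc n)
    have "ck_on n I (\<lambda>u. r u * - (sin (th u + ph u) ^ 3))"
         "ck_on n I (\<lambda>u. r u * (sin (th u) * cos (ph u) ^ 5))"
      by (intro ck_on_mult ck_on_minus ck_on_power ck_on_add ck_on_sin ck_on_cos r
          Suc[THEN conjunct1] Suc[THEN conjunct2])+
    then show ?case using ck_on_real_SucI[OF assms(3)] ck_on_real_SucI[OF assms(4)] by auto
  qed
  have "ck_on n I x" for n
  proof -
    have "ck_on n I (\<lambda>u. r u * (cos (th u) * cos (ph u) ^ 3))"
      by (intro ck_on_mult ck_on_power ck_on_cos r *[THEN conjunct1] *[THEN conjunct2])
    then show ?thesis by (intro ck_on_SucD[OF ck_on_real_SucI[OF assms(5)]])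
  qed
  with * show ?thesis using assms(1) smooth_on_iff_ck_on by blast
qed

lemma smooth_on_graph_ode:
  fixes f g :: "real \<Rightarrow> real"
  assumes "open D"
    and "\<And>u. u \<in> D \<Longrightarrow> (f has_real_derivative g u) (at u)"
    and "\<And>u. u \<in> D \<Longrightarrow> (g has_real_derivative - ((f u + g u) ^ 3)) (at u)"
  shows "smooth_on D f"
proof -
  have "ck_on n D f \<and> ck_on n D g" for n
  proof (induction n)
    case 0
    then show ?case using assms by (auto simp: real_differentiable_def)
  next
    case (Suc n)
    have "ck_on n D (\<lambda>u. - ((f u + g u) ^ 3))"
      by (intro ck_on_minus ck_on_power ck_on_add Suc[THEN conjunct1] Suc[THEN conjunct2])
    then show ?case using ck_on_real_SucI[OF assms(2)] ck_on_real_SucI[OF assms(3)] Suc by auto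
  qed
  then show ?thesis using assms(1) smooth_on_iff_ck_on by blast
qed

subsection \<open>Globally Lipschitz differential equations\<close>

lemma antiderivative_exists:
  fixes h :: "real \<Rightarrow> 'a::banach"
  assumes I: "open I" "connected I" and h: "continuous_on I h" and u0: "u0 \<in> I"
  obtains H where "H u0 = 0" "\<And>u. u \<in> I \<Longrightarrow> (H has_vector_derivative h u) (at u)"
proof -
  \<comment> \<open>One of the two integrals is over an empty interval or a point and vanishes, so
    the difference is the oriented integral from \<open>u0\<close> to \<open>u\<close> on either
    side of \<open>u0\<close>.\<close>
  define H where "H u = integral {u0..u} h - integral {u..u0} h" for u
  have H0: "H u0 = 0" by (simp add: H_def)
  have "(H has_vector_derivative h u) (at u)" if u: "u \<in> I" for u
  proof -
    obtain e where e: "e > 0" "ball (min u u0) e \<subseteq> I"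
      using I(1) u u0 by (metis min_def open_contains_ball)
    obtain e' where e': "e' > 0" "ball (max u u0) e' \<subseteq> I"
      using I(1) u u0 by (metis max_def open_contains_ball)
    \<comment> \<open>On an interval inside \<open>I\<close> with both \<open>u\<close> and
      \<open>u0\<close> in its interior, \<open>H\<close> is up to a constant an integral with fixed
      lower limit.\<close>
    define a b where "a = min u u0 - e/2" and "b = max u u0 + e'/2"
    have "a \<in> I" using e(1) by (intro subsetD[OF e(2)]) (auto simp: a_def dist_real_def)
    moreover have "b \<in> I" using e'(1) by (intro subsetD[OF e'(2)]) (auto simp: b_def dist_real_def)
    ultimately have ab: "{a..b} \<subseteq> I" using connected_contains_Icc[OF I(2)] by blast
    have c: "continuous_on {a..b} h" using h ab continuous_on_subset by blast
    have less: "a < u" "u < b" "a < u0" "u0 < b" using e e' by (auto simp: a_def b_def)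
    have int: "h integrable_on {p..q}" if "a \<le> p" "q \<le> b" for p q
      using that by (intro integrable_continuous_real continuous_on_subset[OF c]) auto
    have eq: "H t = integral {a..t} h - integral {a..u0} h" if "t \<in> {a..b}" for t
    proof (cases "u0 \<le> t")
      case True
      then have "integral {a..u0} h + integral {u0..t} h = integral {a..t} h"
        using that less by (intro Henstock_Kurzweil_Integration.integral_combine int) auto
      moreover have "integral {t..u0} h = 0" using True by (cases "t = u0") auto
      ultimately show ?thesis by (simp add: H_def algebra_simps)
    next
      case False
      then have "integral {a..t} h + integral {t..u0} h = integral {a..u0} h"
        using that less by (intro Henstock_Kurzweil_Integration.integral_combine int) auto
      then show ?thesis using False by (simp add: H_def algebra_simps)
    qed
    have "((\<lambda>t. integral {a..t} h) has_vector_derivative h u) (at u within {a..b})"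
      by (rule integral_has_vector_derivative[OF c]) (use less in simp)
    then have "((\<lambda>t. integral {a..t} h) has_vector_derivative h u) (at u within {a<..<b})"
      by (rule has_vector_derivative_within_subset) (rule greaterThanLessThan_subseteq_atLeastAtMost_iff[THEN iffD2], simp)
    then have "((\<lambda>t. integral {a..t} h) has_vector_derivative h u) (at u)"
      using at_within_open[of u "{a<..<b}"] less by simp
    then have "((\<lambda>t. integral {a..t} h - integral {a..u0} h) has_vector_derivative h u - 0) (at u)"
      by (rule has_vector_derivative_diff) (rule has_vector_derivative_const)
    then have "((\<lambda>t. integral {a..t} h - integral {a..u0} h) has_vector_derivative h u) (at u)" by simp
    then show "(H has_vector_derivative h u) (at u)"
      by (rule has_vector_derivative_transform_within_open[OF _ open_greaterThanLessThan[of a b]])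
         (use less eq in auto)
  qed
  with H0 show ?thesis by (rule that)
qed

lemma norm_le_of_derivative_bound:
  fixes H h :: "real \<Rightarrow> 'a::real_normed_vector"
  assumes H: "H 0 = 0" "\<And>t. (H has_vector_derivative h t) (at t)"
    and k: "\<And>t. norm (h t) \<le> k \<bar>t\<bar>"
    and G: "\<And>t. (G has_real_derivative k t) (at t)"
  shows "norm (H t) \<le> G \<bar>t\<bar> - G 0"
proof -
  have *: "norm (H t) \<le> G t - G 0" if "0 < t" and H: "H 0 = 0" "\<And>t. (H has_vector_derivative h t) (at t)"
    "\<And>t. norm (h t) \<le> k \<bar>t\<bar>" for t and H h :: "real \<Rightarrow> 'a"
  proof -
    have "norm (H t - H 0) \<le> G t - G 0"
    proof (rule differentiable_bound_general[of 0 t H G])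
      show "continuous_on {0..t} H"
        by (intro continuous_at_imp_continuous_on ballI has_vector_derivative_continuous[OF H(2)])
      show "continuous_on {0..t} G"
        by (intro continuous_at_imp_continuous_on ballI DERIV_isCont[OF G])
      fix x assume "0 < x" "x < t"
      then show "norm (h x) \<le> k x" using H(3)[of x] by simp
      show "(H has_vector_derivative h x) (at x)" by (rule H(2))
      show "(G has_vector_derivative k x) (at x)"
        using G by (simp add: has_real_derivative_iff_has_vector_derivative)
    qed (rule that(1))
    then show ?thesis using H by simp
  qed
  consider "t = 0" | "t > 0" | "t < 0" by linarith
  then show ?thesis
  proof cases
    case 1
    then show ?thesis using H(1) by simp
  next
    case 2
    then show ?thesis using *[OF 2 H k] by simp
  next
    case 3
    have "norm (H (- (- t))) \<le> G (- t) - G 0"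
    proof (rule *[of "- t" "\<lambda>t. H (- t)" "\<lambda>t. - h (- t)"])
      show "((\<lambda>t. H (- t)) has_vector_derivative - h (- s)) (at s)" for s
        using vector_diff_chain_at[of uminus "-1" s H "h (- s)"] H(2)[of "- s"]
          has_vector_derivative_minus[OF has_vector_derivative_id] by (simp add: o_def)
      show "norm (- h (- s)) \<le> k \<bar>s\<bar>" for s using k[of "- s"] by simp
      show "0 < - t" using 3 by simp
      show "H (- 0) = 0" using H(1) by simp
    qed
    then show ?thesis using 3 by simp
  qed
qed

text \<open>Picard iteration in the norm weighted by \<open>exp (-2 L \<bar>t\<bar>)\<close>,
  for which the integral operator is a contraction on the whole line.\<close>

lemma lipschitz_ode_exists:
  fixes F :: "'a::banach \<Rightarrow> 'a"
  assumes L: "L > 0" "\<And>p q. norm (F p - F q) \<le> L * norm (p - q)" and M: "\<And>p. norm (F p) \<le> M"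
  obtains u where "u 0 = u0" "\<And>t. (u has_vector_derivative F (u t)) (at t)"
proof -
  have "continuous_on UNIV F"
    by (rule lipschitz_on_continuous_on[of L]) (use L in \<open>auto simp: lipschitz_on_def dist_norm\<close>)
  then have contF: "continuous_on UNIV (\<lambda>t. F (w t))" if "continuous_on UNIV w" for w :: "real \<Rightarrow> 'a"
    using that continuous_on_compose2 by blast
  define A where "A w = (SOME H. H 0 = 0 \<and> (\<forall>t. (H has_vector_derivative F (w t)) (at t)))" for w
  have A: "A w 0 = 0" "(A w has_vector_derivative F (w t)) (at t)" if w: "continuous_on UNIV w" for w t
  proof -
    obtain H where "H 0 = 0" "\<And>t. (H has_vector_derivative F (w t)) (at t)"
      using antiderivative_exists[OF open_UNIV connected_UNIV contF[OF w], of 0] by auto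
    then have "\<exists>H. H 0 = 0 \<and> (\<forall>t. (H has_vector_derivative F (w t)) (at t))" by blast
    from someI_ex[OF this] show "A w 0 = 0" "(A w has_vector_derivative F (w t)) (at t)"
      by (auto simp: A_def)
  qed
  \<comment> \<open>A bounded continuous \<open>v\<close> stands for the candidate
    \<open>wt v\<close>, which may grow like exp (2 L |t|); \<open>Tf\<close> is the integral
    operator conjugated by this weight.\<close>
  define wt where "wt v t = exp (2 * L * \<bar>t\<bar>) *\<^sub>R apply_bcontfun v t" for v :: "real \<Rightarrow>\<^sub>C 'a" and t
  have wt: "continuous_on UNIV (wt v)" for v
    unfolding wt_def by (intro continuous_intros) auto
  define Tf where "Tf v t = exp (- (2 * L * \<bar>t\<bar>)) *\<^sub>R (u0 + A (wt v) t)" for v t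
  have contA: "continuous_on UNIV (A (wt v))" for v
    by (intro continuous_at_imp_continuous_on ballI has_vector_derivative_continuous[OF A(2)[OF wt]])
  \<comment> \<open>The field is bounded by \<open>M\<close>, so the integral grows at most
    linearly, and |t| exp (- 2 L |t|) is at most 1 / (2 L).\<close>
  have bound: "norm (Tf v t) \<le> norm u0 + M / (2 * L)" for v t
  proof -
    have "norm (A (wt v) t) \<le> M * \<bar>t\<bar> - M * 0"
      by (rule norm_le_of_derivative_bound[where h = "\<lambda>t. F (wt v t)" and k = "\<lambda>_. M" and G = "\<lambda>t. M * t"])
         (use A[OF wt] M in \<open>auto intro!: derivative_eq_intros\<close>)
    moreover have "2 * L * \<bar>t\<bar> \<le> exp (2 * L * \<bar>t\<bar>)"
      using exp_ge_add_one_self[of "2 * L * \<bar>t\<bar>"] by linarith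
    then have "exp (- (2 * L * \<bar>t\<bar>)) * \<bar>t\<bar> \<le> 1 / (2 * L)"
      using L(1) by (simp add: exp_minus field_simps)
    moreover have "0 \<le> M" using M[of 0] norm_ge_zero order_trans by blast
    ultimately have "exp (- (2 * L * \<bar>t\<bar>)) * norm (A (wt v) t) \<le> M * (1 / (2 * L))"
      by (smt (verit) exp_ge_zero mult_left_mono mult.left_commute)
    moreover have "exp (- (2 * L * \<bar>t\<bar>)) * norm u0 \<le> 1 * norm u0"
      using L(1) by (intro mult_right_mono) auto
    moreover have "norm (Tf v t) \<le> exp (- (2 * L * \<bar>t\<bar>)) * (norm u0 + norm (A (wt v) t))"
      unfolding Tf_def norm_scaleR using norm_triangle_ineq[of u0 "A (wt v) t"]
      by (simp add: mult_left_mono)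
    ultimately show ?thesis by (simp add: distrib_left)
  qed
  have Tf: "Tf v \<in> bcontfun" for v
  proof (rule bcontfun_normI[OF _ bound])
    show "continuous_on UNIV (Tf v)"
      unfolding Tf_def by (intro continuous_intros contA)
  qed
  define T where "T v = Bcontfun (Tf v)" for v
  have T: "apply_bcontfun (T v) = Tf v" for v
    using Tf by (simp add: T_def Bcontfun_inverse)
  have "\<forall>v w. dist (T v) (T w) \<le> (1/2) * dist v w"
  proof (intro allI dist_bound)
    fix v w t
    \<comment> \<open>The integrand is at most L exp (2 L |s|) times the distance, and integration
      produces the factor 1/2; this is why the weight has the exponent 2 L and not L.\<close>
    have "norm (A (wt v) t - A (wt w) t)
        \<le> dist v w / 2 * exp (2 * L * \<bar>t\<bar>) - dist v w / 2 * exp (2 * L * 0)"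
    proof (rule norm_le_of_derivative_bound[where h = "\<lambda>t. F (wt v t) - F (wt w t)"
          and k = "\<lambda>t. L * (exp (2 * L * t) * dist v w)" and G = "\<lambda>t. dist v w / 2 * exp (2 * L * t)"
          and H = "\<lambda>t. A (wt v) t - A (wt w) t"])
      fix t
      have "norm (F (wt v t) - F (wt w t)) \<le> L * norm (wt v t - wt w t)" by (rule L(2))
      also have "norm (wt v t - wt w t) = exp (2 * L * \<bar>t\<bar>) * dist (v t) (w t)"
        by (simp add: wt_def dist_norm flip: scaleR_diff_right)
      also have "\<dots> \<le> exp (2 * L * \<bar>t\<bar>) * dist v w"
        by (intro mult_left_mono dist_bounded) auto
      finally show "norm (F (wt v t) - F (wt w t)) \<le> L * (exp (2 * L * \<bar>t\<bar>) * dist v w)"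
        using L(1) by simp
    qed (use A[OF wt] in \<open>auto intro!: derivative_eq_intros has_vector_derivative_diff\<close>)
    also have "\<dots> \<le> dist v w / 2 * exp (2 * L * \<bar>t\<bar>)" by simp
    finally have "exp (- (2 * L * \<bar>t\<bar>)) * norm (A (wt v) t - A (wt w) t)
        \<le> exp (- (2 * L * \<bar>t\<bar>)) * (dist v w / 2 * exp (2 * L * \<bar>t\<bar>))"
      by (intro mult_left_mono) auto
    then have "exp (- (2 * L * \<bar>t\<bar>)) * norm (A (wt v) t - A (wt w) t) \<le> dist v w / 2"
      by (simp add: exp_minus field_simps)
    moreover have "dist (T v t) (T w t) = exp (- (2 * L * \<bar>t\<bar>)) * norm (A (wt v) t - A (wt w) t)"
      by (simp add: T Tf_def dist_norm flip: scaleR_diff_right)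
    ultimately show "dist (T v t) (T w t) \<le> (1/2) * dist v w" by simp
  qed
  then obtain v where v: "T v = v"
    using banach_fix_type[of "1/2" T] by auto
  have wt_eq: "wt v t = u0 + A (wt v) t" for t
  proof -
    have "apply_bcontfun v t = exp (- (2 * L * \<bar>t\<bar>)) *\<^sub>R (u0 + A (wt v) t)"
      using T[of v] v by (simp add: Tf_def)
    then show ?thesis by (simp add: wt_def flip: exp_add)
  qed
  show ?thesis
  proof
    show "wt v 0 = u0" using wt_eq[of 0] A(1)[OF wt] by simp
    fix t
    have "((\<lambda>t. u0 + A (wt v) t) has_vector_derivative 0 + F (wt v t)) (at t)"
      by (intro has_vector_derivative_add has_vector_derivative_const A(2)[OF wt])
    then have "(wt v has_vector_derivative 0 + F (wt v t)) (at t)"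
      by (rule has_vector_derivative_transform_within_open[OF _ open_UNIV UNIV_I]) (rule wt_eq[symmetric])
    then show "(wt v has_vector_derivative F (wt v t)) (at t)" by simp
  qed
qed

text \<open>\<open>D * exp (- L * p)\<close> does not increase and \<open>D * exp (L * p)\<close>
  does not decrease, which gives both time directions. The clock \<open>p\<close> only has to be
  nondecreasing, so the inequality can be used under a change of time; for \<open>L = 0\<close> it
  expresses that \<open>D\<close> is constant.\<close>

lemma gronwall:
  fixes D p :: "real \<Rightarrow> real"
  assumes I: "connected I" "s \<in> I" "t \<in> I"
    and D: "\<And>u. u \<in> I \<Longrightarrow> (D has_real_derivative D' u) (at u)"
    and p: "\<And>u. u \<in> I \<Longrightarrow> (p has_real_derivative p' u) (at u)" "\<And>u. u \<in> I \<Longrightarrow> 0 \<le> p' u"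
    and le: "\<And>u. u \<in> I \<Longrightarrow> \<bar>D' u\<bar> \<le> L * p' u * D u"
  shows "D t \<le> D s * exp (L * \<bar>p t - p s\<bar>)"
proof (cases "s \<le> t")
  case True
  then have sub: "{s..t} \<subseteq> I" using connected_contains_Icc I by blast
  have "p s \<le> p t"
  proof (rule DERIV_nonneg_imp_nondecreasing[OF True])
    fix u assume "s \<le> u" "u \<le> t"
    then have "u \<in> I" using sub by auto
    then show "\<exists>y. (p has_real_derivative y) (at u) \<and> 0 \<le> y" using p by blast
  qed
  have "D t * exp (- (L * p t)) \<le> D s * exp (- (L * p s))"
  proof (rule DERIV_nonpos_imp_nonincreasing[OF True])
    fix u assume "s \<le> u" "u \<le> t"
    then have u: "u \<in> I" using sub by auto
    have "((\<lambda>u. D u * exp (- (L * p u))) has_real_derivative (D' u - L * p' u * D u) * exp (- (L * p u))) (at u)"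
      by (auto intro!: derivative_eq_intros D[OF u] p(1)[OF u] simp: algebra_simps)
    then show "\<exists>y. ((\<lambda>u. D u * exp (- (L * p u))) has_real_derivative y) (at u) \<and> y \<le> 0"
      using le[OF u] by (intro exI conjI) (auto intro!: mult_nonpos_nonneg)
  qed
  then have "D t \<le> D s * exp (L * (p t - p s))"
    by (simp add: exp_minus right_diff_distrib exp_diff field_simps)
  then show ?thesis using \<open>p s \<le> p t\<close> by simp
next
  case False
  then have le': "t \<le> s" by simp
  have sub: "{t..s} \<subseteq> I" using connected_contains_Icc I by blast
  have "p t \<le> p s"
  proof (rule DERIV_nonneg_imp_nondecreasing[OF le'])
    fix u assume "t \<le> u" "u \<le> s"
    then have "u \<in> I" using sub by auto
    then show "\<exists>y. (p has_real_derivative y) (at u) \<and> 0 \<le> y" using p by blast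
  qed
  have "D t * exp (L * p t) \<le> D s * exp (L * p s)"
  proof (rule DERIV_nonneg_imp_nondecreasing[OF le'])
    fix u assume "t \<le> u" "u \<le> s"
    then have u: "u \<in> I" using sub by auto
    have "((\<lambda>u. D u * exp (L * p u)) has_real_derivative (D' u + L * p' u * D u) * exp (L * p u)) (at u)"
      by (auto intro!: derivative_eq_intros D[OF u] p(1)[OF u] simp: algebra_simps)
    then show "\<exists>y. ((\<lambda>u. D u * exp (L * p u)) has_real_derivative y) (at u) \<and> 0 \<le> y"
      using le[OF u] by (intro exI conjI) auto
  qed
  then have "D t \<le> D s * exp (L * (p s - p t))"
    by (simp add: exp_minus right_diff_distrib exp_diff field_simps)
  then show ?thesis using \<open>p t \<le> p s\<close> by simp
qed

subsection \<open>The angle system\<close>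

text \<open>With \<open>\<theta>\<close> the tangent angle and \<open>y = tan \<phi>\<close> the height of the curve, and arc length \<open>s\<close>
  replaced by the time with \<open>ds = cos\<^sup>3 \<phi> dt\<close>, the equation becomes a bounded, globally
  Lipschitz system. The factor \<open>r\<close> allows for an arbitrary change of time.\<close>

definition angle_system :: "real set \<Rightarrow> (real \<Rightarrow> real) \<Rightarrow> (real \<Rightarrow> real) \<Rightarrow> (real \<Rightarrow> real) \<Rightarrow> (real \<Rightarrow> real) \<Rightarrow> bool"
  where "angle_system I r \<theta> \<phi> x \<longleftrightarrow> (\<forall>u\<in>I.
    (\<theta> has_real_derivative r u * - (sin (\<theta> u + \<phi> u) ^ 3)) (at u) \<and>
    (\<phi> has_real_derivative r u * (sin (\<theta> u) * cos (\<phi> u) ^ 5)) (at u) \<and>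
    (x has_real_derivative r u * (cos (\<theta> u) * cos (\<phi> u) ^ 3)) (at u) \<and> \<bar>\<phi> u\<bar> < pi / 2)"

abbreviation angle_flow :: "(real \<Rightarrow> real) \<Rightarrow> (real \<Rightarrow> real) \<Rightarrow> (real \<Rightarrow> real) \<Rightarrow> bool"
  where "angle_flow \<equiv> angle_system UNIV (\<lambda>_. 1)"

lemma abs_sin_diff_le: "\<bar>sin a - sin b\<bar> \<le> \<bar>a - b\<bar>" for a b :: real
proof -
  have "\<bar>sin a - sin b\<bar> = 2 * \<bar>sin ((a - b) / 2)\<bar> * \<bar>cos ((a + b) / 2)\<bar>"
    by (simp add: sin_diff_sin abs_mult)
  also have "\<dots> \<le> 2 * \<bar>sin ((a - b) / 2)\<bar> * 1"
    by (intro mult_left_mono) auto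
  also have "\<dots> \<le> 2 * \<bar>(a - b) / 2\<bar>"
    using abs_sin_x_le_abs_x[of "(a - b) / 2"] by simp
  finally show ?thesis by simp
qed

lemma abs_cos_diff_le: "\<bar>cos a - cos b\<bar> \<le> \<bar>a - b\<bar>" for a b :: real
  using abs_sin_diff_le[of "a + pi/2" "b + pi/2"] by (simp add: sin_add)

lemma abs_power_diff_le:
  fixes a b :: real
  assumes "\<bar>a\<bar> \<le> 1" "\<bar>b\<bar> \<le> 1"
  shows "\<bar>a ^ n - b ^ n\<bar> \<le> real n * \<bar>a - b\<bar>"
proof (induction n)
  case (Suc n)
  have "\<bar>a ^ Suc n - b ^ Suc n\<bar> = \<bar>a * (a ^ n - b ^ n) + (a - b) * b ^ n\<bar>" by (simp add: algebra_simps)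
  also have "\<dots> \<le> \<bar>a\<bar> * \<bar>a ^ n - b ^ n\<bar> + \<bar>a - b\<bar> * \<bar>b\<bar> ^ n"
    by (metis abs_mult abs_triangle_ineq power_abs)
  also have "\<dots> \<le> 1 * (real n * \<bar>a - b\<bar>) + \<bar>a - b\<bar> * 1"
    using assms Suc by (intro add_mono mult_mono power_le_one) auto
  finally show ?case by (simp add: algebra_simps)
qed simp

lemma angle_field_lipschitz:
  fixes a b c d :: real
  shows "\<bar>- (sin (a + b) ^ 3) - - (sin (c + d) ^ 3)\<bar> \<le> 3 * (\<bar>a - c\<bar> + \<bar>b - d\<bar>)"
    and "\<bar>sin a * cos b ^ 5 - sin c * cos d ^ 5\<bar> \<le> \<bar>a - c\<bar> + 5 * \<bar>b - d\<bar>"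
proof -
  have "\<bar>- (sin (a + b) ^ 3) - - (sin (c + d) ^ 3)\<bar> = \<bar>sin (a + b) ^ 3 - sin (c + d) ^ 3\<bar>" by linarith
  also have "\<dots> \<le> real 3 * \<bar>sin (a + b) - sin (c + d)\<bar>" by (rule abs_power_diff_le) auto
  also have "\<dots> \<le> 3 * (\<bar>a - c\<bar> + \<bar>b - d\<bar>)"
    using abs_sin_diff_le[of "a + b" "c + d"] by (simp add: abs_if split: if_splits)
  finally show "\<bar>- (sin (a + b) ^ 3) - - (sin (c + d) ^ 3)\<bar> \<le> 3 * (\<bar>a - c\<bar> + \<bar>b - d\<bar>)" .
  have "\<bar>sin a * cos b ^ 5 - sin c * cos d ^ 5\<bar>
      = \<bar>(sin a - sin c) * cos b ^ 5 + sin c * (cos b ^ 5 - cos d ^ 5)\<bar>" by (simp add: algebra_simps)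
  also have "\<dots> \<le> \<bar>sin a - sin c\<bar> * \<bar>cos b\<bar> ^ 5 + \<bar>sin c\<bar> * \<bar>cos b ^ 5 - cos d ^ 5\<bar>"
    by (metis abs_mult abs_triangle_ineq power_abs)
  also have "\<dots> \<le> \<bar>a - c\<bar> * 1 + 1 * (real 5 * \<bar>b - d\<bar>)"
  proof (intro add_mono mult_mono)
    show "\<bar>cos b ^ 5 - cos d ^ 5\<bar> \<le> real 5 * \<bar>b - d\<bar>"
      using abs_power_diff_le[of "cos b" "cos d" 5] abs_cos_diff_le[of b d] by simp
  qed (auto simp: abs_sin_diff_le power_le_one)
  finally show "\<bar>sin a * cos b ^ 5 - sin c * cos d ^ 5\<bar> \<le> \<bar>a - c\<bar> + 5 * \<bar>b - d\<bar>" by simp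
qed

lemma DERIV_diff_square:
  fixes f g :: "real \<Rightarrow> real"
  assumes "(f has_real_derivative r * F) (at u)" "(g has_real_derivative G * r) (at u)"
  shows "((\<lambda>u. (f u - g u)\<^sup>2) has_real_derivative 2 * r * ((f u - g u) * (F - G))) (at u)"
  using assms by (auto intro!: derivative_eq_intros simp: algebra_simps)

lemma DERIV_sum_diff_squares:
  fixes f g :: "real \<Rightarrow> real"
  assumes "(f has_real_derivative r * F) (at u)" "(g has_real_derivative G * r) (at u)"
    and "(h has_real_derivative r * H) (at u)" "(k has_real_derivative K * r) (at u)"
  shows "((\<lambda>u. (f u - g u)\<^sup>2 + (h u - k u)\<^sup>2) has_real_derivative
    2 * r * ((f u - g u) * (F - G) + (h u - k u) * (H - K))) (at u)"
  using DERIV_add[OF DERIV_diff_square[OF assms(1,2)] DERIV_diff_square[OF assms(3,4)]]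
  by (simp add: distrib_left)

text \<open>Two solutions run by the same clock: the Lipschitz constants 3, 1 and 5 of the field
  lead to a quadratic form bounded by 10 times the squared distance, and differentiating a square
  doubles this to 20.\<close>

lemma angle_system_compare:
  assumes I: "connected I" "s \<in> I" "t \<in> I"
    and u: "angle_system I r \<theta>1 \<phi>1 x1" and r: "\<And>u. u \<in> I \<Longrightarrow> 0 \<le> r u"
    and p: "\<And>u. u \<in> I \<Longrightarrow> (p has_real_derivative r u) (at u)"
    and v: "angle_flow \<theta>2 \<phi>2 x2"
  shows "(\<theta>1 t - \<theta>2 (p t))\<^sup>2 + (\<phi>1 t - \<phi>2 (p t))\<^sup>2
    \<le> ((\<theta>1 s - \<theta>2 (p s))\<^sup>2 + (\<phi>1 s - \<phi>2 (p s))\<^sup>2) * exp (20 * \<bar>p t - p s\<bar>)"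
proof (rule gronwall[OF I, where p = p and p' = r and L = 20 and
      D = "\<lambda>u. (\<theta>1 u - \<theta>2 (p u))\<^sup>2 + (\<phi>1 u - \<phi>2 (p u))\<^sup>2" and
      D' = "\<lambda>u. 2 * r u * ((\<theta>1 u - \<theta>2 (p u)) *
          (- (sin (\<theta>1 u + \<phi>1 u) ^ 3) - - (sin (\<theta>2 (p u) + \<phi>2 (p u)) ^ 3)) +
        (\<phi>1 u - \<phi>2 (p u)) *
          (sin (\<theta>1 u) * cos (\<phi>1 u) ^ 5 - sin (\<theta>2 (p u)) * cos (\<phi>2 (p u)) ^ 5))"])
  fix u assume u': "u \<in> I"
  let ?A = "\<theta>1 u - \<theta>2 (p u)" and ?B = "\<phi>1 u - \<phi>2 (p u)"
  let ?F = "- (sin (\<theta>1 u + \<phi>1 u) ^ 3) - - (sin (\<theta>2 (p u) + \<phi>2 (p u)) ^ 3)"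
  let ?G = "sin (\<theta>1 u) * cos (\<phi>1 u) ^ 5 - sin (\<theta>2 (p u)) * cos (\<phi>2 (p u)) ^ 5"
  have d: "(\<theta>1 has_real_derivative r u * - (sin (\<theta>1 u + \<phi>1 u) ^ 3)) (at u)"
    "(\<phi>1 has_real_derivative r u * (sin (\<theta>1 u) * cos (\<phi>1 u) ^ 5)) (at u)"
    using u u' by (auto simp: angle_system_def)
  have e: "((\<lambda>u. \<theta>2 (p u)) has_real_derivative - (sin (\<theta>2 (p u) + \<phi>2 (p u)) ^ 3) * r u) (at u)"
    "((\<lambda>u. \<phi>2 (p u)) has_real_derivative (sin (\<theta>2 (p u)) * cos (\<phi>2 (p u)) ^ 5) * r u) (at u)"
    by (rule DERIV_chain2[OF _ p[OF u']], use v in \<open>simp add: angle_system_def\<close>)+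
  show "((\<lambda>u. (\<theta>1 u - \<theta>2 (p u))\<^sup>2 + (\<phi>1 u - \<phi>2 (p u))\<^sup>2) has_real_derivative
      2 * r u * (?A * ?F + ?B * ?G)) (at u)"
    by (rule DERIV_sum_diff_squares[OF d(1) e(1) d(2) e(2)])
  have "\<bar>?A * ?F + ?B * ?G\<bar> \<le> \<bar>?A\<bar> * \<bar>?F\<bar> + \<bar>?B\<bar> * \<bar>?G\<bar>"
    unfolding abs_mult[symmetric] by (rule abs_triangle_ineq)
  also have "\<dots> \<le> \<bar>?A\<bar> * (3 * (\<bar>?A\<bar> + \<bar>?B\<bar>)) + \<bar>?B\<bar> * (\<bar>?A\<bar> + 5 * \<bar>?B\<bar>)"
    by (intro add_mono mult_left_mono angle_field_lipschitz) auto
  also have "\<dots> \<le> 10 * (\<bar>?A\<bar>\<^sup>2 + \<bar>?B\<bar>\<^sup>2)"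
  proof -
    have "a * (3 * (a + b)) + b * (a + 5 * b) \<le> 10 * (a\<^sup>2 + b\<^sup>2)" for a b :: real
    proof -
      have "10 * (a\<^sup>2 + b\<^sup>2) - (a * (3 * (a + b)) + b * (a + 5 * b)) = 2 * (a - b)\<^sup>2 + 5 * a\<^sup>2 + 3 * b\<^sup>2"
        by (simp add: algebra_simps power2_eq_square)
      then show ?thesis by (smt (verit) zero_le_power2)
    qed
    then show ?thesis .
  qed
  also have "\<dots> = 10 * (?A\<^sup>2 + ?B\<^sup>2)" by simp
  finally have **: "2 * r u * \<bar>?A * ?F + ?B * ?G\<bar> \<le> 2 * r u * (10 * (?A\<^sup>2 + ?B\<^sup>2))"
    using r[OF u'] by (intro mult_left_mono) auto
  show "\<bar>2 * r u * (?A * ?F + ?B * ?G)\<bar> \<le> 20 * r u * (?A\<^sup>2 + ?B\<^sup>2)"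
  proof -
    have *: "\<bar>2 * R * X\<bar> \<le> 20 * R * Z" if "2 * R * \<bar>X\<bar> \<le> 2 * R * (10 * Z)" "0 \<le> R" for R X Z :: real
      using that by (simp add: abs_mult)
    from *[OF ** r[OF u']] show ?thesis .
  qed
qed (rule p, assumption, rule r, assumption)

text \<open>Uniqueness and reparametrization at once: distance zero at \<open>s\<close> forces
  distance zero everywhere, so a solution with rate \<open>r\<close> is a flow line read off at the
  clock \<open>p\<close>. The abscissa comes last, as its derivative is determined by the
  angles.\<close>

lemma angle_system_factor:
  assumes I: "connected I" "s \<in> I" "t \<in> I"
    and u: "angle_system I r \<theta>1 \<phi>1 x1" and r: "\<And>u. u \<in> I \<Longrightarrow> 0 \<le> r u"
    and p: "\<And>u. u \<in> I \<Longrightarrow> (p has_real_derivative r u) (at u)"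
    and v: "angle_flow \<theta>2 \<phi>2 x2"
    and s: "\<theta>1 s = \<theta>2 (p s)" "\<phi>1 s = \<phi>2 (p s)" "x1 s = x2 (p s)"
  shows "\<theta>1 t = \<theta>2 (p t) \<and> \<phi>1 t = \<phi>2 (p t) \<and> x1 t = x2 (p t)"
proof -
  have eq: "\<theta>1 t = \<theta>2 (p t) \<and> \<phi>1 t = \<phi>2 (p t)" if "t \<in> I" for t
  proof -
    have "(\<theta>1 t - \<theta>2 (p t))\<^sup>2 + (\<phi>1 t - \<phi>2 (p t))\<^sup>2 \<le> 0"
      using angle_system_compare[OF I(1,2) that u r p v] s(1,2) by simp
    then show ?thesis by (simp add: sum_power2_le_zero_iff)
  qed
  have "(x1 t - x2 (p t))\<^sup>2 \<le> (x1 s - x2 (p s))\<^sup>2 * exp (0 * \<bar>p t - p s\<bar>)"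
  proof (rule gronwall[OF I, where D = "\<lambda>t. (x1 t - x2 (p t))\<^sup>2" and p = p and p' = r and D' = "\<lambda>_. 0"])
    fix u assume u': "u \<in> I"
    have a: "((\<lambda>u. x2 (p u)) has_real_derivative (1 * (cos (\<theta>2 (p u)) * cos (\<phi>2 (p u)) ^ 3)) * r u) (at u)"
      by (rule DERIV_chain2[OF _ p[OF u']]) (rule v[unfolded angle_system_def, rule_format, THEN conjunct2, THEN conjunct2, THEN conjunct1, OF UNIV_I])
    have b: "(x1 has_real_derivative r u * (cos (\<theta>1 u) * cos (\<phi>1 u) ^ 3)) (at u)"
      by (rule u[unfolded angle_system_def, rule_format, THEN conjunct2, THEN conjunct2, THEN conjunct1, OF u'])
    show "((\<lambda>u. (x1 u - x2 (p u))\<^sup>2) has_real_derivative 0) (at u)"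
      by (rule DERIV_cong[OF DERIV_diff_square[OF b a]]) (simp add: eq[OF u'])
    show "\<bar>0\<bar> \<le> 0 * r u * (x1 u - x2 (p u))\<^sup>2" by simp
  qed (rule p, assumption, rule r, assumption)
  then show ?thesis using s(3) eq[OF I(3)] by simp
qed

lemma angle_flow_unique:
  assumes "angle_flow \<theta>1 \<phi>1 x1" "angle_flow \<theta>2 \<phi>2 x2"
    and "\<theta>1 s = \<theta>2 s" "\<phi>1 s = \<phi>2 s" "x1 s = x2 s"
  shows "\<theta>1 = \<theta>2 \<and> \<phi>1 = \<phi>2 \<and> x1 = x2"
proof -
  have id: "((\<lambda>t. t) has_real_derivative 1) (at u)" for u :: real by (rule DERIV_ident)
  have "\<theta>1 t = \<theta>2 t \<and> \<phi>1 t = \<phi>2 t \<and> x1 t = x2 t" for t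
    by (rule angle_system_factor[OF connected_UNIV UNIV_I UNIV_I assms(1) zero_le_one id assms(2-5)])
  then show ?thesis by (simp add: fun_eq_iff)
qed

lemma continuous_reaches:
  fixes h :: "real \<Rightarrow> real"
  assumes "connected I" "continuous_on I h" "a \<in> I" "b \<in> I" "h a \<le> c" "c \<le> h b"
  shows "\<exists>t\<in>I. h t = c"
proof -
  have "connected (h ` I)" using assms connected_continuous_image by blast
  then have "{h a..h b} \<subseteq> h ` I" using connected_contains_Icc assms by blast
  then show ?thesis using assms by auto
qed

text \<open>The field of the two angles alone is bounded and globally Lipschitz; the abscissa is
  then an integral.\<close>

lemma angle_flow_exists:
  fixes a b c :: real
  assumes "\<bar>b\<bar> < pi / 2"
  obtains \<theta> \<phi> x where "angle_flow \<theta> \<phi> x" "\<theta> 0 = a" "\<phi> 0 = b" "x 0 = c"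
proof -
  define F where "F q = (- (sin (fst q + snd q) ^ 3), sin (fst q) * cos (snd q) ^ 5)" for q :: "real \<times> real"
  have lip: "norm (F p - F q) \<le> 16 * norm (p - q)" for p q
  proof -
    have "norm (F p - F q) \<le> \<bar>fst (F p - F q)\<bar> + \<bar>snd (F p - F q)\<bar>"
      by (metis norm_Pair_le prod.collapse real_norm_def)
    also have "\<dots> \<le> 3 * (\<bar>fst p - fst q\<bar> + \<bar>snd p - snd q\<bar>) + (\<bar>fst p - fst q\<bar> + 5 * \<bar>snd p - snd q\<bar>)"
      unfolding F_def fst_diff snd_diff fst_conv snd_conv
      by (intro add_mono angle_field_lipschitz)
    also have "\<dots> \<le> 4 * norm (p - q) + 8 * norm (p - q)"
      using norm_fst_le[of "fst (p - q)" "snd (p - q)"] norm_snd_le[of "snd (p - q)" "fst (p - q)"]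
      by (simp flip: fst_diff snd_diff)
    finally show ?thesis using norm_ge_zero[of "p - q"] by linarith
  qed
  have bound: "norm (F p) \<le> 2" for p
  proof -
    have "norm (F p) \<le> \<bar>fst (F p)\<bar> + \<bar>snd (F p)\<bar>"
      using norm_Pair_le[of "fst (F p)" "snd (F p)"] by simp
    also have "\<dots> \<le> 1 + 1 * 1"
      unfolding F_def by (intro add_mono) (auto simp: abs_mult power_abs power_le_one intro!: mult_le_one)
    finally show ?thesis by simp
  qed
  obtain u where u: "u 0 = (a, b)" "\<And>t. (u has_vector_derivative F (u t)) (at t)"
    by (rule lipschitz_ode_exists[OF _ lip bound]) (simp, blast)
  define \<theta> \<phi> where "\<theta> = (\<lambda>t. fst (u t))" and "\<phi> = (\<lambda>t. snd (u t))"
  have \<theta>: "(\<theta> has_real_derivative - (sin (\<theta> t + \<phi> t) ^ 3)) (at t)" for t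
    using bounded_linear.has_vector_derivative[OF bounded_linear_fst u(2)[of t]]
    by (simp add: F_def \<theta>_def \<phi>_def has_real_derivative_iff_has_vector_derivative)
  have \<phi>: "(\<phi> has_real_derivative sin (\<theta> t) * cos (\<phi> t) ^ 5) (at t)" for t
    using bounded_linear.has_vector_derivative[OF bounded_linear_snd u(2)[of t]]
    by (simp add: F_def \<theta>_def \<phi>_def has_real_derivative_iff_has_vector_derivative)
  have cont: "continuous_on UNIV \<theta>" "continuous_on UNIV \<phi>"
    by (intro continuous_at_imp_continuous_on ballI DERIV_isCont[OF \<theta>] DERIV_isCont[OF \<phi>])+
  have \<phi>0: "\<phi> 0 = b" using u(1) by (simp add: \<phi>_def)
  \<comment> \<open>The relative rate of change of cos^2 \<phi> is at most 2, so a zero at time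
    \<open>t\<close> would propagate to time 0. Hence \<phi> never reaches the ends of its interval,
    where the height is infinite.\<close>
  have ne: "cos (\<phi> t) \<noteq> 0" for t
  proof
    assume t: "cos (\<phi> t) = 0"
    have "(cos (\<phi> 0))\<^sup>2 \<le> (cos (\<phi> t))\<^sup>2 * exp (2 * \<bar>0 - t\<bar>)"
    proof (rule gronwall[where I = UNIV and p = "\<lambda>t. t" and p' = "\<lambda>_. 1" and L = 2 and
          D = "\<lambda>u. (cos (\<phi> u))\<^sup>2" and D' = "\<lambda>u. - (2 * sin (\<phi> u) * sin (\<theta> u) * cos (\<phi> u) ^ 6)"])
      fix u
      show "((\<lambda>u. (cos (\<phi> u))\<^sup>2) has_real_derivative
          - (2 * sin (\<phi> u) * sin (\<theta> u) * cos (\<phi> u) ^ 6)) (at u)"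
        by (rule derivative_eq_intros \<phi> refl)+ (simp add: power_numeral_reduce)
      have "cos (\<phi> u) ^ 6 = cos (\<phi> u) ^ 4 * (cos (\<phi> u))\<^sup>2"
        using power_add[of "cos (\<phi> u)" 4 2] by simp
      then have "\<bar>- (2 * sin (\<phi> u) * sin (\<theta> u) * cos (\<phi> u) ^ 6)\<bar>
          = 2 * (\<bar>sin (\<phi> u)\<bar> * \<bar>sin (\<theta> u)\<bar> * \<bar>cos (\<phi> u)\<bar> ^ 4 * (cos (\<phi> u))\<^sup>2)"
        by (simp add: abs_mult power_abs)
      also have "\<dots> \<le> 2 * (1 * 1 * 1 * (cos (\<phi> u))\<^sup>2)"
        by (intro mult_left_mono mult_right_mono mult_mono power_le_one) auto
      finally show "\<bar>- (2 * sin (\<phi> u) * sin (\<theta> u) * cos (\<phi> u) ^ 6)\<bar> \<le> 2 * 1 * (cos (\<phi> u))\<^sup>2"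
        by simp
    qed auto
    then have "cos b = 0" using t u(1) by (simp add: \<phi>_def)
    moreover have "- (pi / 2) < b" "b < pi / 2" using assms by linarith+
    ultimately show False using cos_gt_zero_pi[of b] by simp
  qed
  have "\<bar>\<phi> t\<bar> < pi / 2" for t
  proof (rule ccontr)
    assume "\<not> \<bar>\<phi> t\<bar> < pi / 2"
    moreover have "continuous_on UNIV (\<lambda>t. \<bar>\<phi> t\<bar>)" using cont by (intro continuous_intros)
    ultimately obtain s where "\<bar>\<phi> s\<bar> = pi / 2"
      using continuous_reaches[of UNIV "\<lambda>t. \<bar>\<phi> t\<bar>" 0 t "pi / 2"] assms \<phi>0 by auto
    then have "\<phi> s = pi / 2 \<or> \<phi> s = - (pi / 2)" by linarith
    then have "cos (\<phi> s) = 0" by (metis cos_minus cos_pi_half)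
    then show False using ne[of s] by simp
  qed
  note lt = this
  have "continuous_on UNIV (\<lambda>t. cos (\<theta> t) * cos (\<phi> t) ^ 3)"
    using cont by (intro continuous_intros)
  from antiderivative_exists[OF open_UNIV connected_UNIV this UNIV_I[of 0]]
  obtain X where X: "X 0 = 0" "\<And>t. (X has_vector_derivative cos (\<theta> t) * cos (\<phi> t) ^ 3) (at t)"
    by (metis UNIV_I)
  have "((\<lambda>t. X t + c) has_real_derivative cos (\<theta> t) * cos (\<phi> t) ^ 3) (at t)" for t
    using DERIV_add[OF X(2)[of t, folded has_real_derivative_iff_has_vector_derivative] DERIV_const[of c]]
    by simp
  then have "angle_flow \<theta> \<phi> (\<lambda>t. X t + c)"
    using \<theta> \<phi> lt by (simp add: angle_system_def)
  then show ?thesis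
    by (rule that) (use u(1) X(1) in \<open>simp_all add: \<theta>_def \<phi>_def\<close>)
qed

section \<open>Symmetries of the angle system\<close>

lemma angle_system_reflect:
  "angle_system I r \<theta> \<phi> x \<Longrightarrow> angle_system I r (\<lambda>t. - \<theta> t) (\<lambda>t. - \<phi> t) x"
proof -
  have "sin (- a - b) = - sin (a + b)" for a b :: real
    by (metis minus_add_distrib sin_minus diff_conv_add_uminus)
  then show "angle_system I r \<theta> \<phi> x \<Longrightarrow> ?thesis"
    unfolding angle_system_def by (auto intro!: derivative_eq_intros)
qed

lemma angle_system_translate:
  "angle_system I r \<theta> \<phi> x \<Longrightarrow> angle_system I r \<theta> \<phi> (\<lambda>t. x t + c)"
  unfolding angle_system_def by (auto intro!: derivative_eq_intros)

lemma angle_system_full_turns: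
  assumes "angle_system I r \<theta> \<phi> x"
  shows "angle_system I r (\<lambda>t. \<theta> t + 2 * pi * of_int k) \<phi> x"
proof -
  have [simp]: "sin (t + 2 * pi * of_int k) = sin t" "cos (t + 2 * pi * of_int k) = cos t" for t :: real
    by (simp_all add: sin_add cos_add sin_int_2pin cos_int_2pin)
  have eq: "\<theta> t + 2 * pi * of_int k + \<phi> t = \<theta> t + \<phi> t + 2 * pi * of_int k" for t by simp
  then show ?thesis
    using assms unfolding angle_system_def
    by (auto intro!: derivative_eq_intros simp: eq)
qed

lemma angle_flow_shift:
  assumes "angle_flow \<theta> \<phi> x"
  shows "angle_flow (\<lambda>t. \<theta> (t + c)) (\<lambda>t. \<phi> (t + c)) (\<lambda>t. x (t + c))"
  using assms unfolding angle_system_def by (auto simp flip: DERIV_shift)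

text \<open>Travelling in the opposite direction turns the tangent by pi, and each of the three
  right sides changes its sign under this turn.\<close>

lemma angle_flow_reverse:
  assumes "angle_flow \<theta> \<phi> x"
  shows "angle_flow (\<lambda>t. \<theta> (- t) + pi) (\<lambda>t. \<phi> (- t)) (\<lambda>t. x (- t))"
proof -
  have *: "((\<lambda>t. h (- t)) has_real_derivative - h') (at t)" if "(h has_real_derivative h') (at (- t))" for h h' t
    using that DERIV_mirror by blast
  have s: "sin (a + pi + b) = - sin (a + b)" for a b :: real
    by (simp add: sin_add cos_add)
  show ?thesis
    unfolding angle_system_def
  proof (intro ballI conjI)
    fix u
    show "((\<lambda>t. \<theta> (- t) + pi) has_real_derivative 1 * - (sin (\<theta> (- u) + pi + \<phi> (- u)) ^ 3)) (at u)"
      using *[of \<theta> "- (sin (\<theta> (- u) + \<phi> (- u)) ^ 3)" u] assms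
      by (auto simp: s angle_system_def intro!: derivative_eq_intros)
    show "((\<lambda>t. \<phi> (- t)) has_real_derivative 1 * (sin (\<theta> (- u) + pi) * cos (\<phi> (- u)) ^ 5)) (at u)"
      using *[of \<phi> "sin (\<theta> (- u)) * cos (\<phi> (- u)) ^ 5" u] assms by (simp add: angle_system_def)
    show "((\<lambda>t. x (- t)) has_real_derivative 1 * (cos (\<theta> (- u) + pi) * cos (\<phi> (- u)) ^ 3)) (at u)"
      using *[of x "cos (\<theta> (- u)) * cos (\<phi> (- u)) ^ 3" u] assms by (simp add: angle_system_def)
    show "\<bar>\<phi> (- u)\<bar> < pi / 2"
      using assms by (auto simp: angle_system_def)
  qed
qed

section \<open>First zeros of continuous functions\<close>

lemma first_zero_right:
  fixes h :: "real \<Rightarrow> real"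
  assumes "continuous_on {a..b} h" "a \<le> b" "0 < h a" "h b \<le> 0"
  obtains c where "a < c" "c \<le> b" "h c = 0" "\<And>t. a \<le> t \<Longrightarrow> t < c \<Longrightarrow> 0 < h t"
proof -
  define S where "S = {t \<in> {a..b}. h t = 0}"
  have S: "S = {a..b} \<inter> h -` {0}" by (auto simp: S_def)
  have "closed S" unfolding S
    using assms(1) by (intro continuous_closed_preimage) auto
  moreover have "S \<noteq> {}"
    using IVT2'[of h b 0 a] assms by (auto simp: S_def)
  moreover have "bdd_below S" by (auto simp: S_def intro!: bdd_belowI[of _ a])
  ultimately have c: "Inf S \<in> S" by (intro closed_contains_Inf)
  show ?thesis
  proof
    show "Inf S \<le> b" "h (Inf S) = 0" using c by (auto simp: S_def)
    then show "a < Inf S" using c assms(3) by (auto simp: S_def order.order_iff_strict)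
    fix t assume t: "a \<le> t" "t < Inf S"
    show "0 < h t"
    proof (rule ccontr)
      assume "\<not> 0 < h t"
      moreover have "continuous_on {a..t} h"
        using assms(1) by (rule continuous_on_subset) (use t \<open>Inf S \<le> b\<close> in auto)
      ultimately obtain s where "s \<ge> a" "s \<le> t" "h s = 0"
        using IVT2'[of h t 0 a] assms t by auto
      then have "s \<in> S" using t \<open>Inf S \<le> b\<close> by (auto simp: S_def)
      then show False using cInf_lower[OF _ \<open>bdd_below S\<close>] t \<open>s \<le> t\<close> by fastforce
    qed
  qed
qed

lemma first_zero_left:
  fixes h :: "real \<Rightarrow> real"
  assumes "continuous_on {a..b} h" "a \<le> b" "0 < h b" "h a \<le> 0"
  obtains c where "a \<le> c" "c < b" "h c = 0" "\<And>t. c < t \<Longrightarrow> t \<le> b \<Longrightarrow> 0 < h t"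
proof -
  have "continuous_on {- b..- a} (\<lambda>t. h (- t))"
    by (rule continuous_on_compose2[OF assms(1)]) (auto intro!: continuous_intros)
  then obtain c where "- b < c" "c \<le> - a" "h (- c) = 0" "\<And>t. - b \<le> t \<Longrightarrow> t < c \<Longrightarrow> 0 < h (- t)"
    using first_zero_right[of "- b" "- a" "\<lambda>t. h (- t)"] assms by auto
  note c = this
  show ?thesis
  proof (rule that[of "- c"])
    fix t assume "- c < t" "t \<le> b"
    then show "0 < h t" using c(4)[of "- t"] by simp
  qed (use c in auto)
qed

subsection \<open>Energy\<close>

text \<open>The energy of f'' = - f^3, which is the graph equation f'' = - (f + f')^3 without the
  terms that contain the slope.\<close>

definition energy :: "real \<Rightarrow> real \<Rightarrow> real" where
  "energy p q = p ^ 4 / 4 + q\<^sup>2 / 2"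

lemma energy_nonneg: "0 \<le> energy p q"
  by (simp add: energy_def)

text \<open>The factor \<open>m\<close> is the rate of the abscissa in the time used, so one
  computation covers graphs, where m = 1, and flow lines.\<close>

lemma energy_deriv:
  assumes "(f has_real_derivative m * g t) (at t)"
    and "(g has_real_derivative - (m * (f t + g t) ^ 3)) (at t)"
  shows "((\<lambda>t. energy (f t) (g t)) has_real_derivative
    m * (f t ^ 3 * g t - g t * (f t + g t) ^ 3)) (at t)"
  unfolding energy_def using assms
  by (auto intro!: derivative_eq_intros simp: power2_eq_square algebra_simps)

text \<open>The exact rate is - q^2 (3 p^2 + 3 p q + q^2). The constants 1/2 and 1/10 are chosen so
  that what remains is a multiple of a square.\<close>

lemma energy_deriv_le:
  fixes p q :: real
  shows "p ^ 3 * q - q * (p + q) ^ 3 \<le> - (p\<^sup>2 * q\<^sup>2 / 2) - q ^ 4 / 10"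
proof -
  have "- (p\<^sup>2 * q\<^sup>2 / 2) - q ^ 4 / 10 - (p ^ 3 * q - q * (p + q) ^ 3) = 5 / 2 * (q * (p + 3 / 5 * q))\<^sup>2"
    by (simp add: algebra_simps power2_eq_square power3_eq_cube power4_eq_xxxx)
  moreover have "0 \<le> 5 / 2 * (q * (p + 3 / 5 * q))\<^sup>2" by simp
  ultimately show ?thesis by linarith
qed

text \<open>The corrected energy \<open>energy f g + \<epsilon> f\<^sup>3 g\<close> decreases at a rate bounded away from zero
  as long as the energy stays between two positive bounds.\<close>

lemma corrected_energy_deriv_le:
  fixes p q e M :: real
  assumes M: "1 \<le> M" "\<bar>p\<bar> \<le> M" "\<bar>q\<bar> \<le> M" and e: "0 < e" "e \<le> energy p q"
  shows "p ^ 3 * q - q * (p + q) ^ 3 + (3 * p\<^sup>2 * q\<^sup>2 - p ^ 3 * (p + q) ^ 3) / (10 * M\<^sup>2)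
    \<le> - (e\<^sup>2 / (20 * M ^ 4))"
proof -
  have pM: "p\<^sup>2 \<le> M\<^sup>2" "q\<^sup>2 \<le> M\<^sup>2" using M by (auto simp: abs_le_square_iff[symmetric])
  have M2: "1 \<le> M\<^sup>2" using M by (simp add: one_le_power)
  \<comment> \<open>The difference of the bases is (p + q)^2 / 2, and cubing preserves order. So the
    correction contributes a decrease of order p^6 up to terms with a factor q^2, which the decrease
    of the energy itself absorbs. This supplies a decrease where the slope vanishes and the energy
    stagnates.\<close>
  have "((p\<^sup>2 - q\<^sup>2) / 2) ^ 3 \<le> (p\<^sup>2 + p * q) ^ 3"
  proof (rule power_mono_odd)
    have "p\<^sup>2 + p * q - (p\<^sup>2 - q\<^sup>2) / 2 = (p + q)\<^sup>2 / 2" by (simp add: power2_eq_square field_simps)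
    moreover have "0 \<le> (p + q)\<^sup>2 / 2" by simp
    ultimately show "(p\<^sup>2 - q\<^sup>2) / 2 \<le> p\<^sup>2 + p * q" by linarith
  qed simp
  moreover have "(p\<^sup>2 + p * q) ^ 3 = p ^ 3 * (p + q) ^ 3"
    by (simp add: power2_eq_square flip: power_mult_distrib distrib_left)
  moreover have "((p\<^sup>2 - q\<^sup>2) / 2) ^ 3 = (p ^ 6 - 3 * (p\<^sup>2 * (p\<^sup>2 * q\<^sup>2)) + 3 * (p\<^sup>2 * q ^ 4) - q\<^sup>2 * q ^ 4) / 8"
    by (simp add: field_simps power2_eq_square power3_eq_cube power4_eq_xxxx power_numeral_reduce)
  ultimately have a1: "p ^ 3 * (p + q) ^ 3 \<ge> (p ^ 6 - 3 * (p\<^sup>2 * (p\<^sup>2 * q\<^sup>2)) + 3 * (p\<^sup>2 * q ^ 4) - q\<^sup>2 * q ^ 4) / 8"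
    by simp
  have a2: "0 \<le> p\<^sup>2 * q ^ 4" by simp
  have a3: "p\<^sup>2 * (p\<^sup>2 * q\<^sup>2) \<le> M\<^sup>2 * (p\<^sup>2 * q\<^sup>2)" "q\<^sup>2 * q ^ 4 \<le> M\<^sup>2 * q ^ 4"
    using pM by (intro mult_right_mono; simp)+
  have a4: "1 * (p\<^sup>2 * q\<^sup>2) \<le> M\<^sup>2 * (p\<^sup>2 * q\<^sup>2)"
    using M2 by (intro mult_right_mono) auto
  have a5: "M\<^sup>2 * (27 / 8 * (p\<^sup>2 * q\<^sup>2) + q ^ 4 / 8)
      = 27 / 8 * (M\<^sup>2 * (p\<^sup>2 * q\<^sup>2)) + M\<^sup>2 * q ^ 4 / 8" by (simp add: algebra_simps)
  have "3 * (p\<^sup>2 * q\<^sup>2) - p ^ 3 * (p + q) ^ 3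
      \<le> M\<^sup>2 * (27 / 8 * (p\<^sup>2 * q\<^sup>2) + q ^ 4 / 8) - p ^ 6 / 8"
  proof -
    have "3 * A - W \<le> 27 / 8 * MA + MQ / 8 - P / 8"
      if "(P - 3 * X + 3 * Y - Z) / 8 \<le> W" "0 \<le> Y" "X \<le> MA" "Z \<le> MQ" "1 * A \<le> MA"
      for A W MA MQ P X Y Z :: real
    proof -
      have "P - 3 * X + 3 * Y - Z \<le> 8 * W" using that(1) by simp
      moreover have "27 / 8 * MA + MQ / 8 - P / 8 = (27 * MA + MQ - P) / 8" by (simp add: field_simps)
      ultimately show ?thesis using that(2-5) by simp
    qed
    from this[OF a1 a2 a3 a4] show ?thesis unfolding a5 .
  qed
  then have "(3 * (p\<^sup>2 * q\<^sup>2) - p ^ 3 * (p + q) ^ 3) / (10 * M\<^sup>2)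
      \<le> (M\<^sup>2 * (27 / 8 * (p\<^sup>2 * q\<^sup>2) + q ^ 4 / 8) - p ^ 6 / 8) / (10 * M\<^sup>2)"
    using M2 by (intro divide_right_mono) auto
  also have "\<dots> = (27 / 8 * (p\<^sup>2 * q\<^sup>2) + q ^ 4 / 8) / 10 - p ^ 6 / (80 * M\<^sup>2)"
  proof -
    have "(N * X - P / 8) / (10 * N) = X / 10 - P / (80 * N)" if "N > 0" for N X P :: real
      using that by (simp add: field_simps)
    then show ?thesis by this (use M2 in linarith)
  qed
  finally have "p ^ 3 * q - q * (p + q) ^ 3 + (3 * (p\<^sup>2 * q\<^sup>2) - p ^ 3 * (p + q) ^ 3) / (10 * M\<^sup>2)
      \<le> - (p\<^sup>2 * q\<^sup>2 / 2) - q ^ 4 / 10 + ((27 / 8 * (p\<^sup>2 * q\<^sup>2) + q ^ 4 / 8) / 10 - p ^ 6 / (80 * M\<^sup>2))"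
    by (intro add_mono energy_deriv_le)
  also have "\<dots> \<le> - (q ^ 4 / 20) - p ^ 6 / (80 * M\<^sup>2)"
  proof -
    have "- (A / 2) - Q / 10 + ((27 / 8 * A + Q / 8) / 10 - Z) \<le> - (Q / 20) - Z"
      if "0 \<le> A" "0 \<le> Q" for A Q Z :: real using that by (simp add: field_simps)
    then show ?thesis by this simp_all
  qed
  finally have *: "p ^ 3 * q - q * (p + q) ^ 3 + (3 * p\<^sup>2 * q\<^sup>2 - p ^ 3 * (p + q) ^ 3) / (10 * M\<^sup>2)
      \<le> - (q ^ 4 / 20) - p ^ 6 / (80 * M\<^sup>2)"
    by (simp add: mult.assoc)
  have q4: "0 \<le> q ^ 4 / 20" and p6: "0 \<le> p ^ 6 / (80 * M\<^sup>2)" using M2 by simp_all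
  \<comment> \<open>At least half of \<open>e\<close> is carried by one of the two summands of the
    energy.\<close>
  consider "e \<le> q\<^sup>2" | "2 * e \<le> p ^ 4" using e(2) unfolding energy_def by linarith
  then have "e\<^sup>2 / (20 * M ^ 4) \<le> q ^ 4 / 20 + p ^ 6 / (80 * M\<^sup>2)"
  proof cases
    case 1
    then have "e\<^sup>2 \<le> (q\<^sup>2)\<^sup>2" using e(1) by (intro power_mono) auto
    moreover have "e\<^sup>2 / (20 * M ^ 4) \<le> e\<^sup>2 / (20 * 1)"
      using M by (intro divide_left_mono) (auto simp: one_le_power)
    moreover have "(q\<^sup>2)\<^sup>2 = q ^ 4" by simp
    ultimately show ?thesis using p6 by linarith
  next
    case 2
    have "p ^ 4 = p\<^sup>2 * p\<^sup>2" by (simp add: power2_eq_square power4_eq_xxxx)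
    also have "\<dots> \<le> M\<^sup>2 * p\<^sup>2" using pM by (intro mult_right_mono) auto
    finally have "2 * e / M\<^sup>2 \<le> p\<^sup>2" using 2 order_less_le_trans[OF zero_less_one M2] by (simp only: pos_divide_le_eq mult.commute)
    then have "2 * e * (2 * e / M\<^sup>2) \<le> p ^ 4 * p\<^sup>2"
      using 2 e(1) M2 by (intro mult_mono) auto
    then have "4 * e\<^sup>2 / M\<^sup>2 \<le> p ^ 6"
      by (simp add: power2_eq_square power_numeral_reduce algebra_simps)
    then have "4 * e\<^sup>2 / M\<^sup>2 / (80 * M\<^sup>2) \<le> p ^ 6 / (80 * M\<^sup>2)"
      by (intro divide_right_mono) auto
    also have "4 * e\<^sup>2 / M\<^sup>2 / (80 * M\<^sup>2) = e\<^sup>2 / (20 * M ^ 4)"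
      by (simp add: power2_eq_square power4_eq_xxxx field_simps)
    finally show ?thesis using q4 by linarith
  qed
  with * show ?thesis by simp
qed

lemma energy_bounds:
  assumes "energy p q \<le> B" "0 \<le> B"
  shows "\<bar>p\<bar> \<le> 1 + 4 * B" "\<bar>q\<bar> \<le> 1 + 4 * B"
proof -
  have *: "\<bar>r\<bar> \<le> 1 + 4 * B" if "\<bar>r\<bar> ^ n \<le> 4 * B" "1 \<le> n" for r n
  proof (rule ccontr)
    assume c: "\<not> \<bar>r\<bar> \<le> 1 + 4 * B"
    then have "\<bar>r\<bar> ^ 1 \<le> \<bar>r\<bar> ^ n" using assms(2) that(2) by (intro power_increasing) auto
    then show False using that c by simp
  qed
  have "0 \<le> p ^ 4" "0 \<le> q\<^sup>2" by simp_all
  then have "p ^ 4 \<le> 4 * B" "q\<^sup>2 \<le> 4 * B"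
    using assms unfolding energy_def by linarith+
  then have "\<bar>p\<bar> ^ 4 \<le> 4 * B" "\<bar>q\<bar> ^ 2 \<le> 4 * B" by (simp_all add: power_even_abs)
  then show "\<bar>p\<bar> \<le> 1 + 4 * B" "\<bar>q\<bar> \<le> 1 + 4 * B" using *[of p 4] *[of q 2] by simp_all
qed

text \<open>The corrected energy \<open>V\<close> is bounded and falls by at least \<open>c\<close>
  per unit of \<open>X\<close>. Here \<open>X\<close> is the abscissa in either setting: the time
  itself for graphs, \<open>x\<close> for flow lines. The functions are quantified inside because
  \<open>K\<close> depends on \<open>e\<close> and \<open>B\<close> alone.\<close>

lemma energy_level_time_bound:
  fixes e B :: real
  assumes e: "0 < e" "e \<le> B"
  obtains K where "\<And>a b m f g X. \<lbrakk>a \<le> b;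
      \<And>t. a \<le> t \<Longrightarrow> t \<le> b \<Longrightarrow> 0 \<le> m t \<and> (X has_real_derivative m t) (at t) \<and>
        (f has_real_derivative m t * g t) (at t) \<and>
        (g has_real_derivative - (m t * (f t + g t) ^ 3)) (at t) \<and>
        e \<le> energy (f t) (g t) \<and> energy (f t) (g t) \<le> B\<rbrakk> \<Longrightarrow> X b - X a \<le> (K :: real)"
proof -
  define M where "M = 1 + 4 * B"
  define c where "c = e\<^sup>2 / (20 * M ^ 4)"
  define C where "C = B + M ^ 4 / (10 * M\<^sup>2)"
  have M: "1 \<le> M" using e by (simp add: M_def)
  then have c: "0 < c" using e by (simp add: c_def)
  have "X b - X a \<le> 2 * C / c"
    if ab: "a \<le> b" and ode: "\<And>t. a \<le> t \<Longrightarrow> t \<le> b \<Longrightarrow> 0 \<le> m t \<and> (X has_real_derivative m t) (at t) \<and>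
        (f has_real_derivative m t * g t) (at t) \<and>
        (g has_real_derivative - (m t * (f t + g t) ^ 3)) (at t) \<and>
        e \<le> energy (f t) (g t) \<and> energy (f t) (g t) \<le> B" for a b m f g X
  proof -
    define V where "V t = energy (f t) (g t) + f t ^ 3 * g t / (10 * M\<^sup>2)" for t
    have bnd: "\<bar>f t\<bar> \<le> M" "\<bar>g t\<bar> \<le> M" if "a \<le> t" "t \<le> b" for t
      using energy_bounds[of "f t" "g t" B] ode[OF that] e by (auto simp: M_def)
    have V: "\<bar>V t\<bar> \<le> C" if t: "a \<le> t" "t \<le> b" for t
    proof -
      have "\<bar>f t\<bar> ^ 3 * \<bar>g t\<bar> \<le> M ^ 3 * M"
        using bnd[OF t] M by (intro mult_mono power_mono) auto
      then have "\<bar>f t ^ 3 * g t\<bar> \<le> M ^ 4"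
        by (simp add: abs_mult power_abs power_numeral_reduce algebra_simps)
      then have "\<bar>f t ^ 3 * g t / (10 * M\<^sup>2)\<bar> \<le> M ^ 4 / (10 * M\<^sup>2)"
        using M by (simp add: divide_right_mono)
      then show ?thesis
        using ode[OF t] e unfolding V_def C_def by linarith
    qed
    have "V b + c * X b \<le> V a + c * X a"
    proof (rule DERIV_nonpos_imp_nonincreasing[OF ab])
      fix t assume t: "a \<le> t" "t \<le> b"
      let ?d = "f t ^ 3 * g t - g t * (f t + g t) ^ 3
        + (3 * (f t)\<^sup>2 * (g t)\<^sup>2 - f t ^ 3 * (f t + g t) ^ 3) / (10 * M\<^sup>2)"
      have d: "(f has_real_derivative m t * g t) (at t)"
        "(g has_real_derivative - (m t * (f t + g t) ^ 3)) (at t)"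
        "(X has_real_derivative m t) (at t)" "0 \<le> m t"
        using ode[OF t] by auto
      have "((\<lambda>t. f t ^ 3 * g t) has_real_derivative
          m t * (3 * (f t)\<^sup>2 * (g t)\<^sup>2 - f t ^ 3 * (f t + g t) ^ 3)) (at t)"
        using d(1,2) by (auto intro!: derivative_eq_intros simp: power2_eq_square algebra_simps)
      then have "((\<lambda>t. f t ^ 3 * g t / (10 * M\<^sup>2)) has_real_derivative
          m t * (3 * (f t)\<^sup>2 * (g t)\<^sup>2 - f t ^ 3 * (f t + g t) ^ 3) / (10 * M\<^sup>2)) (at t)"
        by (rule DERIV_cdivide)
      from DERIV_add[OF DERIV_add[OF energy_deriv[OF d(1,2)] this] DERIV_cmult[OF d(3), of c]]
      have "((\<lambda>t. V t + c * X t) has_real_derivative m t * (?d + c)) (at t)"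
        unfolding V_def by (simp add: algebra_simps add_divide_distrib diff_divide_distrib)
      moreover have "?d + c \<le> 0"
        using corrected_energy_deriv_le[OF M bnd[OF t] e(1)] ode[OF t] by (simp add: c_def)
      then have "m t * (?d + c) \<le> 0" using d(4) by (simp add: mult_nonneg_nonpos)
      ultimately show "\<exists>y. ((\<lambda>t. V t + c * X t) has_real_derivative y) (at t) \<and> y \<le> 0" by blast
    qed
    then have "c * (X b - X a) \<le> V a - V b" by (simp add: algebra_simps)
    also have "\<dots> \<le> 2 * C" using V[of a] V[of b] ab by (simp add: abs_le_iff)
    finally show ?thesis using c by (simp add: field_simps)
  qed
  then show ?thesis by (rule that)
qed

subsection \<open>The equation for graphs\<close>

lemma decreasing_inverse:
  fixes h :: "real \<Rightarrow> real"
  assumes cb: "c < b" and cont: "continuous_on {c..b} h"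
    and der: "\<And>t. c < t \<Longrightarrow> t < b \<Longrightarrow> (h has_real_derivative h' t) (at t) \<and> h' t < 0"
  obtains r where "r (h c) = c" "r (h b) = b" "continuous_on {h b..h c} r"
    "\<And>v. h b < v \<Longrightarrow> v < h c \<Longrightarrow> c < r v \<and> r v < b \<and> h (r v) = v \<and>
      (r has_real_derivative inverse (h' (r v))) (at v)"
proof -
  have decr: "h s > h t" if "c \<le> s" "s < t" "t \<le> b" for s t
  proof (rule DERIV_neg_imp_decreasing_open[OF that(2)])
    show "\<exists>y. (h has_real_derivative y) (at u) \<and> y < 0" if "s < u" "u < t" for u
      using der[of u] that \<open>c \<le> s\<close> \<open>t \<le> b\<close> by (intro exI[of _ "h' u"]) simp
    show "continuous_on {s..t} h" using that by (intro continuous_on_subset[OF cont]) auto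
  qed
  define r where "r = inv_into {c..b} h"
  have inj: "inj_on h {c..b}"
    by (rule linorder_inj_onI) (use decr in fastforce)+
  have img: "h ` {c..b} = {h b..h c}"
  proof
    show "h ` {c..b} \<subseteq> {h b..h c}"
    proof
      fix v assume "v \<in> h ` {c..b}"
      then obtain t where t: "c \<le> t" "t \<le> b" "v = h t" by auto
      then have "h b \<le> h t" "h t \<le> h c"
        using decr[of t b] decr[of c t] by (auto simp: order.order_iff_strict)
      then show "v \<in> {h b..h c}" using t by simp
    qed
    show "{h b..h c} \<subseteq> h ` {c..b}"
    proof
      fix v assume "v \<in> {h b..h c}"
      then have "\<exists>t\<ge>c. t \<le> b \<and> h t = v" using IVT2'[of h b v c] cont cb by auto
      then show "v \<in> h ` {c..b}" by auto
    qed
  qed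
  have r: "r (h t) = t" if "c \<le> t" "t \<le> b" for t
    unfolding r_def using that inj by (intro inv_into_f_f) auto
  have cont_r: "continuous_on {h b..h c} r"
    unfolding img[symmetric] by (rule continuous_on_inv[OF cont]) (use r in auto)
  have hr: "c \<le> r v \<and> r v \<le> b \<and> h (r v) = v" if "h b \<le> v" "v \<le> h c" for v
  proof -
    have "v \<in> h ` {c..b}" using img that by simp
    then obtain t where "c \<le> t" "t \<le> b" "h t = v" by auto
    then show ?thesis using r[of t] by simp
  qed
  have "c < r v \<and> r v < b \<and> h (r v) = v \<and> (r has_real_derivative inverse (h' (r v))) (at v)"
    if v: "h b < v" "v < h c" for v
  proof -
    have rv: "c < r v" "r v < b" "h (r v) = v"
      using hr[of v] v by (auto simp: order.order_iff_strict)
    have "isCont r v"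
      using cont_r v continuous_on_interior[of "{h b..h c}" r v] by simp
    moreover have "h' (r v) \<noteq> 0" using der rv by fastforce
    ultimately have "(r has_real_derivative inverse (h' (r v))) (at v)"
      by (intro DERIV_inverse_function[where f = h and a = "h b" and b = "h c"]) (use der rv v hr in auto)
    then show ?thesis using rv by blast
  qed
  then show ?thesis
    using that[of r] r[of c] r[of b] cb cont_r by auto
qed

text \<open>Comparison of the rise of \<open>h\<close> on \<open>[a, c]\<close> with its fall on \<open>[c, b]\<close> at equal heights:
  the difference of the values of \<open>\<kappa>\<close> vanishes at \<open>c\<close> and its derivative has a sign.\<close>

lemma rise_shorter_than_fall:
  fixes h k h' l :: "real \<Rightarrow> real"
  assumes abc: "a < c" "c < b" and cont: "continuous_on {a..b} h" "continuous_on {a..b} k"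
    and h: "\<And>t. a < t \<Longrightarrow> t < b \<Longrightarrow> (h has_real_derivative h' t) (at t)"
    and k: "\<And>t. a < t \<Longrightarrow> t < b \<Longrightarrow> (k has_real_derivative h' t * l t) (at t)"
    and up: "\<And>t. a < t \<Longrightarrow> t < c \<Longrightarrow> 0 < h' t" and down: "\<And>t. c < t \<Longrightarrow> t < b \<Longrightarrow> h' t < 0"
    and ends: "h a = h b"
    and l: "\<And>s t. a < s \<Longrightarrow> s < c \<Longrightarrow> c < t \<Longrightarrow> t < b \<Longrightarrow> h s = h t \<Longrightarrow> l s < l t"
    and k_speed: "\<And>s t. a < s \<Longrightarrow> s < c \<Longrightarrow> c < t \<Longrightarrow> t < b \<Longrightarrow> h s = h t \<Longrightarrow> k t < k s \<Longrightarrow> - h' t < h' s"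
  shows "c - a < b - c"
proof -
  have der: "(h has_real_derivative h' t) (at t) \<and> h' t < 0" if "c < t" "t < b" for t
    using that abc h[of t] down[of t] by simp
  have "continuous_on {c..b} h" by (rule continuous_on_subset[OF cont(1)]) (use abc in auto)
  then obtain r where r: "r (h c) = c" "r (h b) = b" "continuous_on {h b..h c} r"
    and rv: "\<And>v. h b < v \<Longrightarrow> v < h c \<Longrightarrow> c < r v \<and> r v < b \<and> h (r v) = v \<and>
      (r has_real_derivative inverse (h' (r v))) (at v)"
    by (rule decreasing_inverse[OF abc(2) _ der]) (assumption, assumption, rule that, assumption+)
  have incr: "h s < h t" if "a \<le> s" "s < t" "t \<le> c" for s t
  proof (rule DERIV_pos_imp_increasing_open[OF that(2)])
    show "\<exists>y. (h has_real_derivative y) (at u) \<and> 0 < y" if "s < u" "u < t" for u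
      using h[of u] up[of u] that \<open>a \<le> s\<close> \<open>t \<le> c\<close> abc by (intro exI[of _ "h' u"]) simp
    show "continuous_on {s..t} h" using that abc by (intro continuous_on_subset[OF cont(1)]) auto
  qed
  \<comment> \<open>\<open>\<sigma> s\<close> is the point of the fall at the same height as the
    point \<open>s\<close> of the rise.\<close>
  define \<sigma> where "\<sigma> = (\<lambda>s. r (h s))"
  have hs: "h b < h s" "h s < h c" if "a < s" "s < c" for s
    using incr[of a s] incr[of s c] that ends by auto
  have \<sigma>: "c < \<sigma> s" "\<sigma> s < b" "h (\<sigma> s) = h s" if "a < s" "s < c" for s
    using rv[OF hs[OF that]] by (auto simp: \<sigma>_def)
  have d\<sigma>: "(\<sigma> has_real_derivative inverse (h' (\<sigma> s)) * h' s) (at s)" if "a < s" "s < c" for s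
    unfolding \<sigma>_def
    by (rule DERIV_chain2[where f = r and g = h and x = s]) (use rv[OF hs[OF that]] h that abc in auto)
  have cont_\<sigma>: "continuous_on {a..c} \<sigma>"
    unfolding \<sigma>_def
  proof (rule continuous_on_compose2[OF r(3)])
    show "continuous_on {a..c} h" by (rule continuous_on_subset[OF cont(1)]) (use abc in auto)
    show "h ` {a..c} \<subseteq> {h b..h c}"
    proof
      fix v assume "v \<in> h ` {a..c}"
      then obtain s where s: "a \<le> s" "s \<le> c" "v = h s" by auto
      show "v \<in> {h b..h c}"
        using s ends incr[of a s] incr[of s c] incr[of a c] abc
        by (cases "s = a"; cases "s = c") auto
    qed
  qed
  have \<sigma>_range: "\<sigma> ` {a..c} \<subseteq> {a..b}"
  proof
    fix v assume "v \<in> \<sigma> ` {a..c}"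
    then obtain s where s: "a \<le> s" "s \<le> c" "v = \<sigma> s" by auto
    have "\<sigma> a = b" "\<sigma> c = c" using r ends by (auto simp: \<sigma>_def)
    then show "v \<in> {a..b}"
      using s \<sigma>[of s] abc by (cases "s = a"; cases "s = c") auto
  qed
  have less: "k (\<sigma> s) < k s" if s: "a < s" "s < c" for s
  proof -
    have "k s - k (\<sigma> s) > k c - k (\<sigma> c)"
    proof (rule DERIV_neg_imp_decreasing_open[OF s(2)])
      fix t assume t: "s < t" "t < c"
      then have at: "a < t" using s by simp
      have "((\<lambda>t. k (\<sigma> t)) has_real_derivative
          (h' (\<sigma> t) * l (\<sigma> t)) * (inverse (h' (\<sigma> t)) * h' t)) (at t)"
        by (rule DERIV_chain2[OF k d\<sigma>]) (use \<sigma>[OF at t(2)] at t abc in auto)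
      moreover have "h' (\<sigma> t) \<noteq> 0" using down[of "\<sigma> t"] \<sigma>[OF at t(2)] by simp
      ultimately have "((\<lambda>t. k (\<sigma> t)) has_real_derivative h' t * l (\<sigma> t)) (at t)"
        by (simp add: field_simps)
      moreover have "(k has_real_derivative h' t * l t) (at t)" using k at t abc by simp
      ultimately have "((\<lambda>t. k t - k (\<sigma> t)) has_real_derivative h' t * l t - h' t * l (\<sigma> t)) (at t)"
        by (intro DERIV_diff)
      moreover have "h' t * l t < h' t * l (\<sigma> t)"
        using up[OF at t(2)] l[OF at t(2), of "\<sigma> t"] \<sigma>[OF at t(2)] by simp
      ultimately show "\<exists>y. ((\<lambda>t. k t - k (\<sigma> t)) has_real_derivative y) (at t) \<and> y < 0"
        by (intro exI conjI) auto
    next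
      have "continuous_on {a..c} (\<lambda>t. k t - k (\<sigma> t))"
        by (intro continuous_on_diff continuous_on_compose2[OF cont(2) cont_\<sigma> \<sigma>_range]
            continuous_on_subset[OF cont(2)]) (use abc in auto)
      then show "continuous_on {s..c} (\<lambda>t. k t - k (\<sigma> t))"
        by (rule continuous_on_subset) (use s in auto)
    qed
    then show ?thesis using r(1) by (simp add: \<sigma>_def)
  qed
  \<comment> \<open>At equal heights the fall is slower by \<open>k_speed\<close>, so the derivative
    of \<sigma> is below -1 and t + \<sigma> t decreases from a + b to 2 c.\<close>
  have "a + \<sigma> a > c + \<sigma> c"
  proof (rule DERIV_neg_imp_decreasing_open[OF abc(1)])
    fix t assume t: "a < t" "t < c"
    have "((\<lambda>t. t + \<sigma> t) has_real_derivative 1 + inverse (h' (\<sigma> t)) * h' t) (at t)"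
      by (intro DERIV_add DERIV_ident d\<sigma> t)
    moreover have "- h' (\<sigma> t) < h' t" "h' (\<sigma> t) < 0"
      using k_speed[OF t, of "\<sigma> t"] \<sigma>[OF t] less[OF t] down[of "\<sigma> t"] by auto
    then have "1 + inverse (h' (\<sigma> t)) * h' t < 0" by (simp add: field_simps)
    ultimately show "\<exists>y. ((\<lambda>t. t + \<sigma> t) has_real_derivative y) (at t) \<and> y < 0" by blast
  next
    show "continuous_on {a..c} (\<lambda>t. t + \<sigma> t)" by (intro continuous_intros cont_\<sigma>)
  qed
  then show ?thesis using r ends by (simp add: \<sigma>_def)
qed

text \<open>An upward closed domain covers both the half-line after a vertical tangent and the whole
  line. The last assumption keeps out the solution f = 0.\<close>

locale graph_ode =
  fixes D :: "real set" and f g :: "real \<Rightarrow> real"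
  assumes open_D: "open D"
    and up_D: "s \<in> D \<Longrightarrow> s \<le> t \<Longrightarrow> t \<in> D"
    and f': "t \<in> D \<Longrightarrow> (f has_real_derivative g t) (at t)"
    and g': "t \<in> D \<Longrightarrow> (g has_real_derivative - ((f t + g t) ^ 3)) (at t)"
    and nontrivial: "t \<in> D \<Longrightarrow> f t \<noteq> 0 \<or> g t \<noteq> 0"
begin

section \<open>Decay of the energy along a graph\<close>

abbreviation E :: "real \<Rightarrow> real" where "E t \<equiv> energy (f t) (g t)"

lemma cont_f: "s \<in> D \<Longrightarrow> continuous_on {s..t} f"
  by (intro continuous_at_imp_continuous_on ballI DERIV_isCont[OF f']) (auto intro: up_D)

lemma cont_g: "s \<in> D \<Longrightarrow> continuous_on {s..t} g"
  by (intro continuous_at_imp_continuous_on ballI DERIV_isCont[OF g']) (auto intro: up_D)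

lemma f_mono:
  assumes "s \<in> D" "s < t" "\<And>u. s < u \<Longrightarrow> u < t \<Longrightarrow> 0 < g u"
  shows "f s < f t"
proof (rule DERIV_pos_imp_increasing_open[OF assms(2)])
  show "\<exists>y. (f has_real_derivative y) (at u) \<and> 0 < y" if "s < u" "u < t" for u
    using assms(3)[OF that] f'[of u] up_D[OF assms(1), of u] that by (intro exI[of _ "g u"]) simp
qed (rule cont_f[OF assms(1)])

lemma f_antimono:
  assumes "s \<in> D" "s < t" "\<And>u. s < u \<Longrightarrow> u < t \<Longrightarrow> g u < 0"
  shows "f t < f s"
proof (rule DERIV_neg_imp_decreasing_open[OF assms(2)])
  show "\<exists>y. (f has_real_derivative y) (at u) \<and> y < 0" if "s < u" "u < t" for u
    using assms(3)[OF that] f'[of u] up_D[OF assms(1), of u] that by (intro exI[of _ "g u"]) simp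
qed (rule cont_f[OF assms(1)])

lemma g_antimono:
  assumes "s \<in> D" "s < t" "\<And>u. s < u \<Longrightarrow> u < t \<Longrightarrow> 0 < f u + g u"
  shows "g t < g s"
proof (rule DERIV_neg_imp_decreasing_open[OF assms(2)])
  show "\<exists>y. (g has_real_derivative y) (at u) \<and> y < 0" if "s < u" "u < t" for u
    using assms(3)[OF that] g'[of u] up_D[OF assms(1), of u] that
    by (intro exI[of _ "- ((f u + g u) ^ 3)"]) simp
qed (rule cont_g[OF assms(1)])

lemma E_deriv:
  "t \<in> D \<Longrightarrow> (E has_real_derivative f t ^ 3 * g t - g t * (f t + g t) ^ 3) (at t)"
  using energy_deriv[of f 1 g t] f' g' by simp

lemma E_deriv_nonpos: "f t ^ 3 * g t - g t * (f t + g t) ^ 3 \<le> 0"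
proof -
  have "0 \<le> (f t)\<^sup>2 * (g t)\<^sup>2" "0 \<le> g t ^ 4" by simp_all
  then show ?thesis using energy_deriv_le[of "f t" "g t"] by linarith
qed

lemma E_antimono:
  assumes "s \<in> D" "s \<le> t"
  shows "E t \<le> E s"
proof (rule DERIV_nonpos_imp_nonincreasing[OF assms(2)])
  fix u assume "s \<le> u" "u \<le> t"
  then have "u \<in> D" using assms up_D by blast
  then show "\<exists>y. (E has_real_derivative y) (at u) \<and> y \<le> 0" using E_deriv E_deriv_nonpos by blast
qed

lemma E_pos: "t \<in> D \<Longrightarrow> 0 < E t"
proof -
  assume "t \<in> D"
  then have "f t ^ 4 \<noteq> 0 \<or> (g t)\<^sup>2 \<noteq> 0" using nontrivial by auto
  moreover have "0 \<le> f t ^ 4" "0 \<le> (g t)\<^sup>2" by simp_all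
  ultimately show ?thesis unfolding energy_def by linarith
qed

text \<open>The rate vanishes where the slope does, so strictness is not visible pointwise. Constant
  energy on an interval would force zero slope there, hence zero second derivative, hence the
  trivial solution.\<close>

lemma E_strict_antimono:
  assumes "s \<in> D" "s < t"
  shows "E t < E s"
proof (rule ccontr)
  assume "\<not> E t < E s"
  have const: "E u = E s" if "s \<le> u" "u \<le> t" for u
    using E_antimono[of s u] E_antimono[of u t] up_D[of s u] that assms \<open>\<not> E t < E s\<close> by linarith
  have g0: "g u = 0" if u: "s < u" "u < t" for u
  proof -
    have uD: "u \<in> D" using up_D assms u by force
    have "f u ^ 3 * g u - g u * (f u + g u) ^ 3 = 0"
    proof (rule DERIV_local_const[OF E_deriv[OF uD]])
      show "0 < min (u - s) (t - u)" using u by simp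
      show "\<forall>y. \<bar>u - y\<bar> < min (u - s) (t - u) \<longrightarrow> E u = E y"
      proof (intro allI impI)
        fix y assume "\<bar>u - y\<bar> < min (u - s) (t - u)"
        then have "s \<le> y" "y \<le> t" by linarith+
        then show "E u = E y" using const[of u] const[of y] u by linarith
      qed
    qed
    moreover have "0 \<le> (f u)\<^sup>2 * (g u)\<^sup>2" "0 \<le> g u ^ 4" by simp_all
    ultimately have "g u ^ 4 = 0" using energy_deriv_le[of "f u" "g u"] by linarith
    then show ?thesis by simp
  qed
  define u where "u = (s + t) / 2"
  have u: "s < u" "u < t" using assms by (auto simp: u_def)
  have uD: "u \<in> D" using up_D assms u by force
  have "- ((f u + g u) ^ 3) = 0"
  proof (rule DERIV_local_const[OF g'[OF uD]])
    show "0 < min (u - s) (t - u)" using u by simp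
    show "\<forall>y. \<bar>u - y\<bar> < min (u - s) (t - u) \<longrightarrow> g u = g y"
    proof (intro allI impI)
      fix y assume "\<bar>u - y\<bar> < min (u - s) (t - u)"
      then have "s < y" "y < t" by linarith+
      then show "g u = g y" using g0 u by simp
    qed
  qed
  then show False using nontrivial[OF uD] g0[OF u] by simp
qed

text \<open>Otherwise the energy would remain between \<open>e\<close> and its value at
  \<open>s\<close> forever, against the bound on the time spent in such a band.\<close>

lemma E_small:
  assumes "s \<in> D" "0 < e"
  obtains t where "s \<le> t" "E t < e"
proof -
  have "\<exists>t\<ge>s. E t < e"
  proof (rule ccontr)
    assume "\<not> ?thesis"
    then have ge: "e \<le> E t" if "s \<le> t" for t using that by force
    obtain K where K: "\<And>a b m f g X. \<lbrakk>a \<le> b;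
      \<And>t. a \<le> t \<Longrightarrow> t \<le> b \<Longrightarrow> 0 \<le> m t \<and> (X has_real_derivative m t) (at t) \<and>
        (f has_real_derivative m t * g t) (at t) \<and>
        (g has_real_derivative - (m t * (f t + g t) ^ 3)) (at t) \<and>
        e \<le> energy (f t) (g t) \<and> energy (f t) (g t) \<le> E s\<rbrakk> \<Longrightarrow> X b - X a \<le> (K :: real)"
      using energy_level_time_bound[OF assms(2) ge[OF order_refl]] by blast
    have "(s + \<bar>K\<bar> + 1) - s \<le> K"
    proof (rule K[where X = "\<lambda>t. t" and m = "\<lambda>_. 1" and f = f and g = g])
      fix t assume "s \<le> t" "t \<le> s + \<bar>K\<bar> + 1"
      then show "(0::real) \<le> 1 \<and> ((\<lambda>t. t) has_real_derivative 1) (at t) \<and>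
          (f has_real_derivative 1 * g t) (at t) \<and>
          (g has_real_derivative - (1 * (f t + g t) ^ 3)) (at t) \<and> e \<le> E t \<and> E t \<le> E s"
        using ge E_antimono[OF assms(1)] f'[of t] g'[of t] up_D[OF assms(1)] by simp
    qed simp
    then show False by simp
  qed
  then show ?thesis using that by blast
qed

lemma E_tendsto_0:
  assumes "s \<in> D"
  shows "(E \<longlongrightarrow> 0) at_top"
proof (rule tendstoI)
  fix e :: real assume "0 < e"
  then obtain t where t: "s \<le> t" "E t < e" using E_small[OF assms] by blast
  then have "E u < e" if "t \<le> u" for u
    using E_antimono[of t u] up_D[OF assms t(1)] that by linarith
  then show "\<forall>\<^sub>F u in at_top. dist (E u) 0 < e"
    using energy_nonneg by (auto simp: eventually_at_top_linorder dist_real_def intro!: exI[of _ t])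
qed

lemma f_tendsto_0:
  assumes "s \<in> D"
  shows "(f \<longlongrightarrow> 0) at_top"
proof (rule tendstoI)
  fix e :: real assume e: "0 < e"
  then have "\<forall>\<^sub>F u in at_top. dist (E u) 0 < e ^ 4 / 4"
    by (intro tendstoD[OF E_tendsto_0[OF assms]]) simp
  then show "\<forall>\<^sub>F u in at_top. dist (f u) 0 < e"
  proof eventually_elim
    case (elim u)
    have "0 \<le> (g u)\<^sup>2" by simp
    then have "f u ^ 4 < e ^ 4" using elim energy_nonneg[of "f u" "g u"] unfolding energy_def dist_real_def by linarith
    then have "\<bar>f u\<bar> ^ 4 < e ^ 4" by (simp add: power_even_abs)
    then show ?case using e power_less_imp_less_base[of "\<bar>f u\<bar>" 4 e] by (simp add: dist_real_def)
  qed
qed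

lemma g_tendsto_0:
  assumes "s \<in> D"
  shows "(g \<longlongrightarrow> 0) at_top"
proof (rule tendstoI)
  fix e :: real assume e: "0 < e"
  then have "\<forall>\<^sub>F u in at_top. dist (E u) 0 < e\<^sup>2 / 2"
    by (intro tendstoD[OF E_tendsto_0[OF assms]]) simp
  then show "\<forall>\<^sub>F u in at_top. dist (g u) 0 < e"
  proof eventually_elim
    case (elim u)
    have "0 \<le> f u ^ 4" by simp
    then have "(g u)\<^sup>2 < e\<^sup>2" using elim energy_nonneg[of "f u" "g u"] unfolding energy_def dist_real_def by linarith
    then have "\<bar>g u\<bar> ^ 2 < e ^ 2" by simp
    then show ?case using e power_less_imp_less_base[of "\<bar>g u\<bar>" 2 e] by (simp add: dist_real_def)
  qed
qed

text \<open>The cube is odd. Statements about the way down from a maximum therefore transfer to the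
  way up from a minimum.\<close>

lemma negate: "graph_ode D (\<lambda>t. - f t) (\<lambda>t. - g t)"
proof
  show "open D" by (rule open_D)
  show "t \<in> D" if "s \<in> D" "s \<le> t" for s t using that by (rule up_D)
  fix t assume t: "t \<in> D"
  show "((\<lambda>t. - f t) has_real_derivative - g t) (at t)" using f'[OF t] by (rule DERIV_minus)
  have "(- f t + - g t) ^ 3 = - ((f t + g t) ^ 3)"
    using power_minus_odd[of 3 "f t + g t"] by simp
  then show "((\<lambda>t. - g t) has_real_derivative - ((- f t + - g t) ^ 3)) (at t)"
    using DERIV_minus[OF g'[OF t]] by simp
  show "- f t \<noteq> 0 \<or> - g t \<noteq> 0" using nontrivial[OF t] by simp
qed

section \<open>The phases of half an oscillation\<close>

lemma w_deriv: "t \<in> D \<Longrightarrow> ((\<lambda>t. f t + g t) has_real_derivative g t - (f t + g t) ^ 3) (at t)"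
  using DERIV_add[OF f' g'] by simp

text \<open>At a zero of f + g the derivative of this sum is \<open>g\<close>, so while the slope is
  positive the sum can cross zero only upward.\<close>

lemma w_pos_while_g_pos:
  assumes s: "s \<in> D" "0 < f s + g s" and g: "\<And>u. s \<le> u \<Longrightarrow> u \<le> t \<Longrightarrow> 0 < g u" and st: "s \<le> t"
  shows "0 < f t + g t"
proof (rule ccontr)
  assume "\<not> 0 < f t + g t"
  then have le: "f t + g t \<le> 0" by simp
  have cont: "continuous_on {s..t} (\<lambda>t. f t + g t)"
    by (intro continuous_on_add cont_f cont_g s)
  obtain c where c: "s < c" "c \<le> t" "f c + g c = 0" "\<And>u. s \<le> u \<Longrightarrow> u < c \<Longrightarrow> 0 < f u + g u"
    using first_zero_right[OF cont st s(2) le] by blast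
  have "c \<in> D" using up_D[OF s(1)] c by simp
  from w_deriv[OF this] have "((\<lambda>t. f t + g t) has_real_derivative g c) (at c)" using c by simp
  moreover have "0 < g c" using g c by simp
  ultimately obtain d where d: "d > 0" "\<And>h. h > 0 \<Longrightarrow> h < d \<Longrightarrow> f (c - h) + g (c - h) < f c + g c"
    using DERIV_pos_inc_left[of "\<lambda>t. f t + g t" "g c" c] by blast
  have "0 < min (d / 2) (c - s)" "min (d / 2) (c - s) < d" using d c by auto
  then show False using d(2)[of "min (d / 2) (c - s)"] c(3) c(4)[of "c - min (d / 2) (c - s)"] by linarith
qed

text \<open>If \<open>g\<close> stayed positive, then \<open>f\<close> would increase to \<open>0\<close> and \<open>1 / g - f\<close> would not increase,
  so \<open>g\<close> would not tend to \<open>0\<close>.\<close>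

lemma rise:
  assumes s: "s \<in> D" "0 < g s" "0 < f s + g s"
  obtains c where "s < c" "g c = 0" "0 < f c" "\<And>t. s \<le> t \<Longrightarrow> t < c \<Longrightarrow> 0 < g t \<and> 0 < f t + g t"
proof -
  have "\<exists>t\<ge>s. g t \<le> 0"
  proof (rule ccontr)
    assume "\<not> ?thesis"
    then have g: "0 < g t" if "s \<le> t" for t using that by force
    have w: "0 < f t + g t" if "s \<le> t" for t
      by (rule w_pos_while_g_pos[OF s(1,3)]) (use g that in auto)
    have inc: "f t < f u" if "s \<le> t" "t < u" for t u
      using that g up_D[OF s(1)] by (intro f_mono) auto
    have neg: "f t < 0" if t: "s \<le> t" for t
    proof (rule ccontr)
      assume "\<not> f t < 0"
      then have pos: "0 < f (t + 1)" using inc[OF t, of "t + 1"] by simp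
      have "\<forall>\<^sub>F u in at_top. f (t + 1) \<le> f u"
        unfolding eventually_at_top_linorder
      proof (intro exI allI impI)
        fix u assume "t + 1 \<le> u"
        then show "f (t + 1) \<le> f u" using inc[of "t + 1" u] t by (cases "t + 1 = u") auto
      qed
      then have "f (t + 1) \<le> 0"
        by (rule tendsto_lowerbound[OF f_tendsto_0[OF s(1)]]) simp
      then show False using pos by simp
    qed
    define C where "C = inverse (g s) - f s"
    have "0 < inverse (g s)" using s(2) by simp
    then have "0 < C" using neg[of s] unfolding C_def by linarith
    have low: "inverse C \<le> g t" if t: "s \<le> t" for t
    proof -
      have "inverse (g t) - f t \<le> inverse (g s) - f s"
      proof (rule DERIV_nonpos_imp_nonincreasing[OF t])
        fix u assume u: "s \<le> u" "u \<le> t"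
        have uD: "u \<in> D" using up_D[OF s(1) u(1)] .
        have gu: "0 < g u" using g u by simp
        have "((\<lambda>t. inverse (g t)) has_real_derivative
            - (inverse (g u) * - ((f u + g u) ^ 3) * inverse (g u))) (at u)"
          using DERIV_inverse'[OF g'[OF uD]] gu by simp
        from DERIV_diff[OF this f'[OF uD]]
        have "((\<lambda>t. inverse (g t) - f t) has_real_derivative (f u + g u) ^ 3 / (g u)\<^sup>2 - g u) (at u)"
          by (simp add: field_simps power2_eq_square)
        moreover have "(f u + g u) ^ 3 \<le> g u ^ 3"
          using w[OF u(1)] neg[OF u(1)] by (intro power_mono) auto
        then have "(f u + g u) ^ 3 / (g u)\<^sup>2 - g u \<le> 0"
          using gu by (simp add: field_simps power2_eq_square power3_eq_cube)
        ultimately show "\<exists>y. ((\<lambda>t. inverse (g t) - f t) has_real_derivative y) (at u) \<and> y \<le> 0" by blast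
      qed
      then have "inverse (g t) \<le> C" using neg[OF t] by (simp add: C_def)
      then show ?thesis using g[OF t] by (metis inverse_inverse_eq inverse_positive_iff_positive le_imp_inverse_le)
    qed
    have "inverse C \<le> 0"
      by (rule tendsto_lowerbound[OF g_tendsto_0[OF s(1)]])
         (use low in \<open>auto simp: eventually_at_top_linorder\<close>)
    then show False using \<open>0 < C\<close> by simp
  qed
  then obtain t where "s \<le> t" "g t \<le> 0" by blast
  then obtain c where c: "s < c" "c \<le> t" "g c = 0" "\<And>u. s \<le> u \<Longrightarrow> u < c \<Longrightarrow> 0 < g u"
    using first_zero_right[of s t g] cont_g[OF s(1)] s(2) by blast
  have w: "0 < f u + g u" if "s \<le> u" "u < c" for u
    by (rule w_pos_while_g_pos[OF s(1,3)]) (use c that in auto)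
  \<comment> \<open>By continuity f + g is nonnegative at \<open>c\<close>, which gives 0 \<le> f c;
    equality would mean f c = g c = 0.\<close>
  have "0 < f c"
  proof -
    have cD: "c \<in> D" using up_D[OF s(1)] c by simp
    have "((\<lambda>u. f u + g u) \<longlongrightarrow> f c + g c) (at_left c)"
      using DERIV_isCont[OF w_deriv[OF cD]] by (simp add: isCont_def filterlim_at_split)
    moreover have "\<forall>\<^sub>F u in at_left c. 0 \<le> f u + g u"
    proof (rule eventually_at_leftI[of s])
      show "0 \<le> f u + g u" if "u \<in> {s<..<c}" for u using w[of u] that by simp
    qed (rule c(1))
    ultimately have "0 \<le> f c + g c" by (rule tendsto_lowerbound) simp
    then show ?thesis using c(3) nontrivial[OF cD] by simp
  qed
  then show ?thesis using that[of c] c w by blast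
qed

text \<open>As long as f + g is positive the slope decreases, starting from 0 at the maximum. It
  would stay below a negative constant, but it tends to 0.\<close>

lemma fall_to_inflection:
  assumes s: "s \<in> D" "g s = 0" "0 < f s"
  obtains y where "s < y" "f y + g y = 0" "\<And>t. s < t \<Longrightarrow> t \<le> y \<Longrightarrow> g t < 0"
    "\<And>t. s \<le> t \<Longrightarrow> t < y \<Longrightarrow> 0 < f t + g t"
proof -
  have "\<exists>t\<ge>s. f t + g t \<le> 0"
  proof (rule ccontr)
    assume "\<not> ?thesis"
    then have w: "0 < f t + g t" if "s \<le> t" for t using that by force
    have dec: "g u < g t" if "s \<le> t" "t < u" for t u
      using that w up_D[OF s(1)] by (intro g_antimono) auto
    have neg: "g (s + 1) < 0" using dec[of s "s + 1"] s by simp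
    have "\<forall>\<^sub>F u in at_top. g u \<le> g (s + 1)"
      unfolding eventually_at_top_linorder
    proof (intro exI allI impI)
      fix u assume "s + 1 \<le> u"
      then show "g u \<le> g (s + 1)" using dec[of "s + 1" u] by (cases "s + 1 = u") auto
    qed
    then have "0 \<le> g (s + 1)"
      by (rule tendsto_upperbound[OF g_tendsto_0[OF s(1)]]) simp
    then show False using neg by simp
  qed
  then obtain t where t: "s \<le> t" "f t + g t \<le> 0" by blast
  have cont: "continuous_on {s..t} (\<lambda>t. f t + g t)"
    by (intro continuous_on_add cont_f cont_g s)
  have "0 < f s + g s" using s by simp
  then obtain y where y: "s < y" "y \<le> t" "f y + g y = 0" "\<And>u. s \<le> u \<Longrightarrow> u < y \<Longrightarrow> 0 < f u + g u"
    using first_zero_right[OF cont t(1) _ t(2)] by blast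
  have "g t < 0" if "s < t" "t \<le> y" for t
    using g_antimono[OF s(1) that(1)] y(4) that s(2) by force
  then show ?thesis using that[of y] y by blast
qed

text \<open>The way from a maximum at \<open>a\<close> over the inflection point \<open>y\<close>
  and the zero \<open>z\<close> to the next minimum at \<open>b\<close>. The way up from a minimum
  is the same notion for the negated functions.\<close>

definition half_cycle :: "real \<Rightarrow> real \<Rightarrow> real \<Rightarrow> real \<Rightarrow> bool" where
  "half_cycle a y z b \<longleftrightarrow> a \<in> D \<and> a < y \<and> y < z \<and> z < b \<and> g a = 0 \<and> 0 < f a \<and> g b = 0 \<and> f b < 0 \<and>
     f z = 0 \<and> f y + g y = 0 \<and> (\<forall>t. a < t \<and> t < b \<longrightarrow> g t < 0) \<and>
     (\<forall>t. a \<le> t \<and> t < y \<longrightarrow> 0 < f t + g t) \<and> (\<forall>t. y < t \<and> t \<le> b \<longrightarrow> f t + g t < 0)"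

text \<open>At the inflection point the derivative of f + g is g y < 0, so shortly afterwards both f
  + g and \<open>g\<close> are negative. The negated functions then satisfy the hypotheses of
  \<open>rise\<close>, and the end of that rise is the minimum.\<close>

lemma half_cycle_exists:
  assumes a: "a \<in> D" "g a = 0" "0 < f a"
  obtains y z b where "half_cycle a y z b"
proof -
  obtain y where y: "a < y" "f y + g y = 0" "\<And>t. a < t \<Longrightarrow> t \<le> y \<Longrightarrow> g t < 0"
    "\<And>t. a \<le> t \<Longrightarrow> t < y \<Longrightarrow> 0 < f t + g t"
    using fall_to_inflection[OF a] by blast
  have yD: "y \<in> D" using up_D[OF a(1)] y by simp
  have gy: "g y < 0" using y by simp
  have "((\<lambda>t. f t + g t) has_real_derivative g y) (at y)" using w_deriv[OF yD] y(2) by simp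
  then obtain d1 where d1: "0 < d1" "\<And>h. 0 < h \<Longrightarrow> h < d1 \<Longrightarrow> f (y + h) + g (y + h) < f y + g y"
    using DERIV_neg_dec_right[of "\<lambda>t. f t + g t" "g y" y] gy by blast
  have "(g \<longlongrightarrow> g y) (nhds y)"
    using DERIV_isCont[OF g'[OF yD]] by (simp add: isCont_def tendsto_at_iff_tendsto_nhds)
  then have "\<forall>\<^sub>F t in nhds y. g t < 0" using gy by (rule order_tendstoD(2))
  then obtain d2 where d2: "0 < d2" "\<And>t. dist t y < d2 \<Longrightarrow> g t < 0"
    by (auto simp: eventually_nhds_metric)
  define e where "e = min d1 d2 / 2"
  have e: "0 < e" "e < d1" "e < d2" using d1(1) d2(1) by (auto simp: e_def)
  interpret neg: graph_ode D "\<lambda>t. - f t" "\<lambda>t. - g t" by (rule negate)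
  have wl: "f t + g t < 0" "g t < 0" if "y < t" "t \<le> y + e" for t
    using d1(2)[of "t - y"] d2(2)[of t] y(2) that e by (auto simp: dist_real_def)
  obtain b where b: "y + e < b" "- g b = 0" "0 < - f b"
    "\<And>t. y + e \<le> t \<Longrightarrow> t < b \<Longrightarrow> 0 < - g t \<and> 0 < - f t + - g t"
    using neg.rise[of "y + e"] wl[of "y + e"] e up_D[OF yD, of "y + e"] by auto
  have gneg: "g t < 0" if "a < t" "t < b" for t
    using y(3)[of t] wl(2)[of t] b(4)[of t] that by linarith
  have wneg: "f t + g t < 0" if "y < t" "t \<le> b" for t
    using wl(1)[of t] b(2,3) b(4)[of t] that by (cases "t = b") (auto, linarith)
  have "\<exists>z\<ge>y. z \<le> b \<and> f z = 0"
    using IVT2'[of f b 0 y] b y cont_f[OF yD] gy e by auto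
  then obtain z where z: "y \<le> z" "z \<le> b" "f z = 0" by blast
  then have "y < z" "z < b" using y(2) gy b(3) by (auto simp: order.order_iff_strict)
  then have "half_cycle a y z b"
    unfolding half_cycle_def using a y b z gneg wneg e by auto
  then show ?thesis by (rule that)
qed

end

subsection \<open>The oscillation\<close>

lemma strict_mono_on_atLeast_1I:
  fixes a :: "nat \<Rightarrow> real"
  assumes "\<And>n. 1 \<le> n \<Longrightarrow> a n < a (n + 1)"
  shows "strict_mono_on {1..} a"
proof (rule strict_mono_onI)
  fix m n :: nat assume "m \<in> {1..}" and "m < n"
  then show "a m < a n"
  proof (induction n)
    case (Suc n)
    then show ?case using assms[of n] by (cases "m = n") (auto intro: less_trans)
  qed simp
qed

lemma strict_antimono_on_atLeast_1I:
  fixes a :: "nat \<Rightarrow> real"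
  assumes "\<And>n. 1 \<le> n \<Longrightarrow> a (n + 1) < a n"
  shows "strict_antimono_on {1..} a"
proof -
  have "strict_mono_on {1..} (\<lambda>n. - a n)"
    by (rule strict_mono_on_atLeast_1I) (use assms in simp)
  then show ?thesis by (simp add: monotone_on_def)
qed

lemma unbounded_interval_index:
  fixes x :: "nat \<Rightarrow> real"
  assumes "filterlim x at_top sequentially" "x 1 \<le> t"
  obtains n where "1 \<le> n" "x n \<le> t" "t < x (n + 1)"
proof -
  have "\<forall>\<^sub>F n in sequentially. t < x n" using assms(1) by (rule filterlim_at_top_dense[THEN iffD1, rule_format])
  then obtain N where N: "\<And>n. N \<le> n \<Longrightarrow> t < x n" by (auto simp: eventually_sequentially)
  define m where "m = (LEAST m. t < x (m + 1))"
  have m: "t < x (m + 1)" unfolding m_def by (rule LeastI[of _ N]) (use N in simp)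
  have "m \<noteq> 0" using m assms(2) by (intro notI) simp
  then obtain k where k: "m = Suc k" by (cases m) auto
  have "\<not> t < x (k + 1)" using not_less_Least[of k "\<lambda>m. t < x (m + 1)"] k by (simp add: m_def)
  then show ?thesis using that[of m] m k by simp
qed

lemma cube_strict_mono: "a < b \<Longrightarrow> a ^ 3 < (b :: real) ^ 3"
  using power_mono_odd[of 3 a b] odd_real_root_power_cancel[of 3 a] odd_real_root_power_cancel[of 3 b]
  by (cases "a ^ 3 = b ^ 3") auto

section \<open>Durations of the phases\<close>

context graph_ode
begin

lemma half_cycle_signs:
  assumes h: "half_cycle a y z b"
  shows "a < t \<Longrightarrow> t < z \<Longrightarrow> 0 < f t" "z < t \<Longrightarrow> t \<le> b \<Longrightarrow> f t < 0" "y < t \<Longrightarrow> t < b \<Longrightarrow> g y < g t"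
proof -
  have aD: "a \<in> D" using h by (simp add: half_cycle_def)
  have D: "u \<in> D" if "a \<le> u" for u using up_D[OF aD that] .
  have less: "a < y" "y < z" "z < b" "f z = 0" using h by (auto simp: half_cycle_def)
  have gn: "g u < 0" if "a < u" "u < b" for u using h that by (simp add: half_cycle_def)
  show "0 < f t" if "a < t" "t < z" using f_antimono[of t z] D[of t] gn that less by simp
  show "f t < 0" if "z < t" "t \<le> b" using f_antimono[of z t] D[of z] gn that less by simp
  interpret neg: graph_ode D "\<lambda>t. - f t" "\<lambda>t. - g t" by (rule negate)
  show "g y < g t" if "y < t" "t < b"
  proof -
    have "f u + g u < 0" if "y < u" "u < t" for u
      using h that \<open>t < b\<close> by (simp add: half_cycle_def)
    then have "0 < - f u + - g u" if "y < u" "u < t" for u using that by force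
    from neg.g_antimono[OF _ that(1) this] D[of y] less show ?thesis by simp
  qed
qed

text \<open>Equal slopes are compared: - g rises up to \<open>y\<close> and falls after it, with
  speed |f + g|^3. The fourth power of f + g is the right \<open>k\<close>, since it determines this
  speed and its derivative contains the speed as a factor. The cubes have opposite signs on the two
  sides of \<open>y\<close>, which orders the factors \<open>l\<close>.\<close>

lemma half_cycle_inflection_early:
  assumes h: "half_cycle a y z b"
  shows "y - a < b - y"
proof (rule rise_shorter_than_fall[where h = "\<lambda>t. - g t" and k = "\<lambda>t. (f t + g t) ^ 4"
      and h' = "\<lambda>t. (f t + g t) ^ 3" and l = "\<lambda>t. 4 * (g t - (f t + g t) ^ 3)"])
  have aD: "a \<in> D" using h by (simp add: half_cycle_def)
  have D: "u \<in> D" if "a \<le> u" for u using up_D[OF aD that] .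
  have ends: "a < y" "y < z" "z < b" "g a = 0" "g b = 0" using h by (auto simp: half_cycle_def)
  have wp: "0 < f t + g t" if "a \<le> t" "t < y" for t using h that by (simp add: half_cycle_def)
  have wn: "f t + g t < 0" if "y < t" "t \<le> b" for t using h that by (simp add: half_cycle_def)
  show "a < y" "y < b" using ends by auto
  show "continuous_on {a..b} (\<lambda>t. - g t)" "continuous_on {a..b} (\<lambda>t. (f t + g t) ^ 4)"
    by (intro continuous_intros cont_f cont_g aD)+
  fix t
  show "((\<lambda>t. - g t) has_real_derivative (f t + g t) ^ 3) (at t)" if "a < t" "t < b"
    using DERIV_minus[OF g'[of t]] D[of t] that by simp
  show "((\<lambda>t. (f t + g t) ^ 4) has_real_derivative (f t + g t) ^ 3 * (4 * (g t - (f t + g t) ^ 3))) (at t)"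
    if "a < t" "t < b"
    by (rule DERIV_cong[OF DERIV_power[OF w_deriv, of _ 4]]) (use D[of t] that in \<open>simp_all add: algebra_simps\<close>)
  show "0 < (f t + g t) ^ 3" if "a < t" "t < y" using wp[of t] that by simp
  show "(f t + g t) ^ 3 < 0" if "y < t" "t < b" using wn[of t] that by simp
  show "- g a = - g b" using ends by simp
  fix s assume s: "a < s" "s < y" and t: "y < t" "t < b" and eq: "- g s = - g t"
  have "(f t + g t) ^ 3 < 0" "0 < (f s + g s) ^ 3" using wn[of t] wp[of s] s t by simp_all
  then have "(f t + g t) ^ 3 < (f s + g s) ^ 3" by (rule less_trans)
  moreover have "4 * (u - B) < 4 * (v - A)" if "A < B" "- u = - v" for A B u v :: real
    using that by simp
  ultimately show "4 * (g s - (f s + g s) ^ 3) < 4 * (g t - (f t + g t) ^ 3)" using eq by blast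
  assume "(f t + g t) ^ 4 < (f s + g s) ^ 4"
  moreover have "(- (f t + g t)) ^ 4 = (f t + g t) ^ 4" by (rule power_minus_even) simp
  ultimately have "(- (f t + g t)) ^ 4 < (f s + g s) ^ 4" by (simp only:)
  then have "- (f t + g t) < f s + g s"
    using power_less_imp_less_base[of "- (f t + g t)" 4 "f s + g s"] wp[of s] s by simp
  then have "(- (f t + g t)) ^ 3 < (f s + g s) ^ 3"
    using wn[of t] t by (intro power_strict_mono) auto
  moreover have "(- (f t + g t)) ^ 3 = - ((f t + g t) ^ 3)" by (rule power_minus_odd) simp
  ultimately show "- ((f t + g t) ^ 3) < (f s + g s) ^ 3" by simp
qed

text \<open>Equal heights around the maximum at \<open>b\<close> are compared, with the squared
  slope as \<open>k\<close>. At equal heights the slope is positive on the rise and negative on the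
  fall, so f + g is larger on the rise, and this orders the factors \<open>l\<close>.\<close>

lemma zero_gaps_increase:
  assumes hc: "graph_ode.half_cycle D (\<lambda>t. - f t) (\<lambda>t. - g t) a y z b" "half_cycle b y' z' b'"
  shows "b - z < z' - b"
proof (rule rise_shorter_than_fall[where h = f and k = "\<lambda>t. (g t)\<^sup>2"
      and h' = g and l = "\<lambda>t. - (2 * (f t + g t) ^ 3)"])
  interpret neg: graph_ode D "\<lambda>t. - f t" "\<lambda>t. - g t" by (rule negate)
  have aD: "a \<in> D" using hc by (simp add: neg.half_cycle_def)
  have D: "u \<in> D" if "a \<le> u" for u using up_D[OF aD that] .
  have ends: "a < y" "y < z" "z < b" "b < y'" "y' < z'" "z' < b'" "f z = 0" "f z' = 0"
    using hc by (auto simp: neg.half_cycle_def half_cycle_def)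
  have up: "0 < g t" if "z < t" "t < b" for t using hc(1) that ends by (auto simp: neg.half_cycle_def)
  have dn: "g t < 0" if "b < t" "t < z'" for t using hc(2) that ends by (auto simp: half_cycle_def)
  show "z < b" "b < z'" using ends by auto
  show "continuous_on {z..z'} f" "continuous_on {z..z'} (\<lambda>t. (g t)\<^sup>2)"
    by (intro continuous_intros cont_f cont_g D; use ends in simp)+
  fix t
  show "(f has_real_derivative g t) (at t)" if "z < t" "t < z'"
    using f'[of t] D[of t] that ends by simp
  show "((\<lambda>t. (g t)\<^sup>2) has_real_derivative g t * (- (2 * (f t + g t) ^ 3))) (at t)" if "z < t" "t < z'"
    by (rule DERIV_cong[OF DERIV_power[OF g', of _ 2]]) (use D[of t] that ends in \<open>simp_all add: algebra_simps\<close>)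
  show "0 < g t" if "z < t" "t < b" using up that .
  show "g t < 0" if "b < t" "t < z'" using dn that .
  show "f z = f z'" using ends by simp
  fix s assume s: "z < s" "s < b" and t: "b < t" "t < z'" and eq: "f s = f t"
  have "f t + g t < f s + g s" using up[OF s] dn[OF t] eq by linarith
  then have "(f t + g t) ^ 3 < (f s + g s) ^ 3" by (rule cube_strict_mono)
  then show "- (2 * (f s + g s) ^ 3) < - (2 * (f t + g t) ^ 3)" by simp
  assume "(g t)\<^sup>2 < (g s)\<^sup>2"
  then have "(- g t)\<^sup>2 < (g s)\<^sup>2" by simp
  then show "- g t < g s"
    using power_less_imp_less_base[of "- g t" 2 "g s"] up[OF s] by simp
qed

text \<open>By the mean value theorem the slope p = - g y is lost at a rate |f + g|^3 taken at one
  point. The energy bounds (f + g)^2 there by 6 p, and the remaining factor is at most 1 / (6 K), so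
  that p cancels.\<close>

lemma half_cycle_long_after_inflection:
  assumes h: "half_cycle a y z b" and K: "0 < K"
    and small: "\<bar>g y\<bar> \<le> 1" "\<And>t. y \<le> t \<Longrightarrow> \<bar>f t\<bar> + \<bar>g t\<bar> \<le> 1 / (6 * K)"
  shows "K \<le> b - y"
proof -
  have aD: "a \<in> D" using h by (simp add: half_cycle_def)
  have D: "u \<in> D" if "a \<le> u" for u using up_D[OF aD that] .
  have ends: "a < y" "y < z" "z < b" "g a = 0" "g b = 0" "f y + g y = 0" "g y < 0"
    using h by (auto simp: half_cycle_def)
  have yD: "y \<in> D" using D ends by simp
  define p where "p = - g y"
  have p: "0 < p" "p \<le> 1" using ends small(1) by (auto simp: p_def)
  have "\<exists>c>y. c < b \<and> g b - g y = (b - y) * - ((f c + g c) ^ 3)"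
    using MVT2[of y b g "\<lambda>c. - ((f c + g c) ^ 3)"] g' up_D[OF yD] ends by auto
  then obtain c where c: "y < c" "c < b" "g b - g y = (b - y) * - ((f c + g c) ^ 3)" by blast
  have w: "f c + g c < 0" using h c by (simp add: half_cycle_def)
  have gc: "g c < 0" "- g c < p" using h c ends half_cycle_signs(3)[OF h, of c] by (auto simp: half_cycle_def p_def)
  have "E c \<le> E y" using E_antimono[OF yD] c by simp
  moreover have "E y = p ^ 4 / 4 + p\<^sup>2 / 2"
  proof -
    have "f y = p" using ends by (simp add: p_def)
    then show ?thesis by (simp add: energy_def p_def)
  qed
  moreover have "p ^ 4 \<le> p\<^sup>2" using p by (intro power_decreasing) auto
  moreover have "f c ^ 4 / 4 \<le> E c" by (simp add: energy_def)
  moreover have "0 \<le> p\<^sup>2" by simp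
  ultimately have "f c ^ 4 \<le> 4 * p\<^sup>2" by linarith
  then have "((f c)\<^sup>2)\<^sup>2 \<le> (2 * p)\<^sup>2" by (simp add: power_mult_distrib)
  then have fc: "(f c)\<^sup>2 \<le> 2 * p" by (rule power2_le_imp_le) (use p in simp)
  have "(g c)\<^sup>2 \<le> p\<^sup>2" using gc p by (simp add: abs_le_square_iff[symmetric])
  moreover have "p\<^sup>2 \<le> p" using p by (simp add: power2_eq_square mult_left_le)
  moreover have "(f c + g c)\<^sup>2 \<le> 2 * (f c)\<^sup>2 + 2 * (g c)\<^sup>2"
    using zero_le_power2[of "f c - g c"] by (simp add: power2_eq_square algebra_simps)
  ultimately have w2: "(f c + g c)\<^sup>2 \<le> 6 * p" using fc by linarith
  have "\<bar>f c + g c\<bar> \<le> 1 / (6 * K)" using small(2)[of c] c by simp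
  then have w1: "- (f c + g c) \<le> 1 / (6 * K)" by linarith
  have "p = (b - y) * - ((f c + g c) ^ 3)" using c ends by (simp add: p_def)
  also have "\<dots> = (b - y) * ((f c + g c)\<^sup>2 * - (f c + g c))" by (simp add: power2_eq_square power3_eq_cube algebra_simps)
  also have "\<dots> \<le> (b - y) * (6 * p * (1 / (6 * K)))"
    using w w1 w2 ends p by (intro mult_left_mono mult_mono) auto
  also have "\<dots> = (b - y) * p / K" by simp
  finally have "p * K \<le> (b - y) * p" using K by (simp only: pos_le_divide_eq)
  then show ?thesis using p by (simp add: mult.commute)
qed

text \<open>By the mean value theorem f a is z - a times the size of a slope, which the energy
  bounds by (f a)^2; one factor f a cancels.\<close>

lemma half_cycle_long_before_zero:
  assumes h: "half_cycle a y z b" and K: "0 < K" and small: "f a \<le> 1 / K"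
  shows "K \<le> z - a"
proof -
  have aD: "a \<in> D" using h by (simp add: half_cycle_def)
  have ends: "a < y" "y < z" "z < b" "g a = 0" "f z = 0" "0 < f a"
    using h by (auto simp: half_cycle_def)
  have "\<exists>c>a. c < z \<and> f z - f a = (z - a) * g c"
    using MVT2[of a z f g] f' up_D[OF aD] ends by auto
  then obtain c where c: "a < c" "c < z" "f z - f a = (z - a) * g c" by blast
  have gc: "g c < 0" using h c by (simp add: half_cycle_def)
  have "E c \<le> E a" using E_antimono[OF aD] c by simp
  moreover have "E a = f a ^ 4 / 4" using ends by (simp add: energy_def)
  moreover have "(g c)\<^sup>2 / 2 \<le> E c" by (simp add: energy_def)
  moreover have "0 \<le> f a ^ 4" by simp
  ultimately have "(g c)\<^sup>2 \<le> f a ^ 4" by linarith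
  then have "(- g c)\<^sup>2 \<le> ((f a)\<^sup>2)\<^sup>2" by simp
  then have "- g c \<le> (f a)\<^sup>2" by (rule power2_le_imp_le) simp
  then have "f a \<le> (z - a) * (f a)\<^sup>2"
    using c ends mult_left_mono[of "- g c" "(f a)\<^sup>2" "z - a"] by simp
  then have "1 \<le> (z - a) * f a" using ends by (simp add: power2_eq_square)
  also have "\<dots> \<le> (z - a) * (1 / K)" using small ends by (intro mult_left_mono) auto
  finally show ?thesis using K by (simp add: field_simps)
qed

section \<open>Signs, inflection points and local extrema\<close>

lemma signed:
  assumes "s = 1 \<or> s = - 1"
  shows "graph_ode D (\<lambda>t. s * f t) (\<lambda>t. s * g t)"
  using assms negate graph_ode_axioms by auto

lemma deriv_f: "t \<in> D \<Longrightarrow> deriv f t = g t"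
  by (rule DERIV_imp_deriv) (rule f')

lemma deriv2_f:
  assumes "t \<in> D"
  shows "deriv (deriv f) t = - ((f t + g t) ^ 3)"
proof -
  have "\<forall>\<^sub>F u in nhds t. u \<in> D" using open_D assms by (rule eventually_nhds_in_open)
  then have "\<forall>\<^sub>F u in nhds t. deriv f u = g u" by eventually_elim (rule deriv_f)
  then have "deriv (deriv f) t = deriv g t" by (rule deriv_cong_ev) simp
  then show ?thesis using DERIV_imp_deriv[OF g'[OF assms]] by simp
qed

text \<open>The second derivative - (f + g)^3 keeps its sign near a point where f + g is
  nonzero.\<close>

lemma inflection_imp_w_zero:
  assumes t: "t \<in> D" and i: "inflection_at f t"
  shows "f t + g t = 0"
proof (rule ccontr)
  assume nz: "f t + g t \<noteq> 0"
  have lim: "((\<lambda>u. f u + g u) \<longlongrightarrow> f t + g t) (nhds t)"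
    using DERIV_isCont[OF w_deriv[OF t]] tendsto_at_iff_tendsto_nhds[of "\<lambda>u. f u + g u" t]
    unfolding isCont_def by blast
  have D: "\<forall>\<^sub>F u in nhds t. u \<in> D" using open_D t by (rule eventually_nhds_in_open)
  consider "0 < f t + g t" | "f t + g t < 0" using nz by linarith
  then show False
  proof cases
    case 1
    have ev: "\<forall>\<^sub>F u in nhds t. deriv (deriv f) u < 0"
      using order_tendstoD(1)[OF lim 1] D by eventually_elim (simp add: deriv2_f)
    from i show False unfolding inflection_at_def
    proof (elim disjE conjE)
      assume a: "\<forall>\<^sub>F u in at_right t. 0 < deriv (deriv f) u"
      have "\<forall>\<^sub>F u in at_right t. deriv (deriv f) u < 0" using ev by (rule filter_leD[OF at_within_le_nhds])
      with a have "\<forall>\<^sub>F u in at_right t. False" by eventually_elim linarith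
      then show False by (simp add: trivial_limit_at_right_real)
    next
      assume a: "\<forall>\<^sub>F u in at_left t. 0 < deriv (deriv f) u"
      have "\<forall>\<^sub>F u in at_left t. deriv (deriv f) u < 0" using ev by (rule filter_leD[OF at_within_le_nhds])
      with a have "\<forall>\<^sub>F u in at_left t. False" by eventually_elim linarith
      then show False by (simp add: trivial_limit_at_left_real)
    qed
  next
    case 2
    have ev: "\<forall>\<^sub>F u in nhds t. 0 < deriv (deriv f) u"
      using order_tendstoD(2)[OF lim 2] D by eventually_elim (simp add: deriv2_f)
    from i show False unfolding inflection_at_def
    proof (elim disjE conjE)
      assume a: "\<forall>\<^sub>F u in at_left t. deriv (deriv f) u < 0"
      have "\<forall>\<^sub>F u in at_left t. 0 < deriv (deriv f) u" using ev by (rule filter_leD[OF at_within_le_nhds])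
      with a have "\<forall>\<^sub>F u in at_left t. False" by eventually_elim linarith
      then show False by (simp add: trivial_limit_at_left_real)
    next
      assume a: "\<forall>\<^sub>F u in at_right t. deriv (deriv f) u < 0"
      have "\<forall>\<^sub>F u in at_right t. 0 < deriv (deriv f) u" using ev by (rule filter_leD[OF at_within_le_nhds])
      with a have "\<forall>\<^sub>F u in at_right t. False" by eventually_elim linarith
      then show False by (simp add: trivial_limit_at_right_real)
    qed
  qed
qed

lemma w_sign_change_imp_inflection:
  assumes a: "a \<in> D" "a < y" "y < b" and s: "s = 1 \<or> s = - 1"
    and w: "\<And>t. a < t \<Longrightarrow> t < y \<Longrightarrow> 0 < s * (f t + g t)" "\<And>t. y < t \<Longrightarrow> t < b \<Longrightarrow> s * (f t + g t) < 0"
  shows "inflection_at f y"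
proof -
  have l: "\<forall>\<^sub>F t in at_left y. t \<in> D \<and> 0 < s * (f t + g t)"
    by (rule eventually_at_leftI[of a]) (use a w up_D[OF a(1)] in auto)
  have r: "\<forall>\<^sub>F t in at_right y. t \<in> D \<and> s * (f t + g t) < 0"
    by (rule eventually_at_rightI[of _ b]) (use a w up_D[OF a(1)] in auto)
  from s show ?thesis
  proof
    assume s: "s = 1"
    have "\<forall>\<^sub>F t in at_left y. deriv (deriv f) t < 0"
      using l by eventually_elim (simp add: deriv2_f s)
    moreover have "\<forall>\<^sub>F t in at_right y. 0 < deriv (deriv f) t"
      using r by eventually_elim (simp add: deriv2_f s)
    ultimately show ?thesis by (simp add: inflection_at_def)
  next
    assume s: "s = - 1"
    have "\<forall>\<^sub>F t in at_left y. 0 < deriv (deriv f) t"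
      using l by eventually_elim (simp add: deriv2_f s)
    moreover have "\<forall>\<^sub>F t in at_right y. deriv (deriv f) t < 0"
      using r by eventually_elim (simp add: deriv2_f s)
    ultimately show ?thesis by (simp add: inflection_at_def)
  qed
qed

lemma peak_at_sign_change:
  assumes a: "a \<in> D" "a < c" "c < b"
    and g: "\<And>t. a < t \<Longrightarrow> t < c \<Longrightarrow> 0 < g t" "\<And>t. c < t \<Longrightarrow> t < b \<Longrightarrow> g t < 0"
  shows "local_max_at f c"
  unfolding local_max_at_def eventually_at_topological
proof (intro exI conjI ballI impI)
  show "open {a<..<b}" "c \<in> {a<..<b}" using a by auto
  fix t assume "t \<in> {a<..<b}" "t \<noteq> c"
  then show "f t \<le> f c"
    using f_mono[of t c] f_antimono[of c t] g up_D[OF a(1)] a by (cases "t < c") force+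
qed

text \<open>\<open>pos\<close> says that the graph is ascending and concave from the left end of the
  domain up to \<open>t0\<close>; both kinds of curves start like this. Hence \<open>x 1\<close> is
  the first critical point and no inflection point precedes it. From there half cycles are chained
  by dependent choice.\<close>

theorem oscillation_exists:
  assumes t0: "t0 \<in> D" "0 \<le> t0" and pos: "\<And>t. t \<in> D \<Longrightarrow> t \<le> t0 \<Longrightarrow> 0 < g t \<and> 0 < f t + g t"
  obtains x y z where "oscillation D f x y z" "t0 < x 1" "\<And>t. t \<in> D \<Longrightarrow> t < x 1 \<Longrightarrow> 0 < g t"
    "z ` {1..} = {t. x 1 < t \<and> f t = 0}"
proof -
  obtain c where c: "t0 < c" "g c = 0" "0 < f c" "\<And>t. t0 \<le> t \<Longrightarrow> t < c \<Longrightarrow> 0 < g t \<and> 0 < f t + g t"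
    using rise[of t0] t0 pos by blast
  have before: "0 < g t" "0 < f t + g t" if "t \<in> D" "t < c" for t
    using pos[of t] c(4)[of t] that by (cases "t \<le> t0"; simp)+
  have cD: "c \<in> D" using up_D[OF t0(1)] c by simp
  \<comment> \<open>With this sign every half cycle is a descent: \<open>s n * f\<close> has its
    maximum at \<open>x n\<close>.\<close>
  define s :: "nat \<Rightarrow> real" where "s n = (- 1) ^ (n + 1)" for n
  have s1: "s n = 1 \<or> s n = - 1" for n by (simp add: s_def minus_one_power_iff)
  have sodd: "s n = 1" if "odd n" for n using that by (simp add: s_def)
  have seven: "s n = - 1" if "even n" for n using that by (simp add: s_def)
  have sSuc: "s (Suc n) = - s n" for n by (simp add: s_def)
  have ode: "graph_ode D (\<lambda>t. s n * f t) (\<lambda>t. s n * g t)" for n using signed s1 by blast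
  let ?hc = "\<lambda>n. graph_ode.half_cycle D (\<lambda>t. s n * f t) (\<lambda>t. s n * g t)"
  \<comment> \<open>The sequences start at index 1. At index 0 both conditions are void, and the
    step from 0 to 1 puts \<open>x 1 = c\<close>.\<close>
  define P where "P n a \<longleftrightarrow> (1 \<le> n \<longrightarrow> a \<in> D \<and> g a = 0 \<and> 0 < s n * f a \<and> (n = 1 \<longrightarrow> a = c))" for n a
  define Q where "Q n a b \<longleftrightarrow> (1 \<le> n \<longrightarrow> (\<exists>y z. ?hc n a y z b))" for n a b
  have "\<exists>b. P (Suc n) b \<and> Q n a b" if "P n a" for n a
  proof (cases n)
    case 0
    have "P (Suc n) c" "Q n a c" using cD c 0 sodd[of 1] by (simp_all add: P_def Q_def)
    then show ?thesis by blast
  next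
    case (Suc m)
    interpret sg: graph_ode D "\<lambda>t. s n * f t" "\<lambda>t. s n * g t" by (rule ode)
    have "a \<in> D" "s n * g a = 0" "0 < s n * f a" using that Suc by (simp_all add: P_def)
    then obtain y z b where hc: "?hc n a y z b" using sg.half_cycle_exists by blast
    then have "b \<in> D" "s n * g b = 0" "s n * f b < 0"
      using up_D[OF \<open>a \<in> D\<close>, of b] by (auto simp: sg.half_cycle_def)
    then have "P (Suc n) b" using s1[of n] Suc by (auto simp: P_def sSuc)
    moreover have "Q n a b" using hc by (auto simp: Q_def)
    ultimately show ?thesis by blast
  qed
  moreover have "\<exists>a. P 0 a" by (simp add: P_def)
  ultimately obtain x where x: "\<And>n. P n (x n)" "\<And>n. Q n (x n) (x (Suc n))"
    using dependent_nat_choice[of P Q] by blast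
  have "\<exists>q. 1 \<le> n \<longrightarrow> ?hc n (x n) (fst q) (snd q) (x (n + 1))" for n
  proof (cases "1 \<le> n")
    case True
    then obtain y z where "?hc n (x n) y z (x (n + 1))" using x(2)[of n] by (auto simp: Q_def)
    then show ?thesis by (intro exI[of _ "(y, z)"]) simp
  qed simp
  then obtain q where q: "\<And>n. 1 \<le> n \<Longrightarrow> ?hc n (x n) (fst (q n)) (snd (q n)) (x (n + 1))" by metis
  define y z where "y n = fst (q n)" and "z n = snd (q n)" for n
  have hc: "?hc n (x n) (y n) (z n) (x (n + 1))" if "1 \<le> n" for n
    using q[OF that] by (simp add: y_def z_def)
  have x1: "x 1 = c" using x(1)[of 1] by (simp add: P_def)
  note hcd = graph_ode.half_cycle_def[OF ode, THEN iffD1, OF hc]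
  have xD: "x n \<in> D" and gx: "g (x n) = 0" and fx: "0 < s n * f (x n)" if "1 \<le> n" for n
    using x(1)[of n] that by (auto simp: P_def)
  have ord: "x n < y n" "y n < z n" "z n < x (n + 1)" if "1 \<le> n" for n
    using hcd[OF that] by auto
  have D: "t \<in> D" if "1 \<le> n" "x n \<le> t" for n t using up_D[OF xD] that by blast
  have s0: "s n \<noteq> 0" for n using s1[of n] by auto
  have fz: "f (z n) = 0" if "1 \<le> n" for n using hcd[OF that] s0 by auto
  have wy: "f (y n) + g (y n) = 0" if n: "1 \<le> n" for n
  proof -
    have "s n * (f (y n) + g (y n)) = 0" using hcd[OF n] by (simp add: distrib_left)
    then show ?thesis using s0 by simp
  qed
  have gs: "s n * g t < 0" if "1 \<le> n" "x n < t" "t < x (n + 1)" for n t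
    using hcd[OF that(1)] that by auto
  have w1: "0 < s n * (f t + g t)" if "1 \<le> n" "x n \<le> t" "t < y n" for n t
    using hcd[OF that(1)] that by (auto simp: distrib_left)
  have w2: "s n * (f t + g t) < 0" if "1 \<le> n" "y n < t" "t \<le> x (n + 1)" for n t
    using hcd[OF that(1)] that by (auto simp: distrib_left)
  have f1: "0 < s n * f t" if "1 \<le> n" "x n < t" "t < z n" for n t
    using graph_ode.half_cycle_signs(1)[OF ode hc[OF that(1)]] that by blast
  have f2: "s n * f t < 0" if "1 \<le> n" "z n < t" "t \<le> x (n + 1)" for n t
    using graph_ode.half_cycle_signs(2)[OF ode hc[OF that(1)]] that by blast
  have abs_s: "\<bar>s n * r\<bar> = \<bar>r\<bar>" for n r using s1[of n] by auto

  have xmono: "strict_mono_on {1..} x"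
    by (rule strict_mono_on_atLeast_1I) (use ord in \<open>meson less_trans\<close>)
  have ymono: "strict_mono_on {1..} y"
  proof (rule strict_mono_on_atLeast_1I)
    fix n :: nat assume n: "1 \<le> n"
    then show "y n < y (n + 1)" using ord[OF n] ord[of "n + 1"] by simp
  qed
  have zmono: "strict_mono_on {1..} z"
  proof (rule strict_mono_on_atLeast_1I)
    fix n :: nat assume n: "1 \<le> n"
    then show "z n < z (n + 1)" using ord[OF n] ord[of "n + 1"] by simp
  qed
  have xge: "c \<le> x n" if "1 \<le> n" for n
    using strict_mono_onD[OF xmono, of 1 n] x1 that by (cases "n = 1") auto

  \<comment> \<open>By the energy at \<open>c\<close> all extreme values are at most 1 / K in size,
    so every half cycle lasts at least \<open>K\<close> and \<open>x n\<close> grows at least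
    linearly.\<close>
  define K where "K = 1 / (1 + 4 * E c)"
  have Ec: "0 < E c" using E_pos[OF cD] .
  then have K: "0 < K" by (simp add: K_def)
  have step: "x n + K \<le> x (n + 1)" if n: "1 \<le> n" for n
  proof -
    have "E (x n) \<le> E c" using E_antimono[OF cD xge[OF n]] .
    then have "\<bar>f (x n)\<bar> \<le> 1 + 4 * E c" using energy_bounds(1)[of "f (x n)" "g (x n)" "E c"] Ec by simp
    then have "s n * f (x n) \<le> 1 / K" using abs_s[of n "f (x n)"] by (simp add: K_def)
    from graph_ode.half_cycle_long_before_zero[OF ode hc[OF n] K this]
    show ?thesis using ord[OF n] by simp
  qed
  have lin: "c + real n * K \<le> x (n + 1)" for n
  proof (induction n)
    case 0
    then show ?case using x1 by simp
  next
    case (Suc n)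
    then show ?case using step[of "n + 1"] by (simp add: algebra_simps)
  qed
  have xlim: "filterlim x at_top sequentially"
    unfolding filterlim_at_top
  proof
    fix B
    obtain N where N: "(B - c) / K < real N" using reals_Archimedean2 by blast
    show "\<forall>\<^sub>F n in sequentially. B \<le> x n"
    proof (rule eventually_sequentiallyI[of "N + 1"])
      fix n assume n: "N + 1 \<le> n"
      then obtain m where m: "n = m + 1" "N \<le> m" by (metis add_le_cancel_right add.commute le_add1 le_Suc_ex group_cancel.add1)
      have "(B - c) / K \<le> real m" using N m by linarith
      then have "B - c \<le> real m * K" using K by (simp add: pos_divide_le_eq)
      then show "B \<le> x n" using lin[of m] m by simp
    qed
  qed
  have ylim: "filterlim y at_top sequentially"
    by (rule filterlim_at_top_mono[OF xlim]) (use ord in \<open>auto intro!: eventually_sequentiallyI[of 1] less_imp_le\<close>)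
  have zlim: "filterlim z at_top sequentially"
    by (rule filterlim_at_top_mono[OF ylim]) (use ord in \<open>auto intro!: eventually_sequentiallyI[of 1] less_imp_le\<close>)
  have smallfg: "\<exists>T. \<forall>t\<ge>T. \<bar>f t\<bar> + \<bar>g t\<bar> \<le> e" if e: "0 < e" for e
  proof -
    have "((\<lambda>t. \<bar>f t\<bar> + \<bar>g t\<bar>) \<longlongrightarrow> \<bar>0\<bar> + \<bar>0\<bar>) at_top"
      by (intro tendsto_intros f_tendsto_0[OF cD] g_tendsto_0[OF cD])
    from order_tendstoD(2)[OF this, of e] e have "\<forall>\<^sub>F t in at_top. \<bar>f t\<bar> + \<bar>g t\<bar> < e" by simp
    then show ?thesis by (auto simp: eventually_at_top_linorder intro: less_imp_le)
  qed
  have gap1: "filterlim (\<lambda>n. x (n + 1) - y n) at_top sequentially"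
    unfolding filterlim_at_top_gt[where c = 0]
  proof (intro allI impI)
    fix B :: real assume B: "0 < B"
    obtain T where T: "\<And>t. T \<le> t \<Longrightarrow> \<bar>f t\<bar> + \<bar>g t\<bar> \<le> min 1 (1 / (6 * B))"
      using smallfg[of "min 1 (1 / (6 * B))"] B by auto
    have "\<forall>\<^sub>F n in sequentially. T \<le> y n" using ylim by (simp add: filterlim_at_top)
    then show "\<forall>\<^sub>F n in sequentially. B \<le> x (n + 1) - y n"
      using eventually_ge_at_top[of 1]
    proof eventually_elim
      case (elim n)
      show ?case
      proof (rule graph_ode.half_cycle_long_after_inflection[OF ode hc B])
        show "1 \<le> n" by fact
        show "\<bar>s n * g (y n)\<bar> \<le> 1" using T[of "y n"] elim abs_s[of n "g (y n)"] by linarith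
        fix t assume "y n \<le> t"
        then have "\<bar>f t\<bar> + \<bar>g t\<bar> \<le> 1 / (6 * B)" using T[of t] elim by simp
        then show "\<bar>s n * f t\<bar> + \<bar>s n * g t\<bar> \<le> 1 / (6 * B)" by (simp only: abs_s)
      qed
    qed
  qed
  have gap2: "filterlim (\<lambda>n. z (n + 1) - x (n + 1)) at_top sequentially"
    unfolding filterlim_at_top_gt[where c = 0]
  proof (intro allI impI)
    fix B :: real assume B: "0 < B"
    obtain T where T: "\<And>t. T \<le> t \<Longrightarrow> \<bar>f t\<bar> + \<bar>g t\<bar> \<le> 1 / B"
      using smallfg[of "1 / B"] B by auto
    have "\<forall>\<^sub>F n in sequentially. T \<le> y n" using ylim by (simp add: filterlim_at_top)
    then show "\<forall>\<^sub>F n in sequentially. B \<le> z (n + 1) - x (n + 1)"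
      using eventually_ge_at_top[of 1]
    proof eventually_elim
      case (elim n)
      show ?case
      proof (rule graph_ode.half_cycle_long_before_zero[OF ode hc B])
        show "1 \<le> n + 1" by simp
        have "T \<le> x (n + 1)" using elim ord[of n] by linarith
        then show "s (n + 1) * f (x (n + 1)) \<le> 1 / B"
          using T[of "x (n + 1)"] abs_s[of "n + 1" "f (x (n + 1))"] by linarith
      qed
    qed
  qed
  have fx_lim: "(\<lambda>n. \<bar>f (x n)\<bar>) \<longlonglongrightarrow> 0" "(\<lambda>n. \<bar>f (y n)\<bar>) \<longlonglongrightarrow> 0" "(\<lambda>n. \<bar>g (z n)\<bar>) \<longlonglongrightarrow> 0"
    using filterlim_compose[OF f_tendsto_0[OF cD] xlim] filterlim_compose[OF f_tendsto_0[OF cD] ylim]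
      filterlim_compose[OF g_tendsto_0[OF cD] zlim] by (auto intro: tendsto_rabs_zero)
  \<comment> \<open>At extrema, inflection points and zeros the energy is an increasing function of
    a single size, that of f, of f = - f', and of f' respectively. Its strict decay gives the three
    monotonicity statements.\<close>
  have fx_dec: "\<bar>f (x (n + 1))\<bar> < \<bar>f (x n)\<bar>" if n: "1 \<le> n" for n
  proof -
    have "E (x (n + 1)) < E (x n)" using E_strict_antimono[OF xD[OF n]] ord[OF n] by simp
    then have "\<bar>f (x (n + 1))\<bar> ^ 4 < \<bar>f (x n)\<bar> ^ 4"
      using gx[OF n] gx[of "n + 1"] by (simp add: energy_def power_even_abs)
    then show ?thesis by (rule power_less_imp_less_base) simp
  qed
  have fy_dec: "\<bar>f (y (n + 1))\<bar> < \<bar>f (y n)\<bar>" if n: "1 \<le> n" for n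
  proof (rule ccontr)
    assume "\<not> ?thesis"
    then have le: "\<bar>f (y n)\<bar> \<le> \<bar>f (y (n + 1))\<bar>" by simp
    have "y n \<in> D" "y n < y (n + 1)" using D[OF n, of "y n"] ord[OF n] ord[of "n + 1"] by auto
    then have lt: "E (y (n + 1)) < E (y n)" by (rule E_strict_antimono)
    have Ey: "E (y m) = \<bar>f (y m)\<bar> ^ 4 / 4 + \<bar>f (y m)\<bar>\<^sup>2 / 2" if "1 \<le> m" for m
    proof -
      have "g (y m) = - f (y m)" using wy[OF that] by linarith
      then show ?thesis by (simp add: energy_def power_even_abs)
    qed
    moreover have "\<bar>f (y n)\<bar> ^ 4 \<le> \<bar>f (y (n + 1))\<bar> ^ 4" "\<bar>f (y n)\<bar> ^ 2 \<le> \<bar>f (y (n + 1))\<bar> ^ 2"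
      using le by (intro power_mono; simp)+
    ultimately show False using lt Ey[OF n] Ey[of "n + 1"] by simp
  qed
  have gz_dec: "\<bar>g (z (n + 1))\<bar> < \<bar>g (z n)\<bar>" if n: "1 \<le> n" for n
  proof -
    have "z n \<in> D" "z n < z (n + 1)" using D[OF n, of "z n"] ord[OF n] ord[of "n + 1"] by auto
    then have "E (z (n + 1)) < E (z n)" by (rule E_strict_antimono)
    then have "\<bar>g (z (n + 1))\<bar> ^ 2 < \<bar>g (z n)\<bar> ^ 2"
      using fz[OF n] fz[of "n + 1"] by (simp add: energy_def)
    then show ?thesis by (rule power_less_imp_less_base) simp
  qed
  have dz: "deriv f (z n) = g (z n)" if "1 \<le> n" for n
    using deriv_f D[OF that, of "z n"] ord[OF that] by simp
  have z_dec: "decreases_to_zero (\<lambda>n. \<bar>deriv f (z n)\<bar>)"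
    unfolding decreases_to_zero_def
  proof
    show "strict_antimono_on {1..} (\<lambda>n. \<bar>deriv f (z n)\<bar>)"
    proof (rule strict_antimono_on_atLeast_1I)
      fix n :: nat assume n: "1 \<le> n"
      then show "\<bar>deriv f (z (n + 1))\<bar> < \<bar>deriv f (z n)\<bar>" using gz_dec[OF n] dz[OF n] dz[of "n + 1"] by simp
    qed
    have "\<forall>\<^sub>F n in sequentially. \<bar>g (z n)\<bar> = \<bar>deriv f (z n)\<bar>"
      by (rule eventually_sequentiallyI[of 1]) (simp add: dz)
    from Lim_transform_eventually[OF fx_lim(3) this]
    show "(\<lambda>n. \<bar>deriv f (z n)\<bar>) \<longlonglongrightarrow> 0" .
  qed
  have loc: "(odd n \<longrightarrow> local_max_at f (x n) \<and> 0 < f (x n)) \<and> (even n \<longrightarrow> local_min_at f (x n) \<and> f (x n) < 0)"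
    if n: "1 \<le> n" for n
  proof -
    \<comment> \<open>To the left of \<open>x n\<close> the sign of the slope comes from the
      preceding half cycle, and for n = 1 from the initial ascent.\<close>
    have "\<exists>l\<in>D. l < x n \<and> (\<forall>t. l < t \<and> t < x n \<longrightarrow> 0 < s n * g t)"
    proof (cases "n = 1")
      case True
      then show ?thesis using t0 c x1 sodd[of 1] by (intro bexI[of _ t0]) auto
    next
      case False
      then obtain m where m: "n = Suc m" "1 \<le> m" using n by (cases n) auto
      have "0 < s n * g t" if "x m < t" "t < x n" for t using gs[of m t] that m sSuc[of m] by simp
      then show ?thesis using xD[of m] ord[of m] m by (intro bexI[of _ "x m"]) auto
    qed
    then obtain l where l: "l \<in> D" "l < x n" "\<And>t. l < t \<Longrightarrow> t < x n \<Longrightarrow> 0 < s n * g t" by blast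
    have "local_max_at (\<lambda>t. s n * f t) (x n)"
      by (rule graph_ode.peak_at_sign_change[OF ode l(1,2), where b = "x (n + 1)"])
         (use l gs[OF n] ord[OF n] in \<open>auto intro: less_trans\<close>)
    then show ?thesis
      using fx[OF n] sodd[of n] seven[of n] by (auto simp: local_max_at_def local_min_at_def)
  qed
  have mono: "mono_on {x n..x (n + 1)} f \<or> antimono_on {x n..x (n + 1)} f" if n: "1 \<le> n" for n
  proof -
    have dec: "s n * f v < s n * f u" if "x n \<le> u" "u < v" "v \<le> x (n + 1)" for u v
      using graph_ode.f_antimono[OF ode, of u v n] D[OF n that(1)] that gs[OF n] by simp
    show ?thesis
    proof (cases "odd n")
      case True
      have "antimono_on {x n..x (n + 1)} f"
      proof (rule monotone_onI)
        fix u v assume "u \<in> {x n..x (n + 1)}" "v \<in> {x n..x (n + 1)}" "u \<le> v"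
        then show "f v \<le> f u" using dec[of u v] sodd[OF True] by (cases "u = v") auto
      qed
      then show ?thesis ..
    next
      case False
      have "mono_on {x n..x (n + 1)} f"
      proof (rule monotone_onI)
        fix u v assume "u \<in> {x n..x (n + 1)}" "v \<in> {x n..x (n + 1)}" "u \<le> v"
        then show "f u \<le> f v" using dec[of u v] seven[of n] False by (cases "u = v") auto
      qed
      then show ?thesis ..
    qed
  qed
  have infl: "y ` {1..} = {t \<in> D. inflection_at f t}"
  proof (intro equalityI subsetI)
    fix t assume "t \<in> y ` {1..}"
    then obtain n where n: "1 \<le> n" "t = y n" by auto
    have "inflection_at f (y n)"
      by (rule w_sign_change_imp_inflection[OF xD[OF n(1)], of _ "x (n + 1)" "s n"])
         (use n ord[OF n(1)] s1 w1[OF n(1)] w2[OF n(1)] in auto)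
    then show "t \<in> {t \<in> D. inflection_at f t}" using n D[OF n(1), of t] ord[OF n(1)] by simp
  next
    fix t assume "t \<in> {t \<in> D. inflection_at f t}"
    then have t: "t \<in> D" "f t + g t = 0" using inflection_imp_w_zero by auto
    \<comment> \<open>Before \<open>x 1\<close> the sum f + g is positive. After it, every point
      lies in one half cycle, in which the sum vanishes only at \<open>y n\<close>.\<close>
    then have "x 1 \<le> t" using before[of t] x1 by force
    then obtain n where n: "1 \<le> n" "x n \<le> t" "t < x (n + 1)"
      using unbounded_interval_index[OF xlim] by blast
    then have "t = y n" using w1[of n t] w2[of n t] t(2) by (cases t "y n" rule: linorder_cases) auto
    then show "t \<in> y ` {1..}" using n by simp
  qed
  have zeros: "z ` {1..} = {t. x 1 < t \<and> f t = 0}"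
  proof (intro equalityI subsetI)
    fix t assume "t \<in> z ` {1..}"
    then obtain n where n: "1 \<le> n" "t = z n" by auto
    then show "t \<in> {t. x 1 < t \<and> f t = 0}" using fz xge ord[OF n(1)] x1 by force
  next
    fix t assume "t \<in> {t. x 1 < t \<and> f t = 0}"
    then have t: "x 1 < t" "f t = 0" by auto
    then obtain n where n: "1 \<le> n" "x n \<le> t" "t < x (n + 1)"
      using unbounded_interval_index[OF xlim, of t] by auto
    have "t \<noteq> x n" using fx[OF n(1)] t(2) by auto
    then have "t = z n" using f1[of n t] f2[of n t] t(2) n by (cases t "z n" rule: linorder_cases) auto
    then show "t \<in> z ` {1..}" using n by simp
  qed
  have ineq: "y n - x n < x (n + 1) - y n \<and> x (n + 1) - z n < z (n + 1) - x (n + 1)" if n: "1 \<le> n" for n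
  proof
    show "y n - x n < x (n + 1) - y n"
      by (rule graph_ode.half_cycle_inflection_early[OF ode hc[OF n]])
    \<comment> \<open>Seen with the sign of index n + 1, half cycle n is the ascent to
      \<open>x (n + 1)\<close> and half cycle n + 1 the descent from it.\<close>
    have "(\<lambda>t. - (s (n + 1) * f t)) = (\<lambda>t. s n * f t)" "(\<lambda>t. - (s (n + 1) * g t)) = (\<lambda>t. s n * g t)"
      using sSuc[of n] by auto
    then show "x (n + 1) - z n < z (n + 1) - x (n + 1)"
      using graph_ode.zero_gaps_increase[OF ode[of "n + 1"], of "x n" "y n" "z n" "x (n + 1)"] hc[OF n] hc[of "n + 1"]
      by simp
  qed
  have "oscillation D f x y z"
    unfolding oscillation_def increases_to_infinity_def
  proof (intro conjI)
    show "smooth_on D f" using open_D f' g' by (rule smooth_on_graph_ode)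
    show "\<forall>n\<ge>1. 0 < x n \<and> 0 < y n \<and> 0 < z n"
    proof (intro allI impI)
      fix n :: nat assume n: "1 \<le> n"
      show "0 < x n \<and> 0 < y n \<and> 0 < z n" using xge[OF n] ord[OF n] c(1) t0(2) by linarith
    qed
    show "\<forall>n\<ge>1. x n < y n \<and> y n < z n \<and> z n < x (n + 1)" using ord by blast
    show "\<forall>n\<ge>1. \<bar>f (y n)\<bar> = \<bar>deriv f (y n)\<bar>"
    proof (intro allI impI)
      fix n :: nat assume n: "1 \<le> n"
      have "deriv f (y n) = g (y n)" using deriv_f D[OF n, of "y n"] ord[OF n] by simp
      then show "\<bar>f (y n)\<bar> = \<bar>deriv f (y n)\<bar>" using wy[OF n] by linarith
    qed
    show "decreases_to_zero (\<lambda>n. \<bar>f (x n)\<bar>)" "decreases_to_zero (\<lambda>n. \<bar>f (y n)\<bar>)"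
      unfolding decreases_to_zero_def
      using fx_lim strict_antimono_on_atLeast_1I[of "\<lambda>n. \<bar>f (x n)\<bar>", OF fx_dec]
        strict_antimono_on_atLeast_1I[of "\<lambda>n. \<bar>f (y n)\<bar>", OF fy_dec] by blast+
  qed (use xmono ymono zmono xlim ylim zlim loc infl mono z_dec ineq gap1 gap2 in blast)+
  then show ?thesis using that before(1) c(1) x1 zeros by blast
qed

end

subsection \<open>Curves without vertical tangent\<close>

lemma angle_flowD:
  assumes "angle_flow \<theta> \<phi> x"
  shows "(\<theta> has_real_derivative - (sin (\<theta> t + \<phi> t) ^ 3)) (at t)"
    and "(\<phi> has_real_derivative sin (\<theta> t) * cos (\<phi> t) ^ 5) (at t)"
    and "(x has_real_derivative cos (\<theta> t) * cos (\<phi> t) ^ 3) (at t)"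
    and "0 < cos (\<phi> t)" "- (pi / 2) < \<phi> t" "\<phi> t < pi / 2"
proof -
  have *: "\<bar>\<phi> t\<bar> < pi / 2" using assms by (simp add: angle_system_def)
  then show "- (pi / 2) < \<phi> t" "\<phi> t < pi / 2" by linarith+
  then show "0 < cos (\<phi> t)" by (rule cos_gt_zero_pi)
qed (use assms in \<open>simp_all add: angle_system_def\<close>)

lemma angle_flow_continuous:
  assumes "angle_flow \<theta> \<phi> x"
  shows "continuous_on S \<theta>" "continuous_on S \<phi>" "continuous_on S x"
  by (intro continuous_at_imp_continuous_on ballI DERIV_isCont[OF angle_flowD(1)[OF assms]]
      DERIV_isCont[OF angle_flowD(2)[OF assms]] DERIV_isCont[OF angle_flowD(3)[OF assms]])+

text \<open>The x-axis run through at unit speed is itself a flow line, so uniqueness leaves no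
  other one that is tangent to it at one of its points.\<close>

lemma angle_flow_equilibrium:
  assumes fl: "angle_flow \<theta> \<phi> x" and s: "\<phi> s = 0" "sin (\<theta> s) = 0"
  shows "\<phi> t = 0 \<and> \<theta> t = \<theta> s \<and> x t = x s + cos (\<theta> s) * (t - s)"
proof -
  have "angle_flow (\<lambda>_. \<theta> s) (\<lambda>_. 0) (\<lambda>t. x s + cos (\<theta> s) * (t - s))"
    using s(2) by (auto simp: angle_system_def intro!: derivative_eq_intros)
  then have *: "\<theta> = (\<lambda>_. \<theta> s) \<and> \<phi> = (\<lambda>_. 0) \<and> x = (\<lambda>t. x s + cos (\<theta> s) * (t - s))"
    by (rule angle_flow_unique[OF fl, of _ _ _ s]) (use s in simp_all)
  show ?thesis
    using fun_cong[OF *[THEN conjunct1], of t] fun_cong[OF *[THEN conjunct2, THEN conjunct1], of t]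
      fun_cong[OF *[THEN conjunct2, THEN conjunct2], of t] by blast
qed

text \<open>At a vertical tangent the derivative of cos \<theta> is sin^4 \<theta> cos^3 \<phi> > 0.
  So the abscissa can turn from decreasing to increasing but never back, and a flow line has at most
  one vertical tangent.\<close>

lemma cos_pos_forward:
  assumes fl: "angle_flow \<theta> \<phi> x" and s: "0 \<le> cos (\<theta> s)" "s < t"
  shows "0 < cos (\<theta> t)"
proof (rule ccontr)
  assume "\<not> 0 < cos (\<theta> t)"
  then have le: "cos (\<theta> t) \<le> 0" by simp
  have dc: "((\<lambda>u. cos (\<theta> u)) has_real_derivative sin (\<theta> u) * sin (\<theta> u + \<phi> u) ^ 3) (at u)" for u
    using DERIV_chain2[OF DERIV_cos angle_flowD(1)[OF fl]] by simp
  have dpos: "0 < sin (\<theta> u) * sin (\<theta> u + \<phi> u) ^ 3" if "cos (\<theta> u) = 0" for u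
  proof -
    have "sin (\<theta> u) * sin (\<theta> u + \<phi> u) ^ 3 = ((sin (\<theta> u))\<^sup>2)\<^sup>2 * cos (\<phi> u) ^ 3"
      using that by (simp add: sin_add power_mult_distrib power_numeral_reduce power2_eq_square)
    moreover have "(sin (\<theta> u))\<^sup>2 = 1" using that sin_cos_squared_add[of "\<theta> u"] by simp
    ultimately show ?thesis using angle_flowD(4)[OF fl, of u] by simp
  qed
  have "\<exists>u. s \<le> u \<and> u < t \<and> 0 < cos (\<theta> u)"
  proof (cases "cos (\<theta> s) = 0")
    case True
    from DERIV_pos_inc_right[OF dc dpos[OF True]]
    obtain d where d: "0 < d" "\<And>h. 0 < h \<Longrightarrow> h < d \<Longrightarrow> cos (\<theta> s) < cos (\<theta> (s + h))" by blast
    define h where "h = min (d / 2) ((t - s) / 2)"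
    have "(t - s) / 2 < t - s" using s(2) by (simp add: field_simps)
    then have "0 < h" "h < d" "h < t - s" using d(1) s(2) by (simp_all add: h_def min_def)
    then show ?thesis using d(2)[of h] True by (intro exI[of _ "s + h"]) auto
  next
    case False
    then show ?thesis using s by (intro exI[of _ s]) auto
  qed
  then obtain u where u: "s \<le> u" "u < t" "0 < cos (\<theta> u)" by blast
  have "continuous_on {u..t} (\<lambda>u. cos (\<theta> u))"
    by (intro continuous_intros angle_flow_continuous[OF fl])
  from first_zero_right[OF this less_imp_le[OF u(2)] u(3) le]
  obtain c where c: "u < c" "cos (\<theta> c) = 0" "\<And>v. u \<le> v \<Longrightarrow> v < c \<Longrightarrow> 0 < cos (\<theta> v)" by metis
  from DERIV_pos_inc_left[OF dc dpos[OF c(2)]]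
  obtain d where d: "0 < d" "\<And>h. 0 < h \<Longrightarrow> h < d \<Longrightarrow> cos (\<theta> (c - h)) < cos (\<theta> c)" by blast
  define h where "h = min (d / 2) (c - u)"
  have "0 < h" "h < d" "h \<le> c - u" using d(1) c(1) unfolding h_def by linarith+
  then show False using d(2)[of h] c(2) c(3)[of "c - h"] by simp
qed

text \<open>Height tan \<phi> and slope tan \<theta> obey the graph equation run at the speed
  \<open>m\<close> of the abscissa. The energy estimates thus apply to flow lines before time is
  replaced by the abscissa.\<close>

lemma flow_slopes:
  assumes fl: "angle_flow \<theta> \<phi> x" and c: "0 < cos (\<theta> t)"
  defines "m \<equiv> cos (\<theta> t) * cos (\<phi> t) ^ 3"
  shows "0 < m" "(x has_real_derivative m) (at t)"
    and "((\<lambda>t. tan (\<phi> t)) has_real_derivative m * tan (\<theta> t)) (at t)"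
    and "((\<lambda>t. tan (\<theta> t)) has_real_derivative - (m * (tan (\<phi> t) + tan (\<theta> t)) ^ 3)) (at t)"
proof -
  have cp: "0 < cos (\<phi> t)" by (rule angle_flowD(4)[OF fl])
  show "0 < m" using c cp by (simp add: m_def)
  show "(x has_real_derivative m) (at t)" unfolding m_def by (rule angle_flowD(3)[OF fl])
  have "((\<lambda>t. tan (\<phi> t)) has_real_derivative inverse ((cos (\<phi> t))\<^sup>2) * (sin (\<theta> t) * cos (\<phi> t) ^ 5)) (at t)"
    by (rule DERIV_chain2[OF DERIV_tan angle_flowD(2)[OF fl]]) (use cp in simp)
  moreover have "inverse (B\<^sup>2) * (S * B ^ 5) = A * B ^ 3 * (S / A)" if "0 < A" "0 < B" for A B S :: real
    using that by (simp add: field_simps power2_eq_square power3_eq_cube power_numeral_reduce)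
  ultimately show "((\<lambda>t. tan (\<phi> t)) has_real_derivative m * tan (\<theta> t)) (at t)"
    using c cp by (simp add: m_def tan_def)
  have "((\<lambda>t. tan (\<theta> t)) has_real_derivative inverse ((cos (\<theta> t))\<^sup>2) * - (sin (\<theta> t + \<phi> t) ^ 3)) (at t)"
    by (rule DERIV_chain2[OF DERIV_tan angle_flowD(1)[OF fl]]) (use c in simp)
  moreover have tt: "tan (\<phi> t) + tan (\<theta> t) = sin (\<theta> t + \<phi> t) / (cos (\<theta> t) * cos (\<phi> t))"
    using add_tan_eq[of "\<theta> t" "\<phi> t"] c cp by (simp add: add.commute)
  moreover have "inverse (A\<^sup>2) * - (S ^ 3) = - (A * B ^ 3 * (S / (A * B)) ^ 3)" if "0 < A" "0 < B" for A B S :: real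
    using that by (simp add: field_simps power2_eq_square power3_eq_cube)
  note this[OF c cp, of "sin (\<theta> t + \<phi> t)"]
  ultimately show "((\<lambda>t. tan (\<theta> t)) has_real_derivative - (m * (tan (\<phi> t) + tan (\<theta> t)) ^ 3)) (at t)"
    unfolding m_def tt by (simp only:)
qed

lemma cos_ge_of_tan_bound:
  fixes a M :: real
  assumes "0 < cos a" "\<bar>tan a\<bar> \<le> M"
  shows "1 / (1 + M\<^sup>2) \<le> cos a"
proof -
  have "(tan a)\<^sup>2 \<le> M\<^sup>2" using power_mono[OF assms(2) abs_ge_zero, of 2] by simp
  then have "(inverse (cos a))\<^sup>2 \<le> 1 + M\<^sup>2" using tan_sec[of a] assms(1) by simp
  moreover have "inverse (cos a) * 1 \<le> inverse (cos a) * inverse (cos a)"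
    using assms(1) by (intro mult_left_mono) (auto simp: one_le_inverse_iff)
  ultimately have "inverse (cos a) \<le> 1 + M\<^sup>2" by (simp add: power2_eq_square)
  moreover have "0 < 1 + M\<^sup>2" using zero_le_power2[of M] by linarith
  ultimately show ?thesis using assms(1) by (simp add: field_simps)
qed

lemma flow_energy_antimono:
  assumes fl: "angle_flow \<theta> \<phi> x" and st: "s \<le> t" and c: "\<And>u. s \<le> u \<Longrightarrow> u \<le> t \<Longrightarrow> 0 < cos (\<theta> u)"
  shows "energy (tan (\<phi> t)) (tan (\<theta> t)) \<le> energy (tan (\<phi> s)) (tan (\<theta> s))"
proof (rule DERIV_nonpos_imp_nonincreasing[OF st])
  fix u assume u: "s \<le> u" "u \<le> t"
  note d = flow_slopes[OF fl c[OF u]]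
  have "0 \<le> (tan (\<phi> u))\<^sup>2 * (tan (\<theta> u))\<^sup>2" "0 \<le> tan (\<theta> u) ^ 4" by simp_all
  then have "tan (\<phi> u) ^ 3 * tan (\<theta> u) - tan (\<theta> u) * (tan (\<phi> u) + tan (\<theta> u)) ^ 3 \<le> 0"
    using energy_deriv_le[of "tan (\<phi> u)" "tan (\<theta> u)"] by linarith
  with energy_deriv[OF d(3,4)] d(1)
  show "\<exists>y. ((\<lambda>u. energy (tan (\<phi> u)) (tan (\<theta> u))) has_real_derivative y) (at u) \<and> y \<le> 0"
    by (intro exI conjI) (assumption, simp add: mult_nonneg_nonpos)
qed

lemma flow_speed_lower_bound:
  assumes fl: "angle_flow \<theta> \<phi> x" and B: "0 \<le> B"
  obtains k where "0 < k" "\<And>t. 0 < cos (\<theta> t) \<Longrightarrow> energy (tan (\<phi> t)) (tan (\<theta> t)) \<le> B \<Longrightarrow>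
    k \<le> cos (\<theta> t) * cos (\<phi> t) ^ 3"
proof -
  define k where "k = 1 / (1 + (1 + 4 * B)\<^sup>2)"
  have k: "0 < k" using zero_le_power2[of "1 + 4 * B"] by (simp add: k_def add_pos_nonneg)
  have "k * k ^ 3 \<le> cos (\<theta> t) * cos (\<phi> t) ^ 3"
    if c: "0 < cos (\<theta> t)" and E: "energy (tan (\<phi> t)) (tan (\<theta> t)) \<le> B" for t
  proof (intro mult_mono power_mono)
    show "k \<le> cos (\<theta> t)" unfolding k_def
      by (rule cos_ge_of_tan_bound[OF c energy_bounds(2)[OF E B]])
    show "k \<le> cos (\<phi> t)" unfolding k_def
      by (rule cos_ge_of_tan_bound[OF angle_flowD(4)[OF fl] energy_bounds(1)[OF E B]])
  qed (use k c in auto)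
  then show ?thesis using that[of "k * k ^ 3"] k by simp
qed

text \<open>The energy does not increase, so height and slope stay bounded in the future, and this
  bounds the speed of the abscissa away from 0.\<close>

lemma flow_x_at_top:
  assumes fl: "angle_flow \<theta> \<phi> x" and c: "\<And>t. s \<le> t \<Longrightarrow> 0 < cos (\<theta> t)"
  shows "filterlim x at_top at_top"
proof -
  define B where "B = energy (tan (\<phi> s)) (tan (\<theta> s))"
  obtain k where k: "0 < k" "\<And>t. 0 < cos (\<theta> t) \<Longrightarrow> energy (tan (\<phi> t)) (tan (\<theta> t)) \<le> B \<Longrightarrow>
      k \<le> cos (\<theta> t) * cos (\<phi> t) ^ 3"
    using flow_speed_lower_bound[OF fl energy_nonneg] unfolding B_def by blast
  have "x s - k * s \<le> x t - k * t" if t: "s \<le> t" for t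
  proof (rule DERIV_nonneg_imp_nondecreasing[OF t])
    fix u assume u: "s \<le> u" "u \<le> t"
    have "energy (tan (\<phi> u)) (tan (\<theta> u)) \<le> B"
      unfolding B_def by (rule flow_energy_antimono[OF fl u(1)]) (rule c)
    from k(2)[OF c[OF u(1)] this] DERIV_diff[OF angle_flowD(3)[OF fl] DERIV_cmult_Id[of k], of u]
    show "\<exists>y. ((\<lambda>t. x t - k * t) has_real_derivative y) (at u) \<and> 0 \<le> y"
      by (intro exI conjI) (assumption, simp)
  qed
  then have ev: "\<forall>\<^sub>F t in at_top. x s - k * s + k * t \<le> x t"
    unfolding eventually_at_top_linorder by (intro exI[of _ s]) (force simp: algebra_simps)
  have "filterlim (\<lambda>t. x s - k * s + k * t) at_top at_top"
    by (intro filterlim_tendsto_add_at_top[OF tendsto_const]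
        filterlim_tendsto_pos_mult_at_top[OF tendsto_const k(1)] filterlim_ident)
  then show ?thesis using ev by (rule filterlim_at_top_mono)
qed

lemma flow_x_strict_mono:
  assumes fl: "angle_flow \<theta> \<phi> x" and st: "s < t" and c: "\<And>u. s < u \<Longrightarrow> u < t \<Longrightarrow> 0 < cos (\<theta> u)"
  shows "x s < x t"
proof (rule DERIV_pos_imp_increasing_open[OF st])
  fix u assume u: "s < u" "u < t"
  show "\<exists>y. (x has_real_derivative y) (at u) \<and> 0 < y"
    using flow_slopes(1,2)[OF fl c[OF u]] by blast
qed (rule angle_flow_continuous[OF fl])

text \<open>Passage from time to abscissa, with \<open>r\<close> the inverse of \<open>x\<close> on
  \<open>S\<close>. The set of abscissas is upward closed because \<open>x\<close> tends to
  infinity.\<close>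

lemma flow_graph_ode:
  assumes fl: "angle_flow \<theta> \<phi> x" and S: "open S" "connected S" "S \<noteq> {}" "\<And>s t. s \<in> S \<Longrightarrow> s \<le> t \<Longrightarrow> t \<in> S"
    and c: "\<And>t. t \<in> S \<Longrightarrow> 0 < cos (\<theta> t)"
    and nz: "\<And>t. \<phi> t \<noteq> 0 \<or> sin (\<theta> t) \<noteq> 0"
    and r: "\<And>t. t \<in> S \<Longrightarrow> r (x t) = t"
  shows "graph_ode (x ` S) (\<lambda>t. tan (\<phi> (r t))) (\<lambda>t. tan (\<theta> (r t)))"
proof
  have inj: "inj_on x S" by (rule inj_on_inverseI[of S r]) (rule r)
  show op: "open (x ` S)"
    by (rule invariance_of_domain[OF angle_flow_continuous(3)[OF fl] S(1) inj])
  obtain s0 where s0: "s0 \<in> S" using S(3) by blast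
  have lim: "filterlim x at_top at_top"
    by (rule flow_x_at_top[OF fl, of s0]) (use c S(4)[OF s0] in blast)
  show "v \<in> x ` S" if u: "u \<in> x ` S" "u \<le> v" for u v
  proof -
    obtain s where s: "s \<in> S" "u = x s" using u by blast
    have "\<forall>\<^sub>F t in at_top. v \<le> x t" using lim by (simp add: filterlim_at_top)
    then obtain T where T: "\<And>t. T \<le> t \<Longrightarrow> v \<le> x t" by (auto simp: eventually_at_top_linorder)
    have "max T s \<in> S" using S(4)[OF s(1)] by simp
    moreover have "v \<le> x (max T s)" using T by simp
    moreover have "x s \<le> v" using u s by simp
    ultimately have "\<exists>t\<in>S. x t = v"
      using continuous_reaches[OF S(2) angle_flow_continuous(3)[OF fl] s(1), of "max T s" v] by blast
    then show ?thesis by blast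
  qed
  have cont_r: "continuous_on (x ` S) r"
    by (rule continuous_on_inverse_open[OF S(1) angle_flow_continuous(3)[OF fl]]) (use r in simp_all)
  fix t assume t: "t \<in> x ` S"
  then have rt: "r t \<in> S" "x (r t) = t" using r by auto
  obtain e where e: "0 < e" "ball t e \<subseteq> x ` S" using op t open_contains_ball by blast
  have m: "(x has_real_derivative cos (\<theta> (r t)) * cos (\<phi> (r t)) ^ 3) (at (r t))"
    "0 < cos (\<theta> (r t)) * cos (\<phi> (r t)) ^ 3"
    using flow_slopes(1,2)[OF fl c[OF rt(1)]] by blast+
  have dr: "(r has_real_derivative inverse (cos (\<theta> (r t)) * cos (\<phi> (r t)) ^ 3)) (at t)"
  proof (rule DERIV_inverse_function[where f = x and a = "t - e" and b = "t + e"])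
    show "isCont r t" using cont_r op t continuous_on_eq_continuous_at by blast
    show "x (r y) = y" if "t - e < y" "y < t + e" for y
    proof -
      have "y \<in> ball t e" using that by (simp add: dist_real_def abs_less_iff)
      then have "y \<in> x ` S" using e(2) by blast
      then show ?thesis using r by auto
    qed
  qed (use m e in auto)
  note d = flow_slopes(3,4)[OF fl c[OF rt(1)]]
  have k: "M * T * inverse M = T" "- (M * T) * inverse M = - T" if "0 < M" for M T :: real
    using that by simp_all
  show "((\<lambda>t. tan (\<phi> (r t))) has_real_derivative tan (\<theta> (r t))) (at t)"
    using DERIV_chain2[OF d(1) dr] unfolding k(1)[OF m(2)] .
  show "((\<lambda>t. tan (\<theta> (r t))) has_real_derivative - ((tan (\<phi> (r t)) + tan (\<theta> (r t))) ^ 3)) (at t)"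
    using DERIV_chain2[OF d(2) dr] unfolding k(2)[OF m(2)] .
  show "tan (\<phi> (r t)) \<noteq> 0 \<or> tan (\<theta> (r t)) \<noteq> 0"
  proof -
    have "sin (\<theta> (r t)) \<noteq> 0" if "\<phi> (r t) = 0" using nz[of "r t"] that by simp
    moreover have "tan (\<phi> (r t)) \<noteq> 0" if "\<phi> (r t) \<noteq> 0"
      using that angle_flowD(5,6)[OF fl, of "r t"] tan_gt_zero[of "\<phi> (r t)"] tan_gt_zero[of "- \<phi> (r t)"]
      by (cases "0 < \<phi> (r t)") auto
    ultimately show ?thesis using c[OF rt(1)] by (auto simp: tan_def)
  qed
qed

subsection \<open>Curves with a vertical tangent\<close>

text \<open>The inverse is restricted to nonnegative times because the times before the vertical
  tangent lead over the same abscissas again.\<close>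

definition right_branch :: "(real \<Rightarrow> real) \<Rightarrow> (real \<Rightarrow> real) \<Rightarrow> real \<Rightarrow> real" where
  "right_branch \<phi> x t = tan (\<phi> (inv_into {0..} x t))"

lemma right_branch:
  assumes fl: "angle_flow \<theta> \<phi> x" and 0: "\<theta> 0 = pi / 2" "x 0 = 0"
  shows "half_line_branch (right_branch \<phi> x)"
    and "0 \<le> s \<Longrightarrow> right_branch \<phi> x (x s) = tan (\<phi> s)"
    and "0 \<le> s \<Longrightarrow> s < t \<Longrightarrow> x s < x t" and "filterlim x at_top at_top"
proof -
  define r where "r = inv_into {0..} x"
  define f g where "f = (\<lambda>t. tan (\<phi> (r t)))" and "g = (\<lambda>t. tan (\<theta> (r t)))"
  have fb: "right_branch \<phi> x = f" by (simp add: fun_eq_iff right_branch_def f_def r_def)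
  have c: "0 < cos (\<theta> t)" if "0 < t" for t
    using cos_pos_forward[OF fl _ that] 0 by simp
  show xm: "x s < x t" if "0 \<le> s" "s < t" for s t
    by (rule flow_x_strict_mono[OF fl that(2)]) (use c that in simp)
  show xlim: "filterlim x at_top at_top"
    by (rule flow_x_at_top[OF fl, of 1]) (use c in simp)
  have inj: "inj_on x {0..}"
    by (rule linorder_inj_onI) (use xm in fastforce)+
  have r: "r (x t) = t" if "0 \<le> t" for t
    unfolding r_def using inj that by simp
  then show "right_branch \<phi> x (x s) = tan (\<phi> s)" if "0 \<le> s" for s using that by (simp add: fb f_def)
  have r0: "r 0 = 0" using r[of 0] 0 by simp
  have img: "x ` {0<..} = {0<..}"
  proof
    show "x ` {0<..} \<subseteq> {0<..}" using xm[of 0] 0 by auto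
    show "{0<..} \<subseteq> x ` {0<..}"
    proof
      fix v :: real assume v: "v \<in> {0<..}"
      have "\<forall>\<^sub>F t in at_top. v \<le> x t" using xlim by (simp add: filterlim_at_top)
      then obtain T where "\<And>t. T \<le> t \<Longrightarrow> v \<le> x t" by (auto simp: eventually_at_top_linorder)
      then have "v \<le> x (max T 0)" by simp
      then obtain t where t: "0 \<le> t" "x t = v"
        using continuous_reaches[OF _ angle_flow_continuous(3)[OF fl], of "{0..}" 0 "max T 0" v] v 0
        by auto
      then have "t \<noteq> 0" using v 0 by auto
      then show "v \<in> x ` {0<..}" using t by auto
    qed
  qed
  have rpos: "0 < r t \<and> x (r t) = t" if "0 < t" for t
  proof -
    have "t \<in> x ` {0<..}" unfolding img using that by simp
    then show ?thesis using r by auto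
  qed
  have nz: "\<phi> t \<noteq> 0 \<or> sin (\<theta> t) \<noteq> 0" for t
  proof (rule ccontr)
    assume "\<not> ?thesis"
    then have "sin (\<theta> 0) = 0" using angle_flow_equilibrium[OF fl, of t 0] by auto
    then show False using 0 by simp
  qed
  interpret graph_ode "{0<..}" f g
    using flow_graph_ode[OF fl, of "{0<..}" r] c nz r unfolding img f_def g_def by auto
  have rlim: "filterlim r (at_right 0) (at_right 0)"
  proof (rule tendsto_imp_filterlim_at_right)
    show "\<forall>\<^sub>F t in at_right 0. 0 < r t"
      by (rule eventually_at_rightI[of 0 1]) (use rpos in auto)
    show "(r \<longlongrightarrow> 0) (at_right 0)"
    proof (rule tendstoI)
      fix e :: real assume e: "0 < e"
      show "\<forall>\<^sub>F t in at_right 0. dist (r t) 0 < e"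
      proof (rule eventually_at_rightI[of 0 "x e"])
        show "0 < x e" using xm[of 0 e] e 0 by simp
        fix t assume t: "t \<in> {0<..<x e}"
        then have "r t < e" using xm[of e "r t"] rpos[of t] e by (cases "r t" e rule: linorder_cases) auto
        then show "dist (r t) 0 < e" using rpos[of t] t by (simp add: dist_real_def)
      qed
    qed
  qed
  have "((\<lambda>t. tan (\<phi> t)) \<longlongrightarrow> tan (\<phi> 0)) (at_right 0)"
  proof (rule tendsto_tan)
    show "(\<phi> \<longlongrightarrow> \<phi> 0) (at_right 0)"
      using DERIV_isCont[OF angle_flowD(2)[OF fl, of 0]] by (simp add: isCont_def filterlim_at_split)
    show "cos (\<phi> 0) \<noteq> 0" using angle_flowD(4)[OF fl, of 0] by simp
  qed
  from filterlim_compose[OF this rlim] have flim: "(f \<longlongrightarrow> f 0) (at_right 0)"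
    by (simp add: f_def r0)
  \<comment> \<open>The angle passes pi / 2 decreasingly, so the slope tends to plus and not to
    minus infinity.\<close>
  have "filterlim \<theta> (at_left (pi / 2)) (at_right 0)"
  proof (rule tendsto_imp_filterlim_at_left)
    show "(\<theta> \<longlongrightarrow> pi / 2) (at_right 0)"
      using DERIV_isCont[OF angle_flowD(1)[OF fl, of 0]] 0 by (simp add: isCont_def filterlim_at_split)
    have "sin (\<theta> 0 + \<phi> 0) = cos (\<phi> 0)" unfolding 0(1) by (simp add: sin_add)
    then have "- (sin (\<theta> 0 + \<phi> 0) ^ 3) < 0" using angle_flowD(4)[OF fl, of 0] by simp
    from DERIV_neg_dec_right[OF angle_flowD(1)[OF fl] this]
    obtain d where d: "0 < d" "\<And>h. 0 < h \<Longrightarrow> h < d \<Longrightarrow> \<theta> (0 + h) < \<theta> 0" by blast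
    show "\<forall>\<^sub>F t in at_right 0. \<theta> t < pi / 2"
      by (rule eventually_at_rightI[of 0 d]) (use d 0 in auto)
  qed
  from filterlim_compose[OF filterlim_tan_at_left filterlim_compose[OF this rlim]]
  have glim: "filterlim g at_top (at_right 0)" by (simp add: g_def)
  have "\<forall>\<^sub>F t in at_right 0. g t = deriv f t"
    by (rule eventually_at_rightI[of 0 1]) (use deriv_f in auto)
  with glim have dlim: "filterlim (deriv f) at_top (at_right 0)"
    by (rule filterlim_mono_eventually[OF _ order_refl order_refl])
  have "\<forall>\<^sub>F t in at_right 0. 0 < g t \<and> 0 < f t + g t"
  proof -
    have "\<forall>\<^sub>F t in at_right 0. \<bar>f 0\<bar> + 1 \<le> g t" using glim by (simp add: filterlim_at_top)
    moreover have "\<forall>\<^sub>F t in at_right 0. f 0 - 1 < f t" using flim by (rule order_tendstoD) simp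
    ultimately show ?thesis by eventually_elim linarith
  qed
  then obtain b where b: "0 < b" "\<And>t. 0 < t \<Longrightarrow> t < b \<Longrightarrow> 0 < g t \<and> 0 < f t + g t"
    by (auto simp: eventually_at_right_field)
  obtain X Y Z where osc: "oscillation {0<..} f X Y Z" "b / 2 < X 1"
      "\<And>t. t \<in> {0<..} \<Longrightarrow> t < X 1 \<Longrightarrow> 0 < g t" "Z ` {1..} = {t. X 1 < t \<and> f t = 0}"
    by (rule oscillation_exists[of "b / 2"]) (use b in auto)
  \<comment> \<open>The branch rises up to its first maximum. If it starts at a nonnegative height,
    it has no zero in between, and the zeros beyond \<open>X 1\<close> are all the positive
    ones.\<close>
  have "f 0 < f t" if t: "0 < t" "t \<le> X 1" for t
  proof (rule DERIV_pos_imp_increasing_open[OF t(1)])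
    show "\<exists>y. (f has_real_derivative y) (at u) \<and> 0 < y" if "0 < u" "u < t" for u
      using f'[of u] osc(3)[of u] that t by (intro exI[of _ "g u"]) simp
    show "continuous_on {0..t} f"
    proof (rule continuous_on_IccI)
      show "(f \<longlongrightarrow> f 0) (at_right 0)" by (rule flim)
      show "(f \<longlongrightarrow> f t) (at_left t)"
        using DERIV_isCont[OF f'[of t]] t by (simp add: isCont_def filterlim_at_split)
      show "f \<midarrow>u\<rightarrow> f u" if "0 < u" "u < t" for u
        using DERIV_isCont[OF f'[of u]] that by (simp add: isCont_def)
    qed (rule t(1))
  qed
  then have zeros: "{t. X 1 < t \<and> f t = 0} = {t. 0 < t \<and> f t = 0}" if "0 \<le> f 0"
    using that osc(2) b(1) by (force simp: not_less)
  show "half_line_branch (right_branch \<phi> x)"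
    unfolding half_line_branch_def fb
    using dlim osc(1,4) zeros by (intro conjI exI[of _ X] exI[of _ Y] exI[of _ Z] impI) simp_all
qed

lemma line_homeomorphism:
  fixes h :: "real \<Rightarrow> real"
  assumes c: "continuous_on UNIV h" and m: "strict_mono h"
    and lim: "filterlim h at_top at_top" "filterlim h at_bot at_bot"
  obtains h' where "homeomorphism UNIV UNIV h h'"
proof -
  have "inj h" using m by (rule strict_mono_imp_inj_on)
  then obtain h' where "homeomorphism UNIV (range h) h h'"
    using invariance_of_domain_homeomorphism[OF open_UNIV c] by auto
  moreover have "range h = UNIV"
  proof (intro equalityI subsetI UNIV_I)
    fix v :: real
    have "\<forall>\<^sub>F t in at_top. v \<le> h t" "\<forall>\<^sub>F t in at_bot. h t \<le> v"
      using lim by (simp_all add: filterlim_at_top filterlim_at_bot)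
    then obtain b a where "v \<le> h b" "h a \<le> v"
      unfolding eventually_at_top_linorder eventually_at_bot_linorder by blast
    then show "v \<in> range h"
      using continuous_reaches[OF connected_UNIV c UNIV_I UNIV_I] by (metis rangeI)
  qed
  ultimately show ?thesis using that by simp
qed

definition height_curve :: "(real \<Rightarrow> real) \<Rightarrow> (real \<Rightarrow> real) \<Rightarrow> real \<Rightarrow> real^2" where
  "height_curve \<phi> x u = vector [x u, tan (\<phi> u)]"

text \<open>The branch before the vertical tangent becomes, after reversal of time and reflection, a
  flow line that also starts with a vertical tangent. At height 0 the two have the same initial
  data, so uniqueness gives the symmetry.\<close>

lemma vertical_tangent_classification:
  assumes fl: "angle_flow \<theta> \<phi> x" and 0: "\<theta> 0 = pi / 2" "x 0 = 0" "0 \<le> \<phi> 0"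
  shows "\<exists>f1 f2. two_branch_profile f1 f2 \<and> f1 0 = tan (\<phi> 0) \<and>
    parametrizes UNIV (height_curve \<phi> x) (two_branch_curve f1 f2)"
proof -
  \<comment> \<open>The full turn brings the initial angle - (pi / 2 + pi) back to pi / 2.\<close>
  define \<theta>' \<phi>' x' where "\<theta>' = (\<lambda>t. - (\<theta> (- t) + pi) + 2 * pi * of_int 1)"
    and "\<phi>' = (\<lambda>t. - \<phi> (- t))" and "x' = (\<lambda>t. x (- t))"
  have fl': "angle_flow \<theta>' \<phi>' x'"
    unfolding \<theta>'_def \<phi>'_def x'_def
    by (intro angle_system_full_turns angle_system_reflect angle_flow_reverse fl)
  have ini': "\<theta>' 0 = pi / 2" "x' 0 = 0" using 0 by (simp_all add: \<theta>'_def x'_def)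
  note b1 = right_branch[OF fl 0(1,2)] and b2 = right_branch[OF fl' ini']
  let ?f1 = "right_branch \<phi> x" and ?f2 = "right_branch \<phi>' x'"
  have f0: "?f1 0 = tan (\<phi> 0)" "?f2 0 = - tan (\<phi> 0)"
    using b1(2)[of 0] b2(2)[of 0] 0(2) ini'(2) by (simp_all add: \<phi>'_def)
  have "0 \<le> tan (\<phi> 0)"
    using 0(3) tan_gt_zero[of "\<phi> 0"] angle_flowD(6)[OF fl, of 0] by (cases "\<phi> 0 = 0") auto
  moreover have "?f1 = ?f2" if "?f1 0 = 0"
  proof -
    have "\<phi> 0 = 0"
      using that f0(1) 0(3) tan_gt_zero[of "\<phi> 0"] angle_flowD(6)[OF fl, of 0] by (cases "\<phi> 0 = 0") auto
    then have "\<theta> = \<theta>' \<and> \<phi> = \<phi>' \<and> x = x'"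
      by (intro angle_flow_unique[OF fl fl', of 0]) (use 0 ini' in \<open>simp_all add: \<phi>'_def\<close>)
    then show ?thesis by simp
  qed
  ultimately have prof: "two_branch_profile ?f1 ?f2"
    unfolding two_branch_profile_def using f0 b1(1) b2(1) by auto
  \<comment> \<open>As \<open>x 0 = 0\<close>, this is x at nonnegative and - x at nonpositive
    times, which is the signed parameter of \<open>two_branch_curve\<close>.\<close>
  define h where "h t = x (max t 0) - x (min t 0)" for t
  have h1: "h t = x t" if "0 \<le> t" for t using that 0(2) by (simp add: h_def max_def min_def)
  have h2: "h t = - x t" if "t \<le> 0" for t using that 0(2) by (simp add: h_def max_def min_def)
  have x1: "0 < x t" if "0 < t" for t using b1(3)[of 0 t] that 0(2) by simp
  have x2: "x t < x s" if "s < t" "t \<le> 0" for s t using b2(3)[of "- t" "- s"] that by (simp add: x'_def)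
  have "continuous_on UNIV h"
    unfolding h_def by (intro continuous_intros continuous_on_compose2[OF angle_flow_continuous(3)[OF fl, of UNIV]]) auto
  moreover have "strict_mono h"
  proof (rule strict_monoI)
    fix s t :: real assume st: "s < t"
    consider "0 \<le> s" | "t \<le> 0" | "s < 0" "0 < t" by linarith
    then show "h s < h t"
    proof cases
      case 1
      then show ?thesis using h1[of s] h1[of t] b1(3)[of s t] st by simp
    next
      case 2
      then show ?thesis using h2[of s] h2[of t] x2[of s t] st by simp
    next
      case 3
      then show ?thesis using h2[of s] h1[of t] x2[of s 0] x1[of t] 0(2) by simp
    qed
  qed
  moreover have "filterlim h at_top at_top"
  proof (rule filterlim_mono_eventually[OF b1(4) order_refl order_refl])
    show "\<forall>\<^sub>F t in at_top. x t = h t"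
      unfolding eventually_at_top_linorder by (intro exI[of _ 0]) (simp add: h1)
  qed
  moreover have "filterlim h at_bot at_bot"
    unfolding filterlim_at_bot
  proof
    fix B
    have "\<forall>\<^sub>F t in at_top. - B \<le> x' t" using b2(4) by (simp add: filterlim_at_top)
    then obtain T where T: "\<And>t. T \<le> t \<Longrightarrow> - B \<le> x' t" by (auto simp: eventually_at_top_linorder)
    show "\<forall>\<^sub>F t in at_bot. h t \<le> B"
      unfolding eventually_at_bot_linorder
    proof (intro exI allI impI)
      fix t assume "t \<le> min 0 (- T)"
      then show "h t \<le> B" using T[of "- t"] h2[of t] by (simp add: x'_def)
    qed
  qed
  ultimately obtain h' where hom: "homeomorphism UNIV UNIV h h'" by (rule line_homeomorphism)
  have "height_curve \<phi> x u = two_branch_curve ?f1 ?f2 (h u)" for u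
  proof (cases "0 \<le> u")
    case True
    then have "0 \<le> x u" using x1[of u] 0(2) by (cases "u = 0") auto
    then show ?thesis using True h1[of u] b1(2)[of u] by (simp add: height_curve_def two_branch_curve_def)
  next
    case False
    then have "0 < x u" using x2[of u 0] 0(2) by simp
    then show ?thesis using False h2[of u] b2(2)[of "- u"]
      by (simp add: height_curve_def two_branch_curve_def x'_def \<phi>'_def)
  qed
  then have "parametrizes UNIV (height_curve \<phi> x) (two_branch_curve ?f1 ?f2)"
    unfolding parametrizes_def using hom by blast
  then show ?thesis using prof f0 by blast
qed

subsection \<open>Entire graphs\<close>

text \<open>A barrier argument: \<open>h\<close> crosses zero only upward, so before a nonpositive
  value it must have been negative throughout.\<close>

lemma negative_backward:
  fixes h :: "real \<Rightarrow> real"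
  assumes h: "\<And>t. t \<le> s \<Longrightarrow> (h has_real_derivative h' t) (at t)" and s: "h s \<le> 0"
    and up: "\<And>t. t \<le> s \<Longrightarrow> h t = 0 \<Longrightarrow> 0 < h' t" and t: "t < s"
  shows "h t < 0"
proof (rule ccontr)
  assume nt: "\<not> h t < 0"
  have "\<exists>b. t < b \<and> b \<le> s \<and> h b < 0"
  proof (cases "h s = 0")
    case True
    from DERIV_pos_inc_left[OF h[OF order_refl] up[OF order_refl True]]
    obtain d where d: "0 < d" "\<And>e. 0 < e \<Longrightarrow> e < d \<Longrightarrow> h (s - e) < h s" by blast
    define e where "e = min (d / 2) ((s - t) / 2)"
    have "(s - t) / 2 < s - t" using t by (simp add: field_simps)
    then have e: "0 < e" "e < d" "e < s - t" using d(1) t by (simp_all add: e_def min_def)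
    then show ?thesis using d(2)[of e] True by (intro exI[of _ "s - e"]) simp
  next
    case False
    then show ?thesis using s t by (intro exI[of _ s]) simp
  qed
  then obtain b where b: "t < b" "b \<le> s" "h b < 0" by blast
  have "continuous_on {t..b} (\<lambda>u. - h u)"
    by (intro continuous_on_minus continuous_at_imp_continuous_on ballI DERIV_isCont[OF h]) (use b in auto)
  from first_zero_left[OF this less_imp_le[OF b(1)]] b(3) nt
  obtain c where c: "t \<le> c" "c < b" "- h c = 0" "\<And>u. c < u \<Longrightarrow> u \<le> b \<Longrightarrow> 0 < - h u"
    by (metis neg_0_less_iff_less neg_le_0_iff_le not_le_imp_less not_less)
  have cs: "c \<le> s" "h c = 0" using b c by auto
  from DERIV_pos_inc_right[OF h[OF cs(1)] up[OF cs]]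
  obtain d where d: "0 < d" "\<And>e. 0 < e \<Longrightarrow> e < d \<Longrightarrow> h c < h (c + e)" by blast
  define e where "e = min (d / 2) (b - c)"
  have "0 < e" "e < d" "c + e \<le> b" using d(1) c(2) by (simp_all add: e_def min_def)
  then show False using d(2)[of e] c(4)[of "c + e"] cs(2) by simp
qed

text \<open>Flow lines that have no vertical tangent and run to the right, other than the line y =
  0. What remains to be understood is their behaviour backward in time.\<close>

locale strip_flow =
  fixes \<theta> \<phi> x :: "real \<Rightarrow> real"
  assumes fl: "angle_flow \<theta> \<phi> x" and strip: "\<And>t. - (pi / 2) < \<theta> t" "\<And>t. \<theta> t < pi / 2"
    and nz: "\<And>t. \<phi> t \<noteq> 0 \<or> \<theta> t \<noteq> 0"
begin

abbreviation F :: "real \<Rightarrow> real" where "F t \<equiv> tan (\<phi> t)"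
abbreviation G :: "real \<Rightarrow> real" where "G t \<equiv> tan (\<theta> t)"
abbreviation W :: "real \<Rightarrow> real" where "W t \<equiv> F t + G t"
definition m :: "real \<Rightarrow> real" where "m t = cos (\<theta> t) * cos (\<phi> t) ^ 3"

lemma cos_pos: "0 < cos (\<theta> t)"
  using strip by (rule cos_gt_zero_pi)

lemmas phi_bounds = angle_flowD(5,6)[OF fl]

lemma slopes:
  shows m_pos: "0 < m t" and x': "(x has_real_derivative m t) (at t)"
    and F': "(F has_real_derivative m t * G t) (at t)"
    and G': "(G has_real_derivative - (m t * W t ^ 3)) (at t)"
  unfolding m_def using flow_slopes[OF fl cos_pos] by blast+

lemma W': "(W has_real_derivative m t * (G t - W t ^ 3)) (at t)"
  using DERIV_add[OF F' G'] by (simp add: right_diff_distrib)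

lemma sign_F: "F t < 0 \<longleftrightarrow> \<phi> t < 0" "0 < F t \<longleftrightarrow> 0 < \<phi> t"
  using tan_mono_lt_eq[of "\<phi> t" 0] tan_mono_lt_eq[of 0 "\<phi> t"] phi_bounds[of t] by simp_all

lemma sign_G: "G t < 0 \<longleftrightarrow> \<theta> t < 0" "0 < G t \<longleftrightarrow> 0 < \<theta> t"
  using tan_mono_lt_eq[of "\<theta> t" 0] tan_mono_lt_eq[of 0 "\<theta> t"] strip[of t] by simp_all

lemma sign_W: "0 < W t \<longleftrightarrow> 0 < \<theta> t + \<phi> t"
proof -
  have "0 < W t \<longleftrightarrow> tan (- \<theta> t) < tan (\<phi> t)" unfolding tan_minus by linarith
  also have "\<dots> \<longleftrightarrow> - \<theta> t < \<phi> t"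
    using strip[of t] phi_bounds[of t] by (intro tan_mono_lt_eq) auto
  finally show ?thesis by linarith
qed

lemma reflect: "strip_flow (\<lambda>t. - \<theta> t) (\<lambda>t. - \<phi> t) x"
proof
  show "angle_flow (\<lambda>t. - \<theta> t) (\<lambda>t. - \<phi> t) x" by (rule angle_system_reflect[OF fl])
  fix t
  show "- (pi / 2) < - \<theta> t" "- \<theta> t < pi / 2" using strip[of t] by simp_all
  show "- \<phi> t \<noteq> 0 \<or> - \<theta> t \<noteq> 0" using nz[of t] by simp
qed

lemma sin_nz: "\<phi> t \<noteq> 0 \<or> sin (\<theta> t) \<noteq> 0"
  using nz[of t] sign_G[of t] cos_pos[of t] by (auto simp: tan_def)

lemma energy_pos: "0 < energy (F t) (G t)"
proof -
  have "F t \<noteq> 0 \<or> G t \<noteq> 0" using nz[of t] sign_F[of t] sign_G[of t] by force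
  then have "F t ^ 4 \<noteq> 0 \<or> (G t)\<^sup>2 \<noteq> 0" by simp
  moreover have "0 \<le> F t ^ 4" "0 \<le> (G t)\<^sup>2" by simp_all
  ultimately show ?thesis unfolding energy_def by linarith
qed

lemma energy_antimono: "s \<le> t \<Longrightarrow> energy (F t) (G t) \<le> energy (F s) (G s)"
  by (rule flow_energy_antimono[OF fl]) (auto simp: cos_pos)

text \<open>Bounded energy would bound the speed of the abscissa from below, so arbitrarily long
  distances would be covered within an energy band, against
  \<open>energy_level_time_bound\<close>.\<close>

lemma energy_unbounded_backward: "\<exists>T. \<forall>t\<le>T. B < energy (F t) (G t)"
proof (rule ccontr)
  assume "\<not> ?thesis"
  then have le: "energy (F t) (G t) \<le> B" for t
    using energy_antimono by (meson linorder_not_less order_trans)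
  then have "0 < B" using energy_pos[of 0] le[of 0] by linarith
  obtain k where k: "0 < k" "\<And>t. k \<le> m t"
    using flow_speed_lower_bound[OF fl less_imp_le[OF \<open>0 < B\<close>]] cos_pos le unfolding m_def by metis
  have x_low: "k * n \<le> x 0 - x (- n)" if "0 \<le> n" for n
  proof -
    have "x (- n) - k * (- n) \<le> x 0 - k * 0"
    proof (rule DERIV_nonneg_imp_nondecreasing[where f = "\<lambda>t. x t - k * t"])
      fix u :: real
      show "\<exists>y. ((\<lambda>t. x t - k * t) has_real_derivative y) (at u) \<and> 0 \<le> y"
        using DERIV_diff[OF x'[of u] DERIV_cmult_Id[of k]] k(2)[of u] by (intro exI conjI) (assumption, simp)
    qed (use that in simp)
    then show ?thesis by simp
  qed
  obtain K where K: "\<And>a b m f g X. \<lbrakk>a \<le> b;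
      \<And>t. a \<le> t \<Longrightarrow> t \<le> b \<Longrightarrow> 0 \<le> m t \<and> (X has_real_derivative m t) (at t) \<and>
        (f has_real_derivative m t * g t) (at t) \<and>
        (g has_real_derivative - (m t * (f t + g t) ^ 3)) (at t) \<and>
        energy (F 0) (G 0) \<le> energy (f t) (g t) \<and> energy (f t) (g t) \<le> B\<rbrakk> \<Longrightarrow> X b - X a \<le> (K :: real)"
    using energy_level_time_bound[OF energy_pos[of 0] le[of 0]] by blast
  have "x 0 - x (- n) \<le> K" if "0 \<le> n" for n
  proof (rule K[where m = m and f = F and g = G and X = x])
    fix t assume "- n \<le> t" "t \<le> 0"
    then show "0 \<le> m t \<and> (x has_real_derivative m t) (at t) \<and> (F has_real_derivative m t * G t) (at t) \<and>
        (G has_real_derivative - (m t * W t ^ 3)) (at t) \<and>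
        energy (F 0) (G 0) \<le> energy (F t) (G t) \<and> energy (F t) (G t) \<le> B"
      using slopes[of t] energy_antimono[of t 0] le[of t] by (auto intro: less_imp_le)
  qed (use that in simp)
  from this[of "(\<bar>K\<bar> + 1) / k"] x_low[of "(\<bar>K\<bar> + 1) / k"] k(1) show False by simp
qed

text \<open>Under these bounds \<phi> has a derivative of at least some c > 0, so it would leave its
  interval in finite time backward. This is how completeness of the flow excludes a slope blowing up
  at finite height.\<close>

lemma height_unbounded_backward:
  assumes "0 < a" "\<And>t. t \<le> T \<Longrightarrow> a \<le> \<theta> t" "\<And>t. t \<le> T \<Longrightarrow> \<bar>F t\<bar> \<le> L"
  shows False
proof -
  define k where "k = 1 / (1 + L\<^sup>2)"
  have k: "0 < k" using zero_le_power2[of L] by (simp add: k_def add_pos_nonneg)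
  have "a < pi / 2" using assms(2)[of T] strip(2)[of T] by simp
  then have sa: "0 < sin a" using assms(1) by (intro sin_gt_zero) auto
  define c where "c = sin a * k ^ 5"
  have c: "0 < c" using sa k by (simp add: c_def)
  have d: "c \<le> sin (\<theta> t) * cos (\<phi> t) ^ 5" if t: "t \<le> T" for t
    unfolding c_def
  proof (intro mult_mono power_mono)
    show "sin a \<le> sin (\<theta> t)"
      using assms(1,2) t strip[of t] by (intro sin_monotone_2pi_le) (auto intro: order_trans)
    show "k \<le> cos (\<phi> t)"
      unfolding k_def by (rule cos_ge_of_tan_bound[OF angle_flowD(4)[OF fl] assms(3)[OF t]])
    show "0 \<le> sin (\<theta> t)"
      using assms(1) assms(2)[OF t] strip[of t] by (intro sin_ge_zero) auto
  qed (use k in auto)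
  define s where "s = T - 2 * pi / c"
  have sT: "s \<le> T" using c by (simp add: s_def)
  have "\<phi> s - c * s \<le> \<phi> T - c * T"
  proof (rule DERIV_nonneg_imp_nondecreasing[OF sT])
    fix u assume "s \<le> u" "u \<le> T"
    then show "\<exists>y. ((\<lambda>t. \<phi> t - c * t) has_real_derivative y) (at u) \<and> 0 \<le> y"
      using DERIV_diff[OF angle_flowD(2)[OF fl, of u] DERIV_cmult_Id[of c]] d[of u] by (intro exI conjI) (assumption, simp)
  qed
  moreover have "c * T - c * s = 2 * pi" using c by (simp add: s_def algebra_simps)
  ultimately show False using phi_bounds[of s] phi_bounds[of T] pi_gt_zero by linarith
qed

text \<open>In the region \<open>w\<^sup>3 > 2 g\<close> the slope blows up in finite time at finite height, going backward.\<close>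

lemma no_steep_point:
  assumes "3 / 2 \<le> W T" "2 * G T < W T ^ 3" "0 < G T"
  shows False
proof -
  define P where "P t = W t ^ 3 - 2 * G t" for t
  have P': "(P has_real_derivative m t * (3 * (W t)\<^sup>2 * (G t - W t ^ 3) + 2 * W t ^ 3)) (at t)" for t
    unfolding P_def
    by (rule DERIV_cong[OF DERIV_diff[OF DERIV_power[OF W', of 3] DERIV_cmult[OF G', of 2]]])
       (simp add: algebra_simps)
  have cont: "continuous_on S W" "continuous_on S P" for S
    by (intro continuous_at_imp_continuous_on ballI DERIV_isCont[OF W'] DERIV_isCont[OF P'])+
  \<comment> \<open>One minimum tracks both conditions, and \<open>c\<close> is its last zero before
    \<open>T\<close>. On [c, T] the sum W decreases, so W c > 3/2 and only P can vanish at
    \<open>c\<close>; the bound 1 is an auxiliary one below 3/2. At P = 0 the derivative of P is m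
    W^3 (2 - 3/2 W^2), which is negative as W^2 > 9/4 > 4/3, whereas P is positive right after
    \<open>c\<close>.\<close>
  have region: "0 < P t \<and> 1 < W t" if t: "t \<le> T" for t
  proof (rule ccontr)
    assume "\<not> ?thesis"
    then have "min (P t) (W t - 1) \<le> 0" by auto
    moreover have "0 < min (P T) (W T - 1)" using assms by (simp add: P_def)
    moreover have "continuous_on {t..T} (\<lambda>t. min (P t) (W t - 1))"
      by (intro continuous_intros cont)
    ultimately obtain c where c: "t \<le> c" "c < T" "min (P c) (W c - 1) = 0"
      "\<And>u. c < u \<Longrightarrow> u \<le> T \<Longrightarrow> 0 < min (P u) (W u - 1)"
      using first_zero_left[of t T "\<lambda>t. min (P t) (W t - 1)"] t by blast
    have "W T < W c"
    proof (rule DERIV_neg_imp_decreasing_open[OF c(2)])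
      fix u assume u: "c < u" "u < T"
      then have "0 < P u" "1 < W u" using c(4)[of u] by auto
      moreover have "0 < W u ^ 3" using \<open>1 < W u\<close> by simp
      ultimately have "G u - W u ^ 3 < 0" unfolding P_def by linarith
      then have "m u * (G u - W u ^ 3) < 0" using m_pos[of u] by (rule mult_pos_neg[rotated])
      then show "\<exists>y. (W has_real_derivative y) (at u) \<and> y < 0" using W' by blast
    qed (rule cont)
    then have Wc: "3 / 2 < W c" using assms(1) by linarith
    then have Pc: "P c = 0" using c(3) by (auto simp: min_def split: if_splits)
    have "m c * (3 * (W c)\<^sup>2 * (G c - W c ^ 3) + 2 * W c ^ 3) < 0"
    proof (rule mult_pos_neg[OF m_pos])
      have "G c = W c ^ 3 / 2" using Pc by (simp add: P_def)
      moreover have "3 * w\<^sup>2 * (g - w ^ 3) + 2 * w ^ 3 = w ^ 3 * (2 - 3 / 2 * w\<^sup>2)" if "g = w ^ 3 / 2" for g w :: real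
        unfolding that by (simp add: field_simps power2_eq_square power3_eq_cube)
      ultimately have "3 * (W c)\<^sup>2 * (G c - W c ^ 3) + 2 * W c ^ 3 = W c ^ 3 * (2 - 3 / 2 * (W c)\<^sup>2)"
        by blast
      moreover have "(3 / 2)\<^sup>2 < (W c)\<^sup>2" using Wc by (intro power_strict_mono) auto
      then have "2 - 3 / 2 * (W c)\<^sup>2 < 0" by (simp add: power2_eq_square)
      moreover have "0 < W c ^ 3" using Wc by simp
      ultimately show "3 * (W c)\<^sup>2 * (G c - W c ^ 3) + 2 * W c ^ 3 < 0" by (simp add: mult_pos_neg)
    qed
    from DERIV_neg_dec_right[OF P' this]
    obtain d where d: "0 < d" "\<And>h. 0 < h \<Longrightarrow> h < d \<Longrightarrow> P (c + h) < P c" by blast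
    define e where "e = min (d / 2) (T - c)"
    have "0 < e" "e < d" "c + e \<le> T" using d(1) c(2) by (simp_all add: e_def min_def)
    then show False using d(2)[of e] c(4)[of "c + e"] Pc by simp
  qed
  have w': "m t * (G t - W t ^ 3) \<le> - (m t * W t ^ 3 / 2)" if "t \<le> T" for t
  proof -
    have "G t - W t ^ 3 \<le> - (W t ^ 3 / 2)" using region[OF that] unfolding P_def by linarith
    then have "m t * (G t - W t ^ 3) \<le> m t * - (W t ^ 3 / 2)"
      using m_pos[of t] by (intro mult_left_mono) auto
    then show ?thesis by simp
  qed
  have G_ge: "G T \<le> G t" if "t \<le> T" for t
  proof (rule DERIV_nonpos_imp_nonincreasing[OF that])
    fix u assume "t \<le> u" "u \<le> T"
    then have "0 \<le> m u * W u ^ 3" using region[of u] m_pos[of u] by simp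
    then show "\<exists>y. (G has_real_derivative y) (at u) \<and> y \<le> 0"
      using G'[of u] by (intro exI conjI) (assumption, simp)
  qed
  \<comment> \<open>G - 2 W has the derivative m P > 0, so going backward the slope is at most
    linear in W.\<close>
  define C where "C = \<bar>G T - 2 * W T\<bar>"
  have G_le: "G t \<le> 2 * W t + C" if "t \<le> T" for t
  proof -
    have "G t - 2 * W t \<le> G T - 2 * W T"
    proof (rule DERIV_nonneg_imp_nondecreasing[OF that])
      fix u assume "t \<le> u" "u \<le> T"
      then have "0 \<le> m u * P u" using region[of u] m_pos[of u] by simp
      moreover have "((\<lambda>t. G t - 2 * W t) has_real_derivative m u * P u) (at u)"
        unfolding P_def by (rule DERIV_cong[OF DERIV_diff[OF G' DERIV_cmult[OF W', of 2]]]) (simp add: algebra_simps)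
      ultimately show "\<exists>y. ((\<lambda>t. G t - 2 * W t) has_real_derivative y) (at u) \<and> 0 \<le> y" by blast
    qed
    then show ?thesis unfolding C_def by linarith
  qed
  \<comment> \<open>W falls at a rate of at least m W^3 / 2, so Q rises at a rate of at least m (2 W
    + C), which dominates the rate m G of the height. Hence going backward the height loses at most
    \<open>Q T\<close>, however large W becomes.\<close>
  define Q where "Q t = 4 * inverse (W t) + C * (inverse (W t))\<^sup>2" for t
  have F_low: "F T - Q T \<le> F t - Q t" if "t \<le> T" for t
  proof (rule DERIV_nonpos_imp_nonincreasing[OF that])
    fix u assume "t \<le> u" "u \<le> T"
    then have uT: "u \<le> T" by simp
    define V where "V = m u * (G u - W u ^ 3)"
    have wu: "0 < W u" using region[OF uT] by simp
    have di: "((\<lambda>t. inverse (W t)) has_real_derivative - (inverse (W u) * V * inverse (W u))) (at u)"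
      unfolding V_def by (rule DERIV_inverse'[OF W']) (use wu in simp)
    have "((\<lambda>t. F t - Q t) has_real_derivative
        m u * G u - (4 * - (inverse (W u) * V * inverse (W u))
          + C * (of_nat 2 * (- (inverse (W u) * V * inverse (W u)) * inverse (W u) ^ (2 - Suc 0))))) (at u)"
      unfolding Q_def by (intro DERIV_diff DERIV_add DERIV_cmult DERIV_power di F')
    then have dQ: "((\<lambda>t. F t - Q t) has_real_derivative
        m u * G u + V * (4 * (inverse (W u))\<^sup>2 + 2 * C * inverse (W u) ^ 3)) (at u)"
      by (rule DERIV_cong) (simp add: algebra_simps power2_eq_square power3_eq_cube)
    have "V * (4 * (inverse (W u))\<^sup>2 + 2 * C * inverse (W u) ^ 3)
        \<le> - (m u * W u ^ 3 / 2) * (4 * (inverse (W u))\<^sup>2 + 2 * C * inverse (W u) ^ 3)"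
      unfolding V_def using wu by (intro mult_right_mono w'[OF uT]) (simp add: C_def)
    also have "\<dots> = - (m u * (2 * W u + C))"
    proof -
      have "- (M * w ^ 3 / 2) * (4 * (inverse w)\<^sup>2 + 2 * C * inverse w ^ 3) = - (M * (2 * w + C))"
        if "0 < w" for M w :: real
        using that by (simp add: field_simps power2_eq_square power3_eq_cube)
      from this[OF wu] show ?thesis .
    qed
    finally have "m u * G u + V * (4 * (inverse (W u))\<^sup>2 + 2 * C * inverse (W u) ^ 3)
        \<le> m u * G u - m u * (2 * W u + C)" by simp
    also have "\<dots> \<le> 0" using G_le[OF uT] m_pos[of u] by simp
    finally show "\<exists>y. ((\<lambda>t. F t - Q t) has_real_derivative y) (at u) \<and> y \<le> 0" using dQ by blast
  qed
  have F_up: "F t \<le> F T" if "t \<le> T" for t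
  proof (rule DERIV_nonneg_imp_nondecreasing[OF that])
    fix u assume "t \<le> u" "u \<le> T"
    then have "0 \<le> m u * G u" using G_ge[of u] assms(3) m_pos[of u] by simp
    then show "\<exists>y. (F has_real_derivative y) (at u) \<and> 0 \<le> y" using F' by blast
  qed
  show False
  proof (rule height_unbounded_backward[of "\<theta> T" T "\<bar>F T\<bar> + \<bar>Q T\<bar>"])
    show "0 < \<theta> T" using assms(3) sign_G by simp
    fix t assume t: "t \<le> T"
    show "\<theta> T \<le> \<theta> t"
    proof -
      have "\<not> tan (\<theta> t) < tan (\<theta> T)" using G_ge[OF t] by simp
      then have "\<not> \<theta> t < \<theta> T" using tan_mono_lt_eq[OF strip(1) strip(2) strip(1) strip(2), of t T] by blast
      then show ?thesis by simp
    qed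
    have "0 \<le> Q t" using region[OF t] by (simp add: Q_def C_def)
    then show "\<bar>F t\<bar> \<le> \<bar>F T\<bar> + \<bar>Q T\<bar>" using F_low[OF t] F_up[OF t] by linarith
  qed
qed

text \<open>Where the height is zero, the energy is half the squared slope and W equals the slope.
  Energy above 4 makes the slope larger than 2 in size, and then \<open>no_steep_point\<close>
  applies to the curve or to its reflection.\<close>

lemma height_nonzero_backward:
  obtains T where "(\<forall>t\<le>T. F t < 0) \<or> (\<forall>t\<le>T. 0 < F t)"
proof -
  obtain T where T: "\<And>t. t \<le> T \<Longrightarrow> 4 < energy (F t) (G t)" using energy_unbounded_backward by blast
  interpret neg: strip_flow "\<lambda>t. - \<theta> t" "\<lambda>t. - \<phi> t" x by (rule reflect)
  have nz: "F t \<noteq> 0" if "t \<le> T" for t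
  proof
    assume 0: "F t = 0"
    then have "8 < (G t)\<^sup>2" using T[OF that] by (simp add: energy_def)
    then have g: "2\<^sup>2 < \<bar>G t\<bar>\<^sup>2" by simp
    then have g2: "2 < \<bar>G t\<bar>" by (rule power_less_imp_less_base) simp
    have "2 * \<bar>G t\<bar> < \<bar>G t\<bar>\<^sup>2 * \<bar>G t\<bar>" using g g2 by (intro mult_strict_right_mono) auto
    then have g3: "2 * \<bar>G t\<bar> < \<bar>G t\<bar> ^ 3" by (simp add: power2_eq_square power3_eq_cube)
    show False
    proof (cases "0 < G t")
      case True
      then show False using no_steep_point[of t] g2 g3 0 by simp
    next
      case False
      then show False using neg.no_steep_point[of t] g2 g3 0 by simp
    qed
  qed
  have "(\<forall>t\<le>T. F t < 0) \<or> (\<forall>t\<le>T. 0 < F t)"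
  proof (rule ccontr)
    assume "\<not> ?thesis"
    then obtain s t where st: "s \<le> T" "t \<le> T" "0 \<le> F s" "F t \<le> 0" by (auto simp: not_less)
    have "continuous_on {..T} F" by (intro continuous_at_imp_continuous_on ballI DERIV_isCont[OF F'])
    then have "\<exists>u\<in>{..T}. F u = 0"
      using continuous_reaches[of "{..T}" F t s 0] st by auto
    then show False using nz by auto
  qed
  then show ?thesis by (rule that)
qed

text \<open>At \<theta> = 0 and, for positive \<theta>, at \<theta> + \<phi> = 0 the respective
  derivative is positive, so a wrong sign persists backward. If \<theta> is wrong, the height stays
  bounded while the slope stays away from 0. If \<theta> + \<phi> is wrong, \<theta> decreases
  backward at a fixed rate and becomes negative.\<close>

lemma left_end_signs:
  assumes neg: "\<And>t. t \<le> T \<Longrightarrow> F t < 0" and t: "t \<le> T"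
  shows "0 < \<theta> t" "0 < \<theta> t + \<phi> t"
proof -
  have \<phi>: "\<phi> t < 0" if "t \<le> T" for t using neg[OF that] sign_F by simp
  have pos: "0 < \<theta> t" if t: "t \<le> T" for t
  proof (rule ccontr)
    assume "\<not> 0 < \<theta> t"
    then have t0: "\<theta> t \<le> 0" by simp
    have th: "\<theta> s < 0" if "s < t" for s
    proof (rule negative_backward[OF angle_flowD(1)[OF fl] t0 _ that])
      fix u assume u: "u \<le> t" "\<theta> u = 0"
      have "sin (\<phi> u) < 0" using \<phi>[of u] phi_bounds[of u] u t sin_gt_zero[of "- \<phi> u"] by simp
      then show "0 < - (sin (\<theta> u + \<phi> u) ^ 3)" using u(2) by simp
    qed
    interpret r: strip_flow "\<lambda>t. - \<theta> t" "\<lambda>t. - \<phi> t" x by (rule reflect)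
    \<comment> \<open>The wrong sign is strict only before \<open>t\<close>, hence the base point t
      - 1.\<close>
    show False
    proof (rule r.height_unbounded_backward[of "- \<theta> (t - 1)" "t - 1" "\<bar>F (t - 1)\<bar>"])
      show "0 < - \<theta> (t - 1)" using th[of "t - 1"] by simp
      fix s assume s: "s \<le> t - 1"
      have "\<theta> s \<le> \<theta> (t - 1)"
      proof (rule DERIV_nonneg_imp_nondecreasing[OF s])
        fix u assume u: "s \<le> u" "u \<le> t - 1"
        have "0 < sin (- (\<theta> u + \<phi> u))"
          using th[of u] \<phi>[of u] strip[of u] phi_bounds[of u] u t by (intro sin_gt_zero) auto
        then have "0 \<le> - (sin (\<theta> u + \<phi> u) ^ 3)" by (simp del: minus_add_distrib)
        then show "\<exists>y. (\<theta> has_real_derivative y) (at u) \<and> 0 \<le> y" using angle_flowD(1)[OF fl] by blast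
      qed
      then show "- \<theta> (t - 1) \<le> - \<theta> s" by simp
      have "F (t - 1) \<le> F s"
      proof (rule DERIV_nonpos_imp_nonincreasing[OF s])
        fix u assume u: "s \<le> u" "u \<le> t - 1"
        then have "m u * G u \<le> 0" using th[of u] sign_G[of u] m_pos[of u] by (simp add: mult_nonneg_nonpos)
        then show "\<exists>y. (F has_real_derivative y) (at u) \<and> y \<le> 0" using F' by blast
      qed
      then show "\<bar>tan (- \<phi> s)\<bar> \<le> \<bar>F (t - 1)\<bar>" using neg[of s] s t by simp
    qed
  qed
  then show "0 < \<theta> t" using t .
  show "0 < \<theta> t + \<phi> t"
  proof (rule ccontr)
    assume "\<not> 0 < \<theta> t + \<phi> t"
    then have t0: "\<theta> t + \<phi> t \<le> 0" by simp
    have d: "((\<lambda>t. \<theta> t + \<phi> t) has_real_derivative - (sin (\<theta> u + \<phi> u) ^ 3) + sin (\<theta> u) * cos (\<phi> u) ^ 5) (at u)" for u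
      by (intro DERIV_add angle_flowD(1,2)[OF fl])
    have sp: "0 < sin (\<theta> u) * cos (\<phi> u) ^ 5" if "u \<le> t" for u
    proof -
      have "0 < sin (\<theta> u)" using pos[of u] strip[of u] that t by (intro sin_gt_zero) auto
      then show ?thesis using angle_flowD(4)[OF fl, of u] by simp
    qed
    have ps: "\<theta> s + \<phi> s < 0" if "s < t" for s
      by (rule negative_backward[OF d t0 _ that]) (use sp in simp)
    have sn: "sin (\<theta> u + \<phi> u) < 0" if "u < t" for u
      using sin_gt_zero[of "- (\<theta> u + \<phi> u)"] ps[OF that] pos[of u] phi_bounds[of u] that t by (simp del: minus_add_distrib)
    define e where "e = - (\<theta> (t - 1) + \<phi> (t - 1))"
    have e: "0 < e" "e < pi / 2"
      using ps[of "t - 1"] pos[of "t - 1"] phi_bounds[of "t - 1"] t by (simp_all add: e_def)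
    define c where "c = sin e ^ 3"
    have c: "0 < c" using e by (simp add: c_def sin_gt_zero)
    have low: "c \<le> - (sin (\<theta> u + \<phi> u) ^ 3)" if u: "u \<le> t - 1" for u
    proof -
      have "\<theta> u + \<phi> u \<le> \<theta> (t - 1) + \<phi> (t - 1)"
      proof (rule DERIV_nonneg_imp_nondecreasing[OF u])
        fix v assume v: "u \<le> v" "v \<le> t - 1"
        have "0 \<le> - (sin (\<theta> v + \<phi> v) ^ 3)" using sn[of v] v by simp
        moreover have "0 < sin (\<theta> v) * cos (\<phi> v) ^ 5" using sp[of v] v by simp
        ultimately have "0 \<le> - (sin (\<theta> v + \<phi> v) ^ 3) + sin (\<theta> v) * cos (\<phi> v) ^ 5" by linarith
        then show "\<exists>y. ((\<lambda>t. \<theta> t + \<phi> t) has_real_derivative y) (at v) \<and> 0 \<le> y" using d[of v] by blast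
      qed
      then have "e \<le> - (\<theta> u + \<phi> u)" "- (\<theta> u + \<phi> u) < pi / 2"
        using pos[of u] phi_bounds[of u] u t by (simp_all add: e_def)
      then have "sin e \<le> sin (- (\<theta> u + \<phi> u))" using e by (intro sin_monotone_2pi_le) auto
      then have "sin e ^ 3 \<le> sin (- (\<theta> u + \<phi> u)) ^ 3" using e by (intro power_mono) (auto intro: sin_ge_zero)
      also have "sin (- (\<theta> u + \<phi> u)) ^ 3 = - (sin (\<theta> u + \<phi> u) ^ 3)" unfolding sin_minus by simp
      finally show ?thesis by (simp add: c_def)
    qed
    define s where "s = t - 1 - pi / c"
    have s: "s \<le> t - 1" using c by (simp add: s_def)
    have "\<theta> s - c * s \<le> \<theta> (t - 1) - c * (t - 1)"
    proof (rule DERIV_nonneg_imp_nondecreasing[OF s])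
      fix u assume "s \<le> u" "u \<le> t - 1"
      then show "\<exists>y. ((\<lambda>t. \<theta> t - c * t) has_real_derivative y) (at u) \<and> 0 \<le> y"
        using DERIV_diff[OF angle_flowD(1)[OF fl, of u] DERIV_cmult_Id[of c]] low[of u] by (intro exI conjI) (assumption, simp)
    qed
    moreover have "c * (t - 1) - c * s = pi" using c by (simp add: s_def algebra_simps)
    ultimately show False using strip(2)[of "t - 1"] pos[of s] s t pi_gt_zero by linarith
  qed
qed

text \<open>The height is monotone, and a lower bound for it would contradict
  \<open>height_unbounded_backward\<close>. For the abscissa, a slope of at most 4 - 2 F makes (2 -
  F) exp (2 x) nondecreasing in time, hence bounded backward; since 2 - F tends to infinity, exp (2
  x) tends to 0.\<close>

lemma left_end_limits:
  assumes neg: "\<And>t. t \<le> T \<Longrightarrow> F t < 0"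
  shows "filterlim F at_bot at_bot" "filterlim x at_bot at_bot"
proof -
  have signs: "0 < \<theta> t" "0 < \<theta> t + \<phi> t" if "t \<le> T" for t
    using left_end_signs[of T t] neg that by blast+
  have Gpos: "0 < G t" and Wpos: "0 < W t" if "t \<le> T" for t
    using signs[OF that] sign_G sign_W by simp_all
  have Fmono: "F s \<le> F t" if "s \<le> t" "t \<le> T" for s t
  proof (rule DERIV_nonneg_imp_nondecreasing[OF that(1)])
    fix u assume "s \<le> u" "u \<le> t"
    then have "0 \<le> m u * G u" using Gpos[of u] m_pos[of u] that by simp
    then show "\<exists>y. (F has_real_derivative y) (at u) \<and> 0 \<le> y" using F' by blast
  qed
  have unb: "\<exists>t\<le>T. F t < L" for L
  proof (rule ccontr)
    assume "\<not> ?thesis"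
    then have low: "L \<le> F t" if "t \<le> T" for t using that by force
    show False
    proof (rule height_unbounded_backward[of "\<theta> T" T "\<bar>L\<bar>"])
      show "0 < \<theta> T" using signs by simp
      fix t assume t: "t \<le> T"
      show "\<theta> T \<le> \<theta> t"
      proof (rule DERIV_nonpos_imp_nonincreasing[OF t])
        fix u assume u: "t \<le> u" "u \<le> T"
        have "\<phi> u < 0" using neg[OF u(2)] sign_F by simp
        then have "0 < sin (\<theta> u + \<phi> u)"
          using signs[OF u(2)] strip[of u] by (intro sin_gt_zero) auto
        then have "- (sin (\<theta> u + \<phi> u) ^ 3) \<le> 0" by simp
        then show "\<exists>y. (\<theta> has_real_derivative y) (at u) \<and> y \<le> 0" using angle_flowD(1)[OF fl] by blast
      qed
      show "\<bar>F t\<bar> \<le> \<bar>L\<bar>" using low[OF t] neg[OF t] by linarith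
    qed
  qed
  show Flim: "filterlim F at_bot at_bot"
    unfolding filterlim_at_bot
  proof
    fix B
    obtain t where t: "t \<le> T" "F t < B" using unb by blast
    show "\<forall>\<^sub>F s in at_bot. F s \<le> B"
      unfolding eventually_at_bot_linorder
    proof (intro exI allI impI)
      fix s assume "s \<le> t"
      then show "F s \<le> B" using Fmono[of s t] t by linarith
    qed
  qed
  \<comment> \<open>A larger slope would give W > 4 - F > 4 and hence 2 G = 2 (W - F) < 16 W < W^3,
    which \<open>no_steep_point\<close> forbids.\<close>
  have Gle: "G t \<le> 4 - 2 * F t" if t: "t \<le> T" for t
  proof (rule ccontr)
    assume "\<not> ?thesis"
    then have w: "4 - F t < W t" by linarith
    then have w4: "4 < W t" using neg[OF t] by linarith
    have "4\<^sup>2 < (W t)\<^sup>2" using w4 by (intro power_strict_mono) auto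
    then have "4\<^sup>2 * W t < (W t)\<^sup>2 * W t" using w4 by (intro mult_strict_right_mono) auto
    then have w3: "16 * W t < W t ^ 3" by (simp add: power2_eq_square power3_eq_cube)
    have "2 * (w - f) < 16 * w" if "4 - f < w" "4 < w" for f w :: real using that by argo
    from this[OF w w4] have "2 * G t < 16 * W t" by simp
    then have "2 * G t < W t ^ 3" using w3 by (rule less_trans)
    then show False using no_steep_point[of t] w4 Gpos[OF t] by simp
  qed
  define C where "C = (2 - F T) * exp (2 * x T)"
  have C: "0 < C" using neg[of T] by (simp add: C_def)
  have bound: "(2 - F t) * exp (2 * x t) \<le> C" if t: "t \<le> T" for t
    unfolding C_def
  proof (rule DERIV_nonneg_imp_nondecreasing[OF t])
    fix u assume "t \<le> u" "u \<le> T"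
    then have "0 \<le> m u * exp (2 * x u) * (4 - 2 * F u - G u)" using Gle[of u] m_pos[of u] by simp
    moreover have "((\<lambda>t. (2 - F t) * exp (2 * x t)) has_real_derivative m u * exp (2 * x u) * (4 - 2 * F u - G u)) (at u)"
      by (rule derivative_eq_intros F' x' refl)+ (simp add: algebra_simps)
    ultimately show "\<exists>y. ((\<lambda>t. (2 - F t) * exp (2 * x t)) has_real_derivative y) (at u) \<and> 0 \<le> y" by blast
  qed
  show "filterlim x at_bot at_bot"
    unfolding filterlim_at_bot
  proof
    fix B
    have "\<forall>\<^sub>F t in at_bot. F t \<le> 2 - C / exp (2 * B)" using Flim by (simp add: filterlim_at_bot)
    then show "\<forall>\<^sub>F t in at_bot. x t \<le> B"
      using eventually_le_at_bot[of T]
    proof eventually_elim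
      case (elim t)
      then have "C / exp (2 * B) \<le> 2 - F t" by linarith
      then have "C / exp (2 * B) * exp (2 * x t) \<le> (2 - F t) * exp (2 * x t)"
        by (intro mult_right_mono) auto
      also have "\<dots> \<le> C" using bound elim by simp
      finally have "exp (2 * x t) \<le> exp (2 * B)" using C by (simp add: field_simps)
      then show ?case by simp
    qed
  qed
qed

text \<open>The point at time \<open>T\<close> is moved to abscissa 0. The graph is then ascending
  and concave over all nonpositive abscissas, as \<open>oscillation_exists\<close> demands for
  \<open>t0 = 0\<close>.\<close>

lemma entire_profile_of_negative_left_end:
  assumes neg: "\<And>t. t \<le> T \<Longrightarrow> F t < 0"
  shows "\<exists>f. entire_profile f \<and> parametrizes UNIV (height_curve \<phi> (\<lambda>t. x t - x T)) (graph_curve f)"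
proof -
  define X where "X = (\<lambda>t. x t - x T)"
  have flX: "angle_flow \<theta> \<phi> X"
    using angle_system_translate[OF fl, of "- x T"] by (simp add: X_def)
  have top: "filterlim X at_top at_top"
    by (rule flow_x_at_top[OF flX, of 0]) (rule cos_pos)
  have limits: "filterlim F at_bot at_bot" "filterlim x at_bot at_bot"
    using left_end_limits[of T] neg by blast+
  have bot: "filterlim X at_bot at_bot"
    unfolding filterlim_at_bot
  proof
    fix B
    have "\<forall>\<^sub>F t in at_bot. x t \<le> B + x T" using limits(2) by (simp add: filterlim_at_bot)
    then show "\<forall>\<^sub>F t in at_bot. X t \<le> B" by eventually_elim (simp add: X_def)
  qed
  have mono: "X s < X t" if "s < t" for s t
    by (rule flow_x_strict_mono[OF flX that]) (rule cos_pos)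
  obtain r where hom: "homeomorphism UNIV UNIV X r"
    by (rule line_homeomorphism[OF angle_flow_continuous(3)[OF flX] strict_monoI[OF mono] top bot])
  have r: "r (X t) = t" "X (r t) = t" for t using hom by (simp_all add: homeomorphism_def)
  have r_le: "r s \<le> t" if "s \<le> X t" for s t
    using mono[of t "r s"] r(2)[of s] that by (cases "r s \<le> t") auto
  have surj: "range X = UNIV" using hom by (simp add: homeomorphism_def)
  define f g where "f = (\<lambda>t. tan (\<phi> (r t)))" and "g = (\<lambda>t. tan (\<theta> (r t)))"
  interpret gr: graph_ode UNIV f g
    using flow_graph_ode[OF flX open_UNIV connected_UNIV, of r] cos_pos sin_nz r surj
    by (simp add: f_def g_def)
  have pos: "0 < g t \<and> 0 < f t + g t" if "t \<le> 0" for t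
  proof -
    have "r t \<le> T" using r_le[of t T] that by (simp add: X_def)
    then have "0 < \<theta> (r t)" "0 < \<theta> (r t) + \<phi> (r t)" using left_end_signs[of T "r t"] neg by blast+
    then show ?thesis
      using sign_G(2)[of "r t"] sign_W[of "r t"] by (simp add: f_def g_def)
  qed
  obtain a b c where osc: "oscillation UNIV f a b c" "0 < a 1" "\<And>t. t \<in> UNIV \<Longrightarrow> t < a 1 \<Longrightarrow> 0 < g t"
      "c ` {1..} = {t. a 1 < t \<and> f t = 0}"
    using gr.oscillation_exists[of 0] pos by blast
  have "strict_mono_on {..a 1} f"
  proof (rule strict_mono_onI)
    fix s t assume "s \<in> {..a 1}" "t \<in> {..a 1}" "s < t"
    then show "f s < f t" by (intro gr.f_mono) (use osc(3) in auto)
  qed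
  moreover have "filterlim f at_bot at_bot"
    unfolding filterlim_at_bot
  proof
    fix B
    have "\<forall>\<^sub>F t in at_bot. F t \<le> B" using limits(1) by (simp add: filterlim_at_bot)
    then obtain s where s: "\<And>t. t \<le> s \<Longrightarrow> F t \<le> B" by (auto simp: eventually_at_bot_linorder)
    show "\<forall>\<^sub>F t in at_bot. f t \<le> B"
      unfolding eventually_at_bot_linorder
    proof (intro exI allI impI)
      fix t assume "t \<le> X s"
      then show "f t \<le> B" using s[OF r_le] by (simp add: f_def)
    qed
  qed
  ultimately have "entire_profile f"
    unfolding entire_profile_def using osc by blast
  moreover have "parametrizes UNIV (height_curve \<phi> X) (graph_curve f)"
    unfolding parametrizes_def
    using hom r by (intro exI[of _ X] exI[of _ r]) (simp add: height_curve_def graph_curve_def f_def)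
  ultimately show ?thesis unfolding X_def by blast
qed

theorem entire_classification:
  "\<exists>\<phi>'\<in>{\<phi>, \<lambda>t. - \<phi> t}. \<exists>b f. entire_profile f \<and> parametrizes UNIV (height_curve \<phi>' (\<lambda>t. x t + b)) (graph_curve f)"
proof -
  obtain T where "(\<forall>t\<le>T. F t < 0) \<or> (\<forall>t\<le>T. 0 < F t)" by (rule height_nonzero_backward)
  then show ?thesis
  proof
    assume "\<forall>t\<le>T. F t < 0"
    then have "\<exists>f. entire_profile f \<and> parametrizes UNIV (height_curve \<phi> (\<lambda>t. x t + - x T)) (graph_curve f)"
      using entire_profile_of_negative_left_end[of T] by simp
    then show ?thesis by blast
  next
    assume "\<forall>t\<le>T. 0 < F t"
    interpret neg: strip_flow "\<lambda>t. - \<theta> t" "\<lambda>t. - \<phi> t" x by (rule reflect)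
    have "\<exists>f. entire_profile f \<and> parametrizes UNIV (height_curve (\<lambda>t. - \<phi> t) (\<lambda>t. x t + - x T)) (graph_curve f)"
      using neg.entire_profile_of_negative_left_end[of T] \<open>\<forall>t\<le>T. 0 < F t\<close> by simp
    then show ?thesis by blast
  qed
qed

end

section \<open>Staying in the strip |\<theta>| < pi / 2 and leaving it; existence of a curve without
  vertical tangent\<close>

lemma strip_invariant:
  assumes fl: "angle_flow \<theta> \<phi> x" and c: "\<And>t. 0 < cos (\<theta> t)" and 0: "\<bar>\<theta> s\<bar> < pi / 2"
  shows "\<bar>\<theta> t\<bar> < pi / 2"
proof (rule ccontr)
  assume "\<not> ?thesis"
  moreover have "continuous_on UNIV (\<lambda>t. \<bar>\<theta> t\<bar>)" by (intro continuous_intros angle_flow_continuous[OF fl])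
  ultimately obtain u where "\<bar>\<theta> u\<bar> = pi / 2"
    using continuous_reaches[of UNIV "\<lambda>t. \<bar>\<theta> t\<bar>" s t "pi / 2"] 0 by auto
  then have "\<theta> u = pi / 2 \<or> \<theta> u = - (pi / 2)" by linarith
  then have "cos (\<theta> u) = 0" by (metis cos_minus cos_pi_half)
  then show False using c[of u] by simp
qed

text \<open>On the boundary \<theta> = pi / 2 the angle has derivative - cos^3 \<phi> < 0, so going
  backward it can only move out of the strip.\<close>

lemma exit_above_backward:
  assumes fl: "angle_flow \<theta> \<phi> x" and s: "pi / 2 \<le> \<theta> s" "t < s"
  shows "pi / 2 < \<theta> t"
proof -
  have "pi / 2 - \<theta> t < 0"
  proof (rule negative_backward[OF _ _ _ s(2)])
    show "((\<lambda>u. pi / 2 - \<theta> u) has_real_derivative 0 - - (sin (\<theta> u + \<phi> u) ^ 3)) (at u)" for u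
      by (intro DERIV_diff DERIV_const angle_flowD(1)[OF fl])
    show "pi / 2 - \<theta> s \<le> 0" using s by simp
    fix u assume "pi / 2 - \<theta> u = 0"
    then have th: "\<theta> u = pi / 2" by simp
    have "sin (\<theta> u + \<phi> u) = cos (\<phi> u)" unfolding th by (simp add: sin_add)
    then show "0 < 0 - - (sin (\<theta> u + \<phi> u) ^ 3)" using angle_flowD(4)[OF fl, of u] by simp
  qed
  then show ?thesis by simp
qed

lemma exit_below_backward:
  assumes fl: "angle_flow \<theta> \<phi> x" and s: "\<theta> s \<le> - (pi / 2)" "t < s"
  shows "\<theta> t < - (pi / 2)"
  using exit_above_backward[OF angle_system_reflect[OF fl], of s t] s by simp

text \<open>Shooting in the initial angle: going backward, a solution can leave the strip on either side,
  both possibilities are open and occur, so some solution never leaves it.\<close>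

lemma strip_flow_exists: "\<exists>\<theta> \<phi> x. strip_flow \<theta> \<phi> x"
proof -
  \<comment> \<open>The nonzero initial height keeps the line y = 0 out of the family.\<close>
  have "\<exists>\<theta> \<phi> x. angle_flow \<theta> \<phi> x \<and> \<theta> 0 = a \<and> \<phi> 0 = - (pi / 4) \<and> x 0 = 0" for a
  proof -
    have "\<bar>- (pi / 4)\<bar> < pi / 2" using pi_gt_zero by simp
    from angle_flow_exists[OF this, of a 0] show ?thesis by blast
  qed
  then obtain th ph xx where fl: "\<And>a. angle_flow (th a) (ph a) (xx a)" "\<And>a. th a 0 = a"
    "\<And>a. ph a 0 = - (pi / 4)" by metis
  \<comment> \<open>Continuous dependence on the initial angle; the exponent 20 for squared
    distances becomes 10 for distances.\<close>
  have diff: "\<bar>th a t - th b t\<bar> \<le> \<bar>a - b\<bar> * exp (10 * \<bar>t\<bar>)" for a b t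
  proof -
    have "(th a t - th b t)\<^sup>2 + (ph a t - ph b t)\<^sup>2
        \<le> ((th a 0 - th b 0)\<^sup>2 + (ph a 0 - ph b 0)\<^sup>2) * exp (20 * \<bar>t - 0\<bar>)"
      by (rule angle_system_compare[OF connected_UNIV UNIV_I UNIV_I fl(1) _ _ fl(1), where p = "\<lambda>t. t"]) auto
    also have "\<dots> = (a - b)\<^sup>2 * exp (20 * \<bar>t\<bar>)" by (simp add: fl)
    also have "exp (20 * \<bar>t\<bar>) = (exp (10 * \<bar>t\<bar>))\<^sup>2" by (simp add: power2_eq_square flip: exp_add)
    also have "(a - b)\<^sup>2 * (exp (10 * \<bar>t\<bar>))\<^sup>2 = (\<bar>a - b\<bar> * exp (10 * \<bar>t\<bar>))\<^sup>2"
      by (simp add: power_mult_distrib)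
    finally have "(th a t - th b t)\<^sup>2 \<le> (\<bar>a - b\<bar> * exp (10 * \<bar>t\<bar>))\<^sup>2"
      using zero_le_power2[of "ph a t - ph b t"] by linarith
    then have "\<bar>th a t - th b t\<bar>\<^sup>2 \<le> (\<bar>a - b\<bar> * exp (10 * \<bar>t\<bar>))\<^sup>2" by simp
    then show ?thesis by (rule power2_le_imp_le) simp
  qed
  have near: "\<exists>d>0. \<forall>b. \<bar>a - b\<bar> < d \<longrightarrow> \<bar>th a t - th b t\<bar> < e" if "0 < e" for a t e
  proof (intro exI conjI allI impI)
    show "0 < e / exp (10 * \<bar>t\<bar>)" using that by simp
    fix b assume "\<bar>a - b\<bar> < e / exp (10 * \<bar>t\<bar>)"
    then have "\<bar>a - b\<bar> * exp (10 * \<bar>t\<bar>) < e" by (simp add: pos_less_divide_eq)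
    then show "\<bar>th a t - th b t\<bar> < e" using diff[of a t b] by linarith
  qed
  define U where "U = {a. \<exists>t\<le>0. pi / 2 < th a t}"
  define V where "V = {a. \<exists>t\<le>0. th a t < - (pi / 2)}"
  have "open U"
    unfolding open_dist
  proof
    fix a assume "a \<in> U"
    then obtain t where t: "t \<le> 0" "pi / 2 < th a t" by (auto simp: U_def)
    obtain d where d: "0 < d" "\<And>b. \<bar>a - b\<bar> < d \<Longrightarrow> \<bar>th a t - th b t\<bar> < th a t - pi / 2"
      using near[of "th a t - pi / 2" a t] t by auto
    show "\<exists>e>0. \<forall>b. dist b a < e \<longrightarrow> b \<in> U"
    proof (intro exI conjI allI impI)
      fix b assume "dist b a < d"
      then have "\<bar>th a t - th b t\<bar> < th a t - pi / 2" using d(2)[of b] by (simp add: dist_real_def)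
      then have "pi / 2 < th b t" by linarith
      then show "b \<in> U" using t by (auto simp: U_def)
    qed (rule d(1))
  qed
  have "open V"
    unfolding open_dist
  proof
    fix a assume "a \<in> V"
    then obtain t where t: "t \<le> 0" "th a t < - (pi / 2)" by (auto simp: V_def)
    obtain d where d: "0 < d" "\<And>b. \<bar>a - b\<bar> < d \<Longrightarrow> \<bar>th a t - th b t\<bar> < - (pi / 2) - th a t"
      using near[of "- (pi / 2) - th a t" a t] t by auto
    show "\<exists>e>0. \<forall>b. dist b a < e \<longrightarrow> b \<in> V"
    proof (intro exI conjI allI impI)
      fix b assume "dist b a < d"
      then have "\<bar>th a t - th b t\<bar> < - (pi / 2) - th a t" using d(2)[of b] by (simp add: dist_real_def)
      then have "th b t < - (pi / 2)" by linarith
      then show "b \<in> V" using t by (auto simp: V_def)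
    qed (rule d(1))
  qed
  \<comment> \<open>After leaving on one side the angle remains there backward, so at an early
    enough time it would be on both sides.\<close>
  have "U \<inter> V = {}"
  proof (rule equals0I)
    fix a assume "a \<in> U \<inter> V"
    then obtain s t where st: "pi / 2 < th a s" "th a t < - (pi / 2)" by (auto simp: U_def V_def)
    have "pi / 2 < th a (min s t - 1)" using exit_above_backward[OF fl(1), of a s] st by simp
    moreover have "th a (min s t - 1) < - (pi / 2)" using exit_below_backward[OF fl(1), of a t] st by simp
    ultimately show False using pi_gt_zero by linarith
  qed
  moreover have "pi / 2 \<in> U"
    using exit_above_backward[OF fl(1), of "pi / 2" 0 "- 1"] fl(2) by (auto simp: U_def intro!: exI[of _ "- 1"])
  moreover have "- (pi / 2) \<in> V"
    using exit_below_backward[OF fl(1), of "- (pi / 2)" 0 "- 1"] fl(2) by (auto simp: V_def intro!: exI[of _ "- 1"])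
  moreover have "pi / 2 \<in> {- (pi / 2)..pi / 2}" "- (pi / 2) \<in> {- (pi / 2)..pi / 2}" using pi_gt_zero by simp_all
  ultimately have "\<not> {- (pi / 2)..pi / 2} \<subseteq> U \<union> V"
    using connectedD[OF connected_Icc \<open>open U\<close> \<open>open V\<close>, of "- (pi / 2)" "pi / 2"] by blast
  then obtain a where a: "a \<notin> U" "a \<notin> V" by blast
  have lt: "- (pi / 2) < th a t \<and> th a t < pi / 2" if t: "t \<le> 0" for t
  proof (rule ccontr)
    assume "\<not> ?thesis"
    then consider "pi / 2 \<le> th a t" | "th a t \<le> - (pi / 2)" by linarith
    then show False
    proof cases
      case 1
      from exit_above_backward[OF fl(1) this, of "t - 1"] show False using a(1) t by (auto simp: U_def)
    next
      case 2
      from exit_below_backward[OF fl(1) this, of "t - 1"] show False using a(2) t by (auto simp: V_def)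
    qed
  qed
  have c: "0 < cos (th a t)" for t
  proof (cases "t \<le> 0")
    case True
    then show ?thesis using lt[of t] by (intro cos_gt_zero_pi) auto
  next
    case False
    have "0 \<le> cos (th a 0)" using lt[of 0] by (intro cos_ge_zero) auto
    then show ?thesis using cos_pos_forward[OF fl(1)] False by simp
  qed
  have "strip_flow (th a) (ph a) (xx a)"
  proof
    fix t
    have "\<bar>th a 0\<bar> < pi / 2" using lt[of 0] by linarith
    from strip_invariant[OF fl(1) c this, of t]
    show "- (pi / 2) < th a t" "th a t < pi / 2" by linarith+
    show "ph a t \<noteq> 0 \<or> th a t \<noteq> 0"
    proof (rule ccontr)
      assume "\<not> ?thesis"
      then have "ph a 0 = 0" using angle_flow_equilibrium[OF fl(1), of a t 0] by simp
      then show False using fl(3)[of a] by simp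
    qed
  qed (rule fl(1))
  then show ?thesis by blast
qed

subsection \<open>Solutions and the angle system\<close>

text \<open>With speed N the left side of the curve equation is - (b + y a) / N and the curvature
  has the denominator N^3, so cubing removes N altogether.\<close>

lemma equation_iff:
  assumes n: "vderiv Y u \<noteq> 0"
  defines "a \<equiv> vderiv Y u $ 1" and "b \<equiv> vderiv Y u $ 2"
    and "a' \<equiv> vderiv (vderiv Y) u $ 1" and "b' \<equiv> vderiv (vderiv Y) u $ 2"
  shows "((vector [vector [0, 0], vector [0, -1]] :: real^2^2) *v Y u + vector [1, 0])
      \<bullet> unit_normal Y u = root 3 (curvature Y u) \<longleftrightarrow>
    a * b' - b * a' = - ((b + Y u $ 2 * a) ^ 3)"
proof -
  define N where "N = norm (vderiv Y u)"
  have N: "0 < N" using n by (simp add: N_def)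
  have l: "((vector [vector [0, 0], vector [0, -1]] :: real^2^2) *v Y u + vector [1, 0]) \<bullet> unit_normal Y u
      = - ((b + Y u $ 2 * a) / N)"
    by (simp add: inner_vec_def sum_2 matrix_vector_mult_def unit_normal_def unit_tangent_def J_def
        N_def a_def b_def field_simps add_divide_distrib)
  have r: "curvature Y u = (a * b' - b * a') / N ^ 3"
    by (simp add: curvature_def det_2 transpose_def N_def a_def b_def a'_def b'_def algebra_simps)
  have "(- ((b + Y u $ 2 * a) / N) = root 3 ((a * b' - b * a') / N ^ 3)) \<longleftrightarrow>
      (- ((b + Y u $ 2 * a) / N)) ^ 3 = (a * b' - b * a') / N ^ 3"
    by (metis odd_numeral odd_real_root_pow odd_real_root_power_cancel)
  also have "(- ((b + Y u $ 2 * a) / N)) ^ 3 = - ((b + Y u $ 2 * a) ^ 3) / N ^ 3"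
    by (simp add: power_divide)
  also have "(- ((b + Y u $ 2 * a) ^ 3) / N ^ 3 = (a * b' - b * a') / N ^ 3) \<longleftrightarrow>
      a * b' - b * a' = - ((b + Y u $ 2 * a) ^ 3)"
  proof -
    have "(- C / M = D / M) \<longleftrightarrow> D = - C" if "0 < M" for C D M :: real
      using that by (auto simp: field_simps)
    then show ?thesis using N by (meson zero_less_power)
  qed
  finally show ?thesis unfolding l r .
qed

lemma vderiv_eqI: "(g has_vector_derivative g') (at u) \<Longrightarrow> vderiv g u = g'"
  by (simp add: vderiv_def vector_derivative_at)

lemma vderiv_cong:
  assumes "open I" "\<And>u. u \<in> I \<Longrightarrow> f u = g u" "u \<in> I"
  shows "vderiv f u = vderiv g u"
  unfolding vderiv_def
proof (rule vector_derivative_cong_eq)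
  show "\<forall>\<^sub>F x in nhds u. x \<in> UNIV \<longrightarrow> f x = g x"
    using eventually_nhds_in_open[OF assms(1,3)] by eventually_elim (simp add: assms(2))
qed (use assms in auto)

lemma solution_cong:
  assumes s: "solution I Y" and eq: "\<And>u. u \<in> I \<Longrightarrow> Y u = Y' u"
  shows "solution I Y'"
proof -
  have I: "open I" "connected I" "I \<noteq> {}" "smooth_on I Y" "\<And>u. u \<in> I \<Longrightarrow> vderiv Y u \<noteq> 0"
    using s by (auto simp: solution_def immersed_curve_def)
  have v1: "vderiv Y u = vderiv Y' u" if "u \<in> I" for u
    using vderiv_cong[OF I(1) eq that] by simp
  have v2: "vderiv (vderiv Y) u = vderiv (vderiv Y') u" if "u \<in> I" for u
    using vderiv_cong[OF I(1) v1 that] by simp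
  have "ck_on n I Y'" for n
    by (rule ck_on_cong[OF I(1) _ eq]) (use I(4) smooth_on_iff_ck_on[OF I(1), of Y] in blast)
  then have "smooth_on I Y'" unfolding smooth_on_iff_ck_on[OF I(1)] by blast
  then show ?thesis
    using s eq v1 v2 I unfolding solution_def immersed_curve_def unit_normal_def unit_tangent_def curvature_def
    by simp
qed

lemma maximal_solution_cong:
  assumes "maximal_solution I Y" "\<And>u. u \<in> I \<Longrightarrow> Y u = Y' u"
  shows "maximal_solution I Y'"
  unfolding maximal_solution_def
proof (intro conjI allI impI)
  show "solution I Y'"
    using solution_cong[of I Y Y'] assms by (auto simp: maximal_solution_def)
  fix K Z p assume "solution K Z \<and> smooth_on I p \<and> (\<forall>u\<in>I. vderiv p u \<noteq> 0) \<and> p ` I \<subseteq> K \<and> (\<forall>u\<in>I. Y' u = Z (p u))"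
  then show "p ` I = K"
    using assms unfolding maximal_solution_def by (metis (no_types, lifting))
qed

lemma angle_systemD:
  assumes "angle_system I r \<theta> \<phi> x" "u \<in> I"
  shows "(\<theta> has_real_derivative r u * - (sin (\<theta> u + \<phi> u) ^ 3)) (at u)"
    and "(\<phi> has_real_derivative r u * (sin (\<theta> u) * cos (\<phi> u) ^ 5)) (at u)"
    and "(x has_real_derivative r u * (cos (\<theta> u) * cos (\<phi> u) ^ 3)) (at u)"
    and "0 < cos (\<phi> u)"
proof -
  have "\<bar>\<phi> u\<bar> < pi / 2" using assms by (simp add: angle_system_def)
  then have "- (pi / 2) < \<phi> u" "\<phi> u < pi / 2" by linarith+
  then show "0 < cos (\<phi> u)" by (rule cos_gt_zero_pi)
qed (use assms in \<open>simp_all add: angle_system_def\<close>)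

text \<open>The velocity is N (cos \<theta>, sin \<theta>) with speed N = r cos^3 \<phi>. The
  determinant of velocity and acceleration is therefore N^2 \<theta>', and the equation for \<theta>
  turns into that of \<open>equation_iff\<close>.\<close>

lemma solution_height_curve:
  assumes I: "open I" "connected I" "I \<noteq> {}" and sys: "angle_system I r \<theta> \<phi> x"
    and r: "smooth_on I r" "\<And>u. u \<in> I \<Longrightarrow> 0 < r u"
  shows "solution I (height_curve \<phi> x)"
proof -
  note d = angle_systemD[OF sys]
  have sm: "smooth_on I \<theta>" "smooth_on I \<phi>"
    using smooth_on_ode[OF I(1) r(1) d(1,2,3)] by blast+
  define N where "N = (\<lambda>u. r u * cos (\<phi> u) ^ 3)"
  define V where "V = (\<lambda>u. vector [N u * cos (\<theta> u), N u * sin (\<theta> u)] :: real^2)"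
  have ckr: "ck_on n I \<theta>" "ck_on n I \<phi>" "ck_on n I r" for n
    using sm r(1) unfolding smooth_on_iff_ck_on[OF I(1)] by blast+
  have "ck_on n I N" for n
    unfolding N_def by (intro ck_on_mult ck_on_power ck_on_cos ckr)
  note ckN = this ckr(1)
  have ckV: "ck_on n I V" for n
    unfolding V_def by (intro ck_on_vec2 ck_on_mult ck_on_sin ck_on_cos ckN)
  have dY: "(height_curve \<phi> x has_vector_derivative V u) (at u)" if u: "u \<in> I" for u
    unfolding height_curve_def[abs_def] V_def
  proof (rule has_vector_derivative_vec2)
    show "(x has_real_derivative N u * cos (\<theta> u)) (at u)"
      using d(3)[OF u] by (simp add: N_def mult_ac)
    have "((\<lambda>u. tan (\<phi> u)) has_real_derivative inverse ((cos (\<phi> u))\<^sup>2) * (r u * (sin (\<theta> u) * cos (\<phi> u) ^ 5))) (at u)"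
      by (rule DERIV_chain2[OF DERIV_tan d(2)[OF u]]) (use d(4)[OF u] in simp)
    moreover have "inverse (B\<^sup>2) * (R * (S * B ^ 5)) = R * B ^ 3 * S" if "0 < B" for B R S :: real
      using that by (simp add: field_simps power2_eq_square power3_eq_cube power_numeral_reduce)
    ultimately show "((\<lambda>u. tan (\<phi> u)) has_real_derivative N u * sin (\<theta> u)) (at u)"
      using d(4)[OF u] by (simp add: N_def)
  qed
  have v1: "vderiv (height_curve \<phi> x) u = V u" if "u \<in> I" for u
    using dY[OF that] by (rule vderiv_eqI)
  have Npos: "0 < N u" if "u \<in> I" for u using r(2)[OF that] d(4)[OF that] by (simp add: N_def)
  have nz: "vderiv (height_curve \<phi> x) u \<noteq> 0" if u: "u \<in> I" for u
  proof
    assume "vderiv (height_curve \<phi> x) u = 0"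
    then have "V u $ 1 = 0" "V u $ 2 = 0" using v1[OF u] by simp_all
    then have "cos (\<theta> u) = 0" "sin (\<theta> u) = 0" using Npos[OF u] by (simp_all add: V_def)
    then show False using sin_cos_squared_add[of "\<theta> u"] by simp
  qed
  have "ck_on (Suc n) I (height_curve \<phi> x)" for n
    unfolding ck_on.simps using dY ckV by blast
  then have "ck_on n I (height_curve \<phi> x)" for n by (rule ck_on_SucD)
  then have smY: "smooth_on I (height_curve \<phi> x)" unfolding smooth_on_iff_ck_on[OF I(1)] by blast
  have "vderiv (height_curve \<phi> x) u $ 1 * vderiv (vderiv (height_curve \<phi> x)) u $ 2
      - vderiv (height_curve \<phi> x) u $ 2 * vderiv (vderiv (height_curve \<phi> x)) u $ 1
      = - ((vderiv (height_curve \<phi> x) u $ 2 + height_curve \<phi> x u $ 2 * vderiv (height_curve \<phi> x) u $ 1) ^ 3)"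
    if u: "u \<in> I" for u
  proof -
    \<comment> \<open>Only the existence of this derivative matters, as it cancels from the
      determinant.\<close>
    obtain N' where N': "(N has_real_derivative N') (at u)"
      using ck_on_real_SucE[OF ckN(1)[of "Suc 0"]] u by blast
    define T' where "T' = r u * - (sin (\<theta> u + \<phi> u) ^ 3)"
    have dT: "(\<theta> has_real_derivative T') (at u)" unfolding T'_def by (rule d(1)[OF u])
    have dV: "(V has_vector_derivative vector [N' * cos (\<theta> u) + (- sin (\<theta> u) * T') * N u, N' * sin (\<theta> u) + (cos (\<theta> u) * T') * N u]) (at u)"
      unfolding V_def by (intro has_vector_derivative_vec2 DERIV_mult N' DERIV_chain2[OF DERIV_cos dT] DERIV_chain2[OF DERIV_sin dT])
    have v2: "vderiv (vderiv (height_curve \<phi> x)) u = vector [N' * cos (\<theta> u) + (- sin (\<theta> u) * T') * N u, N' * sin (\<theta> u) + (cos (\<theta> u) * T') * N u]"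
      using vderiv_cong[OF I(1) v1 u] vderiv_eqI[OF dV] by simp
    have "N u * cos (\<theta> u) * (N' * sin (\<theta> u) + (cos (\<theta> u) * T') * N u)
        - N u * sin (\<theta> u) * (N' * cos (\<theta> u) + (- sin (\<theta> u) * T') * N u)
        = (N u)\<^sup>2 * T' * ((sin (\<theta> u))\<^sup>2 + (cos (\<theta> u))\<^sup>2)"
    proof -
      have "N * c * (N' * s + (c * T) * N) - N * s * (N' * c + (- s * T) * N) = N\<^sup>2 * T * (s\<^sup>2 + c\<^sup>2)"
        for N N' c s T :: real by (simp add: algebra_simps power2_eq_square)
      then show ?thesis .
    qed
    also have "\<dots> = (N u)\<^sup>2 * T'" by simp
    also have "\<dots> = - ((N u * sin (\<theta> u + \<phi> u) / cos (\<phi> u)) ^ 3)"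
      using d(4)[OF u] by (simp add: T'_def N_def field_simps power2_eq_square power3_eq_cube)
    also have "N u * sin (\<theta> u + \<phi> u) / cos (\<phi> u) = N u * sin (\<theta> u) + tan (\<phi> u) * (N u * cos (\<theta> u))"
      using d(4)[OF u] by (simp add: sin_add tan_def field_simps)
    finally show ?thesis
      unfolding v2 v1[OF u] by (simp add: V_def height_curve_def)
  qed
  then show ?thesis
    unfolding solution_def immersed_curve_def using I smY nz equation_iff[of "height_curve \<phi> x"] by auto
qed

lemma cos_arctan_pow: "cos (arctan y) = inverse (sqrt (1 + y\<^sup>2))"
  by (simp add: cos_arctan inverse_eq_divide)

text \<open>The tangent angle of a solution is obtained by integrating its speed times its curvature.\<close>

lemma solution_angle_system:
  assumes sol: "solution I Y"
  obtains r \<theta> \<phi> x where "angle_system I r \<theta> \<phi> x" "smooth_on I r" "\<And>u. u \<in> I \<Longrightarrow> 0 < r u"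
    "\<And>u. u \<in> I \<Longrightarrow> Y u = height_curve \<phi> x u"
proof -
  have I: "open I" "connected I" "I \<noteq> {}" and sm: "smooth_on I Y" and nz: "\<And>u. u \<in> I \<Longrightarrow> vderiv Y u \<noteq> 0"
    and eq: "\<And>u. u \<in> I \<Longrightarrow> vderiv Y u $ 1 * vderiv (vderiv Y) u $ 2 - vderiv Y u $ 2 * vderiv (vderiv Y) u $ 1
      = - ((vderiv Y u $ 2 + Y u $ 2 * vderiv Y u $ 1) ^ 3)"
    using sol equation_iff[of Y] unfolding solution_def immersed_curve_def by auto
  define a b y x where "a = (\<lambda>u. vderiv Y u $ 1)" and "b = (\<lambda>u. vderiv Y u $ 2)"
    and "y = (\<lambda>u. Y u $ 2)" and "x = (\<lambda>u. Y u $ 1)"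
  define a' b' where "a' = (\<lambda>u. vderiv (vderiv Y) u $ 1)" and "b' = (\<lambda>u. vderiv (vderiv Y) u $ 2)"
  have dxy: "(x has_real_derivative a u) (at u)" "(y has_real_derivative b u) (at u)" if "u \<in> I" for u
    unfolding x_def y_def a_def b_def
    using has_real_derivative_nth smooth_on_imp_derivative[OF sm that] by blast+
  have dab: "(a has_real_derivative a' u) (at u)" "(b has_real_derivative b' u) (at u)" if "u \<in> I" for u
    unfolding a_def b_def a'_def b'_def
    using has_real_derivative_nth smooth_on_imp_derivative[OF smooth_on_vderiv[OF sm] that] by blast+
  have eq': "a u * b' u - b u * a' u = - ((b u + y u * a u) ^ 3)" if "u \<in> I" for u
    using eq[OF that] by (simp add: a_def b_def a'_def b'_def y_def)
  have ab: "0 < (a u)\<^sup>2 + (b u)\<^sup>2" if "u \<in> I" for u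
  proof -
    have "a u \<noteq> 0 \<or> b u \<noteq> 0" using nz[OF that] by (auto simp: a_def b_def vec_eq_iff forall_2)
    then show ?thesis by (simp add: sum_power2_gt_zero_iff)
  qed
  define n where "n = (\<lambda>u. sqrt ((a u)\<^sup>2 + (b u)\<^sup>2))"
  have n: "0 < n u" "(n u)\<^sup>2 = (a u)\<^sup>2 + (b u)\<^sup>2" if "u \<in> I" for u
    using ab[OF that] by (simp_all add: n_def)
  define \<phi> where "\<phi> = (\<lambda>u. arctan (y u))"
  \<comment> \<open>The speed divided by cos^3 \<phi>, because cos \<phi> = 1 / sqrt (1 +
    y^2).\<close>
  define r where "r = (\<lambda>u. n u * sqrt (1 + (y u)\<^sup>2) ^ 3)"
  have cphi: "cos (\<phi> u) = inverse (sqrt (1 + (y u)\<^sup>2))" for u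
    by (simp add: \<phi>_def cos_arctan_pow)
  have sq: "0 < 1 + (y u)\<^sup>2" for u using zero_le_power2[of "y u"] by linarith
  have cpos: "0 < cos (\<phi> u)" for u using sq[of u] by (simp add: cphi)
  have rn: "r u * cos (\<phi> u) ^ 3 = n u" for u
    using sq[of u] by (simp add: r_def cphi flip: power_mult_distrib)
  have rpos: "0 < r u" if "u \<in> I" for u using n(1)[OF that] sq[of u] by (simp add: r_def)
  have ck: "ck_on k I a" "ck_on k I b" "ck_on k I y" for k
    unfolding a_def b_def y_def using sm smooth_on_vderiv[OF sm] unfolding smooth_on_iff_ck_on[OF I(1)]
    by (blast intro: ck_on_linear[OF bounded_linear_vec_nth])+
  have "ck_on k I r" for k
    unfolding r_def n_def
    by (intro ck_on_mult ck_on_power ck_on_sqrt ck_on_add ck_on_const ck ballI) (use ab sq in auto)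
  then have smr: "smooth_on I r" unfolding smooth_on_iff_ck_on[OF I(1)] by blast
  define \<kappa> where "\<kappa> = (\<lambda>u. (a u * b' u - b u * a' u) / (n u)\<^sup>2)"
  have "\<kappa> u = - ((b u + y u * a u) ^ 3) / ((a u)\<^sup>2 + (b u)\<^sup>2)" if "u \<in> I" for u
    using eq'[OF that] n(2)[OF that] by (simp add: \<kappa>_def)
  moreover have "continuous_on I (\<lambda>u. - ((b u + y u * a u) ^ 3) / ((a u)\<^sup>2 + (b u)\<^sup>2))"
  proof -
    have "continuous_on I a" by (intro continuous_at_imp_continuous_on ballI) (erule DERIV_isCont[OF dab(1)])
    moreover have "continuous_on I b" by (intro continuous_at_imp_continuous_on ballI) (erule DERIV_isCont[OF dab(2)])
    moreover have "continuous_on I y" by (intro continuous_at_imp_continuous_on ballI) (erule DERIV_isCont[OF dxy(2)])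
    ultimately show ?thesis using ab by (intro continuous_intros) force+
  qed
  ultimately have cont: "continuous_on I \<kappa>" by (simp cong: continuous_on_cong)
  obtain u0 where u0: "u0 \<in> I" using I(3) by blast
  obtain H where H: "H u0 = 0" "\<And>u. u \<in> I \<Longrightarrow> (H has_vector_derivative \<kappa> u) (at u)"
    using antiderivative_exists[OF I(1,2) cont u0] by blast
  have "(a u0 / n u0)\<^sup>2 + (b u0 / n u0)\<^sup>2 = ((a u0)\<^sup>2 + (b u0)\<^sup>2) / (n u0)\<^sup>2"
    by (simp add: power_divide add_divide_distrib)
  also have "\<dots> = 1" unfolding n(2)[OF u0, symmetric] using n(1)[OF u0] by simp
  finally obtain t0 where t0: "a u0 / n u0 = cos t0" "b u0 / n u0 = sin t0"
    using sincos_total_2pi by metis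
  define \<theta> where "\<theta> = (\<lambda>u. H u + t0)"
  have d\<theta>: "(\<theta> has_real_derivative \<kappa> u) (at u)" if "u \<in> I" for u
    using DERIV_add[OF H(2)[OF that, folded has_real_derivative_iff_has_vector_derivative] DERIV_const[of t0]]
    by (simp add: \<theta>_def)
  have dn: "(n has_real_derivative (a u * a' u + b u * b' u) / n u) (at u)" if u: "u \<in> I" for u
  proof -
    have "((\<lambda>u. (a u)\<^sup>2 + (b u)\<^sup>2) has_real_derivative 2 * (a u * a' u + b u * b' u)) (at u)"
      using dab[OF u] by (auto intro!: derivative_eq_intros)
    from DERIV_chain2[OF DERIV_real_sqrt[OF ab[OF u]] this]
    moreover have "inverse q / 2 * (2 * p) = p / q" for p q :: real by (simp add: field_simps)
    ultimately show ?thesis unfolding n_def by (simp only:)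
  qed
  have dT: "((\<lambda>u. a u / n u) has_real_derivative - \<kappa> u * (b u / n u)) (at u)"
    "((\<lambda>u. b u / n u) has_real_derivative \<kappa> u * (a u / n u)) (at u)" if u: "u \<in> I" for u
  proof -
    have alg: "(A' * N - A * ((A * A' + B * B') / N)) / (N * N) = - ((A * B' - B * A') / N\<^sup>2) * (B / N)"
      "(B' * N - B * ((A * A' + B * B') / N)) / (N * N) = (A * B' - B * A') / N\<^sup>2 * (A / N)"
      if N: "0 < N" "N\<^sup>2 = A\<^sup>2 + B\<^sup>2" for A B A' B' N :: real
    proof -
      have e1: "A' * N\<^sup>2 - A * (A * A' + B * B') = - ((A * B' - B * A') * B)"
        and e2: "B' * N\<^sup>2 - B * (A * A' + B * B') = (A * B' - B * A') * A"
        unfolding N(2) by (simp_all add: algebra_simps power2_eq_square)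
      have "(A' * N - A * ((A * A' + B * B') / N)) / (N * N) = (A' * N\<^sup>2 - A * (A * A' + B * B')) / (N\<^sup>2 * N)"
        using N(1) by (simp add: field_simps power2_eq_square)
      then show "(A' * N - A * ((A * A' + B * B') / N)) / (N * N) = - ((A * B' - B * A') / N\<^sup>2) * (B / N)"
        unfolding e1 by simp
      have "(B' * N - B * ((A * A' + B * B') / N)) / (N * N) = (B' * N\<^sup>2 - B * (A * A' + B * B')) / (N\<^sup>2 * N)"
        using N(1) by (simp add: field_simps power2_eq_square)
      then show "(B' * N - B * ((A * A' + B * B') / N)) / (N * N) = (A * B' - B * A') / N\<^sup>2 * (A / N)"
        unfolding e2 by simp
    qed
    have nu: "n u \<noteq> 0" using n(1)[OF u] by simp
    show "((\<lambda>u. a u / n u) has_real_derivative - \<kappa> u * (b u / n u)) (at u)"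
      using DERIV_divide[OF dab(1)[OF u] dn[OF u] nu] unfolding alg(1)[OF n[OF u]] \<kappa>_def .
    show "((\<lambda>u. b u / n u) has_real_derivative \<kappa> u * (a u / n u)) (at u)"
      using DERIV_divide[OF dab(2)[OF u] dn[OF u] nu] unfolding alg(2)[OF n[OF u]] \<kappa>_def .
  qed
  have tang: "a u = n u * cos (\<theta> u)" "b u = n u * sin (\<theta> u)" if u: "u \<in> I" for u
  proof -
    \<comment> \<open>The unit tangent and (cos \<theta>, sin \<theta>) both turn at the rate
      \<kappa>, so their squared distance is constant; it is 0 at \<open>u0\<close> by the choice of
      \<open>t0\<close>.\<close>
    have "(a u / n u - cos (\<theta> u))\<^sup>2 + (b u / n u - sin (\<theta> u))\<^sup>2
        \<le> ((a u0 / n u0 - cos (\<theta> u0))\<^sup>2 + (b u0 / n u0 - sin (\<theta> u0))\<^sup>2) * exp (0 * \<bar>u - u0\<bar>)"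
    proof (rule gronwall[OF I(2) u0 u, where p = "\<lambda>u. u" and p' = "\<lambda>_. 1" and L = 0 and D' = "\<lambda>_. 0"
          and D = "\<lambda>u. (a u / n u - cos (\<theta> u))\<^sup>2 + (b u / n u - sin (\<theta> u))\<^sup>2"])
      fix v assume v: "v \<in> I"
      have "((\<lambda>u. (a u / n u - cos (\<theta> u))\<^sup>2 + (b u / n u - sin (\<theta> u))\<^sup>2) has_real_derivative
          2 * \<kappa> v * ((a v / n v - cos (\<theta> v)) * (- (b v / n v) - - sin (\<theta> v))
            + (b v / n v - sin (\<theta> v)) * (a v / n v - cos (\<theta> v)))) (at v)"
      proof (rule DERIV_sum_diff_squares)
        show "((\<lambda>u. a u / n u) has_real_derivative \<kappa> v * - (b v / n v)) (at v)" using dT(1)[OF v] by simp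
        show "((\<lambda>u. cos (\<theta> u)) has_real_derivative - sin (\<theta> v) * \<kappa> v) (at v)" by (rule DERIV_chain2[OF DERIV_cos d\<theta>[OF v]])
        show "((\<lambda>u. b u / n u) has_real_derivative \<kappa> v * (a v / n v)) (at v)" by (rule dT(2)[OF v])
        show "((\<lambda>u. sin (\<theta> u)) has_real_derivative cos (\<theta> v) * \<kappa> v) (at v)" by (rule DERIV_chain2[OF DERIV_sin d\<theta>[OF v]])
      qed
      then show "((\<lambda>u. (a u / n u - cos (\<theta> u))\<^sup>2 + (b u / n u - sin (\<theta> u))\<^sup>2) has_real_derivative 0) (at v)"
        by (rule DERIV_cong) (simp add: algebra_simps)
    qed simp_all
    moreover have "\<theta> u0 = t0" using H(1) by (simp add: \<theta>_def)
    ultimately have "(a u / n u - cos (\<theta> u))\<^sup>2 + (b u / n u - sin (\<theta> u))\<^sup>2 \<le> 0" using t0 by simp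
    then have "a u / n u = cos (\<theta> u)" "b u / n u = sin (\<theta> u)" by (simp_all add: sum_power2_le_zero_iff)
    then show "a u = n u * cos (\<theta> u)" "b u = n u * sin (\<theta> u)" using n(1)[OF u] by (simp_all add: field_simps)
  qed
  have "angle_system I r \<theta> \<phi> x"
    unfolding angle_system_def
  proof (intro ballI conjI)
    fix u assume u: "u \<in> I"
    note t = tang[OF u]
    have ty: "y u = tan (\<phi> u)" by (simp add: \<phi>_def tan_arctan)
    have "\<kappa> u = - ((b u + y u * a u) ^ 3) / (n u)\<^sup>2" using eq'[OF u] by (simp add: \<kappa>_def)
    also have "b u + y u * a u = n u * (sin (\<theta> u + \<phi> u) / cos (\<phi> u))"
      unfolding t ty using cpos[of u] by (simp add: sin_add tan_def field_simps)
    also have "- ((n u * (sin (\<theta> u + \<phi> u) / cos (\<phi> u))) ^ 3) / (n u)\<^sup>2 = r u * - (sin (\<theta> u + \<phi> u) ^ 3)"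
      using n(1)[OF u] cpos[of u] unfolding rn[of u, symmetric] by (simp add: field_simps power2_eq_square power3_eq_cube)
    finally show "(\<theta> has_real_derivative r u * - (sin (\<theta> u + \<phi> u) ^ 3)) (at u)" using d\<theta>[OF u] by simp
    have "(\<phi> has_real_derivative inverse (1 + (y u)\<^sup>2) * b u) (at u)"
      unfolding \<phi>_def by (rule DERIV_chain2[OF DERIV_arctan dxy(2)[OF u]])
    moreover have "inverse (1 + (y u)\<^sup>2) = (cos (\<phi> u))\<^sup>2"
      using sq[of u] by (simp add: cphi power_inverse)
    moreover have "(cos (\<phi> u))\<^sup>2 * b u = r u * (sin (\<theta> u) * cos (\<phi> u) ^ 5)"
      unfolding t rn[of u, symmetric] by (simp add: power2_eq_square power3_eq_cube power_numeral_reduce)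
    ultimately show "(\<phi> has_real_derivative r u * (sin (\<theta> u) * cos (\<phi> u) ^ 5)) (at u)" by simp
    show "(x has_real_derivative r u * (cos (\<theta> u) * cos (\<phi> u) ^ 3)) (at u)"
      using dxy(1)[OF u] unfolding t rn[of u, symmetric] by (simp add: mult_ac)
    show "\<bar>\<phi> u\<bar> < pi / 2" unfolding \<phi>_def using arctan_lbound[of "y u"] arctan_ubound[of "y u"] by linarith
  qed
  moreover have "Y u = height_curve \<phi> x u" for u
    by (simp add: height_curve_def \<phi>_def tan_arctan x_def y_def vec_eq_iff forall_2)
  ultimately show ?thesis using that smr rpos by blast
qed

lemma maximal_solution_of_proper:
  fixes p r :: "real \<Rightarrow> real"
  assumes sol: "solution I Y" and hom: "homeomorphism I UNIV p r"
    and proper: "\<And>C. \<exists>B. \<forall>u\<in>I. \<bar>Y u $ 1\<bar> \<le> C \<longrightarrow> \<bar>p u\<bar> \<le> B"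
  shows "maximal_solution I Y"
  unfolding maximal_solution_def
proof (intro conjI allI impI)
  fix K Z q assume *: "solution K Z \<and> smooth_on I q \<and> (\<forall>u\<in>I. vderiv q u \<noteq> 0) \<and> q ` I \<subseteq> K \<and> (\<forall>u\<in>I. Y u = Z (q u))"
  then have K: "open K" "connected K" and Z: "smooth_on K Z" and q: "smooth_on I q" "\<And>u. u \<in> I \<Longrightarrow> vderiv q u \<noteq> 0"
    "q ` I \<subseteq> K" "\<And>u. u \<in> I \<Longrightarrow> Y u = Z (q u)"
    by (auto simp: solution_def immersed_curve_def)
  have I: "open I" "connected I" "I \<noteq> {}" using sol by (auto simp: solution_def immersed_curve_def)
  have dq: "(q has_real_derivative vderiv q u) (at u)" if "u \<in> I" for u
    using smooth_on_imp_derivative[OF q(1) that] by (simp add: has_real_derivative_iff_has_vector_derivative)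
  have cont_q: "continuous_on I q"
    by (intro continuous_at_imp_continuous_on ballI; erule DERIV_isCont[OF dq])
  have inj: "inj_on q I"
  proof (rule linorder_inj_onI)
    fix u v assume uv: "u < v" "u \<in> I" "v \<in> I"
    then have sub: "{u..v} \<subseteq> I" using connected_contains_Icc[OF I(2)] by blast
    show "q u \<noteq> q v"
    proof
      assume "q u = q v"
      have "\<And>z. u \<le> z \<Longrightarrow> z \<le> v \<Longrightarrow> (q has_real_derivative vderiv q z) (at z)" using dq sub by auto
      from MVT2[OF uv(1) this] obtain z where z: "u < z" "z < v" "q v - q u = (v - u) * vderiv q z" by blast
      have "z \<in> I" using sub z(1,2) by auto
      then show False using q(2)[of z] z(3) uv(1) \<open>q u = q v\<close> by simp
    qed
  qed auto
  have opJ: "open (q ` I)" by (rule invariance_of_domain[OF cont_q I(1) inj])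
  have cont_Z: "continuous_on K (\<lambda>k. Z k $ 1)"
  proof (intro continuous_at_imp_continuous_on ballI)
    fix k assume "k \<in> K"
    from has_real_derivative_nth[OF smooth_on_imp_derivative[OF Z this], of 1]
    show "isCont (\<lambda>k. Z k $ 1) k" by (rule DERIV_isCont)
  qed
  have hr: "continuous_on UNIV r" "range r = I" "\<And>u. u \<in> I \<Longrightarrow> r (p u) = u"
    using hom by (auto simp: homeomorphism_def)
  have closed: "k \<in> q ` I" if k: "k \<in> K" "k \<in> closure (q ` I)" for k
  proof -
    define C where "C = \<bar>Z k $ 1\<bar> + 1"
    define U where "U = {l \<in> K. \<bar>Z l $ 1\<bar> < C}"
    have "U = K \<inter> (\<lambda>l. \<bar>Z l $ 1\<bar>) -` {..<C}" by (auto simp: U_def)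
    moreover have "open \<dots>"
      by (rule continuous_open_preimage) (intro continuous_intros cont_Z K, simp_all add: K)
    ultimately have opU: "open U" by simp
    have kU: "k \<in> U" using k by (simp add: U_def C_def)
    obtain B where B: "\<And>u. u \<in> I \<Longrightarrow> \<bar>Y u $ 1\<bar> \<le> C \<Longrightarrow> \<bar>p u\<bar> \<le> B" using proper[of C] by blast
    define S where "S = (\<lambda>t. q (r t)) ` {- B..B}"
    have "continuous_on {- B..B} (\<lambda>t. q (r t))"
      by (rule continuous_on_compose2[OF cont_q continuous_on_subset[OF hr(1)]]) (use hr(2) in auto)
    then have "compact S" unfolding S_def by (rule compact_continuous_image) simp
    then have clS: "closure S = S" by (simp add: compact_imp_closed)
    have "U \<inter> q ` I \<subseteq> S"
    proof
      fix l assume "l \<in> U \<inter> q ` I"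
      then obtain u where u: "u \<in> I" "l = q u" "\<bar>Z l $ 1\<bar> < C" by (auto simp: U_def)
      then have "\<bar>p u\<bar> \<le> B" using B[of u] q(4)[of u] by simp
      then have "p u \<in> {- B..B}" by (simp add: abs_le_iff)
      then show "l \<in> S" unfolding S_def using hr(3)[OF u(1)] u(2) by (intro image_eqI[of _ _ "p u"]) simp_all
    qed
    moreover have "k \<in> closure (U \<inter> q ` I)" using open_Int_closure_subset[OF opU] kU k(2) by blast
    ultimately have "k \<in> S" using closure_mono clS by blast
    then show ?thesis using hr(2) unfolding S_def by blast
  qed
  have "q ` I \<inter> K = {} \<or> - closure (q ` I) \<inter> K = {}"
  proof (rule connectedD[OF K(2) opJ])
    show "open (- closure (q ` I))" by (rule open_Compl[OF closed_closure])
    show "q ` I \<inter> - closure (q ` I) \<inter> K = {}" using closure_subset[of "q ` I"] by blast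
    show "K \<subseteq> q ` I \<union> - closure (q ` I)" using closed by blast
  qed
  then have "- closure (q ` I) \<inter> K = {}" using q(3) I(3) by blast
  then show "q ` I = K" using closed q(3) by blast
qed (rule sol)

subsection \<open>Classification\<close>

definition normal_form :: "(real \<Rightarrow> real^2) \<Rightarrow> real set \<Rightarrow> bool" where
  "normal_form W I \<longleftrightarrow>
     parametrizes I W (graph_curve (\<lambda>t. 0)) \<or>
     (\<exists>f1 f2. two_branch_profile f1 f2 \<and> parametrizes I W (two_branch_curve f1 f2)) \<or>
     (\<exists>f. entire_profile f \<and> parametrizes I W (graph_curve f))"

lemma parametrizes_compose:
  assumes "parametrizes L W c" "homeomorphism I L p q" "\<And>u. u \<in> I \<Longrightarrow> V u = W (p u)"
  shows "parametrizes I V c"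
proof -
  obtain h h' where h: "homeomorphism L UNIV h h'" "\<And>u. u \<in> L \<Longrightarrow> W u = c (h u)"
    using assms(1) by (auto simp: parametrizes_def)
  have "p u \<in> L" if "u \<in> I" for u using assms(2) that by (auto simp: homeomorphism_def)
  then show ?thesis
    unfolding parametrizes_def using homeomorphism_compose[OF assms(2) h(1)] h(2) assms(3)
    by (intro exI[of _ "h \<circ> p"] exI[of _ "q \<circ> h'"]) simp
qed

lemma normal_form_compose:
  assumes "normal_form W L" "homeomorphism I L p q" "\<And>u. u \<in> I \<Longrightarrow> V u = W (p u)"
  shows "normal_form V I"
proof -
  have "parametrizes I V c" if "parametrizes L W c" for c
    using that assms(2) by (rule parametrizes_compose) (rule assms(3))
  then show ?thesis using assms(1) unfolding normal_form_def by blast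
qed

text \<open>The tangent angle at \<open>s\<close> is pi / 2 up to a multiple of pi. Full turns
  remove an even multiple; for an odd one the curve is first traversed in the opposite
  direction.\<close>

lemma vertical_tangent_normal_form:
  assumes fl: "angle_flow \<theta> \<phi> x" and s: "cos (\<theta> s) = 0" "0 \<le> \<phi> s"
  shows "normal_form (height_curve \<phi> (\<lambda>t. x t - x s)) UNIV"
proof -
  define X where "X = (\<lambda>t. x t - x s)"
  have flX: "angle_flow \<theta> \<phi> X"
    using angle_system_translate[OF fl, of "- x s"] by (simp add: X_def)
  note sh = angle_flow_shift[OF flX, of s]
  obtain i :: int where i: "odd i" "\<theta> s = of_int i * (pi / 2)" using s(1) cos_zero_iff_int by blast
  then obtain j where "i = 2 * j + 1" by (blast elim: oddE)
  then have th: "\<theta> s = pi / 2 + of_int j * pi" using i(2) by (simp add: algebra_simps)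
  show ?thesis
  proof (cases "even j")
    case True
    then obtain k where k: "j = 2 * k" by (blast elim: evenE)
    have "\<exists>f1 f2. two_branch_profile f1 f2 \<and> f1 0 = tan (\<phi> (0 + s)) \<and>
        parametrizes UNIV (height_curve (\<lambda>t. \<phi> (t + s)) (\<lambda>t. X (t + s))) (two_branch_curve f1 f2)"
      by (rule vertical_tangent_classification[OF angle_system_full_turns[OF sh, of "- k"]])
         (use th k s(2) in \<open>simp_all add: X_def\<close>)
    then have "normal_form (height_curve (\<lambda>t. \<phi> (t + s)) (\<lambda>t. X (t + s))) UNIV"
      unfolding normal_form_def by blast
    moreover have "homeomorphism UNIV UNIV (\<lambda>t. t - s) (\<lambda>t. t + s)"
      by (intro homeomorphismI continuous_intros) auto
    ultimately have "normal_form (height_curve \<phi> X) UNIV"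
      by (rule normal_form_compose) (simp add: height_curve_def)
    then show ?thesis unfolding X_def .
  next
    case False
    then obtain k where k: "j = 2 * k + 1" by (blast elim: oddE)
    have "\<exists>f1 f2. two_branch_profile f1 f2 \<and> f1 0 = tan (\<phi> (- 0 + s)) \<and>
        parametrizes UNIV (height_curve (\<lambda>t. \<phi> (- t + s)) (\<lambda>t. X (- t + s))) (two_branch_curve f1 f2)"
      by (rule vertical_tangent_classification[OF angle_system_full_turns[OF angle_flow_reverse[OF sh], of "- k - 1"]])
         (use th k s(2) in \<open>simp_all add: X_def algebra_simps\<close>)
    then have "normal_form (height_curve (\<lambda>t. \<phi> (- t + s)) (\<lambda>t. X (- t + s))) UNIV"
      unfolding normal_form_def by blast
    moreover have "homeomorphism UNIV UNIV (\<lambda>t. s - t) (\<lambda>t. s - t)"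
      by (intro homeomorphismI continuous_intros) auto
    ultimately have "normal_form (height_curve \<phi> X) UNIV"
      by (rule normal_form_compose) (simp add: height_curve_def)
    then show ?thesis unfolding X_def .
  qed
qed

lemma angle_near_zero_of_cos_pos:
  fixes a :: real
  assumes "0 < cos a"
  obtains k :: int where "\<bar>a + 2 * pi * of_int k\<bar> < pi / 2"
proof -
  \<comment> \<open>Rounding a / (2 pi) to a nearest integer; removing that many full turns leaves
    |b| \<le> pi.\<close>
  define k where "k = \<lfloor>a / (2 * pi) + 1 / 2\<rfloor>"
  define b where "b = a + 2 * pi * of_int (- k)"
  have "of_int k \<le> a / (2 * pi) + 1 / 2" "a / (2 * pi) + 1 / 2 < of_int k + 1"
    unfolding k_def by linarith+
  then have "2 * pi * of_int k \<le> a + pi" "a + pi < 2 * pi * of_int k + 2 * pi"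
    by (simp_all add: field_simps)
  then have b: "\<bar>b\<bar> \<le> pi" unfolding b_def by (simp add: abs_le_iff)
  have "cos b = cos a" unfolding b_def by (simp add: cos_diff cos_int_2pin sin_int_2pin)
  then have "0 < cos \<bar>b\<bar>" using assms by simp
  have "\<bar>b\<bar> < pi / 2"
  proof (rule ccontr)
    assume "\<not> ?thesis"
    then have "cos \<bar>b\<bar> \<le> cos (pi / 2)" using b by (intro cos_monotone_0_pi_le) auto
    then show False using \<open>0 < cos \<bar>b\<bar>\<close> by simp
  qed
  then show ?thesis unfolding b_def by (rule that)
qed

lemma graph_normal_form:
  assumes fl: "angle_flow \<theta> \<phi> x" and c: "\<And>t. 0 < cos (\<theta> t)"
  shows "\<exists>\<phi>'\<in>{\<phi>, \<lambda>t. - \<phi> t}. \<exists>b. normal_form (height_curve \<phi>' (\<lambda>t. x t + b)) UNIV"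
proof -
  obtain k :: int where k: "\<bar>\<theta> 0 + 2 * pi * of_int k\<bar> < pi / 2"
    using angle_near_zero_of_cos_pos[OF c] by blast
  define \<theta>' where "\<theta>' = (\<lambda>t. \<theta> t + 2 * pi * of_int k)"
  have fl': "angle_flow \<theta>' \<phi> x" unfolding \<theta>'_def by (rule angle_system_full_turns[OF fl])
  have "cos (\<theta>' t) = cos (\<theta> t)" for t by (simp add: \<theta>'_def cos_add cos_int_2pin sin_int_2pin)
  then have c': "0 < cos (\<theta>' t)" for t using c by simp
  have st: "\<bar>\<theta>' t\<bar> < pi / 2" for t
    by (rule strip_invariant[OF fl' c', of 0]) (use k in \<open>simp add: \<theta>'_def\<close>)
  show ?thesis
  proof (cases "\<forall>t. \<phi> t \<noteq> 0 \<or> \<theta>' t \<noteq> 0")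
    case True
    interpret strip_flow \<theta>' \<phi> x
    proof
      fix t
      show "- (pi / 2) < \<theta>' t" "\<theta>' t < pi / 2" using st[of t] by linarith+
      show "\<phi> t \<noteq> 0 \<or> \<theta>' t \<noteq> 0" using True by blast
    qed (rule fl')
    show ?thesis using entire_classification unfolding normal_form_def by blast
  next
    case False
    then obtain s where s: "\<phi> s = 0" "\<theta>' s = 0" by blast
    then have *: "\<phi> t = 0 \<and> x t = x s + (t - s)" for t
      using angle_flow_equilibrium[OF fl' s(1), of t] by simp
    define d where "d = x s - s"
    have x: "x = (\<lambda>t. t + d)"
    proof
      show "x t = t + d" for t using *[of t] unfolding d_def by linarith
    qed
    have \<phi>: "\<phi> = (\<lambda>_. 0)" using * by blast
    have "homeomorphism UNIV UNIV (\<lambda>t. t + d) (\<lambda>t. t - d)"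
      by (intro homeomorphismI continuous_intros) auto
    then have "parametrizes UNIV (height_curve \<phi> (\<lambda>t. x t + 0)) (graph_curve (\<lambda>t. 0))"
      unfolding parametrizes_def x \<phi>
      by (intro exI[of _ "\<lambda>t. t + d"] exI[of _ "\<lambda>t. t - d"]) (simp add: height_curve_def graph_curve_def)
    then show ?thesis unfolding normal_form_def by blast
  qed
qed

text \<open>A vertical tangent below the axis is brought above it by the reflection. Without a
  vertical tangent cos \<theta> has a constant sign, and a curve running to the left is traversed
  backward.\<close>

lemma height_curve_normal_form:
  assumes fl: "angle_flow \<theta> \<phi> x"
  shows "\<exists>\<phi>'\<in>{\<phi>, \<lambda>t. - \<phi> t}. \<exists>b. normal_form (height_curve \<phi>' (\<lambda>t. x t + b)) UNIV"
proof (cases "\<exists>s. cos (\<theta> s) = 0")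
  case True
  then obtain s where s: "cos (\<theta> s) = 0" by blast
  show ?thesis
  proof (cases "0 \<le> \<phi> s")
    case True
    have "normal_form (height_curve \<phi> (\<lambda>t. x t + - x s)) UNIV"
      using vertical_tangent_normal_form[OF fl s True] by simp
    then show ?thesis by blast
  next
    case False
    have "normal_form (height_curve (\<lambda>t. - \<phi> t) (\<lambda>t. x t + - x s)) UNIV"
      using vertical_tangent_normal_form[OF angle_system_reflect[OF fl], of s] s False by simp
    then show ?thesis by blast
  qed
next
  case False
  have "(\<forall>t. 0 < cos (\<theta> t)) \<or> (\<forall>t. cos (\<theta> t) < 0)"
  proof (rule ccontr)
    assume "\<not> ?thesis"
    then obtain s t where "cos (\<theta> s) \<le> 0" "0 \<le> cos (\<theta> t)" by (auto simp: not_less)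
    moreover have "continuous_on UNIV (\<lambda>t. cos (\<theta> t))"
      by (intro continuous_intros angle_flow_continuous[OF fl])
    ultimately show False using continuous_reaches[of UNIV "\<lambda>t. cos (\<theta> t)" s t 0] False by auto
  qed
  then show ?thesis
  proof
    assume "\<forall>t. 0 < cos (\<theta> t)"
    then show ?thesis using graph_normal_form[OF fl] by blast
  next
    assume "\<forall>t. cos (\<theta> t) < 0"
    then have "\<exists>\<phi>'\<in>{\<lambda>t. \<phi> (- t), \<lambda>t. - \<phi> (- t)}. \<exists>b. normal_form (height_curve \<phi>' (\<lambda>t. x (- t) + b)) UNIV"
      using graph_normal_form[OF angle_flow_reverse[OF fl]] by simp
    then obtain \<phi>' b where *: "\<phi>' \<in> {\<lambda>t. \<phi> (- t), \<lambda>t. - \<phi> (- t)}"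
      "normal_form (height_curve \<phi>' (\<lambda>t. x (- t) + b)) UNIV" by blast
    have hom: "homeomorphism UNIV UNIV (\<lambda>t::real. - t) (\<lambda>t. - t)"
      by (intro homeomorphismI continuous_intros) auto
    have "normal_form (height_curve (\<lambda>t. \<phi>' (- t)) (\<lambda>t. x t + b)) UNIV"
      by (rule normal_form_compose[OF *(2) hom]) (simp add: height_curve_def)
    moreover have "(\<lambda>t. \<phi>' (- t)) \<in> {\<phi>, \<lambda>t. - \<phi> t}" using *(1) by auto
    ultimately show ?thesis by blast
  qed
qed

text \<open>In each normal form the abscissa has the same modulus as the parameter, and the
  continuous inverse of the reparametrization maps compact intervals to bounded sets.\<close>

lemma normal_form_proper:
  assumes "normal_form W UNIV"
  shows "\<exists>B. \<forall>u. \<bar>W u $ 1\<bar> \<le> C \<longrightarrow> \<bar>u\<bar> \<le> B"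
proof -
  have *: "\<exists>B. \<forall>u. \<bar>W u $ 1\<bar> \<le> C \<longrightarrow> \<bar>u\<bar> \<le> B"
    if W: "parametrizes UNIV W c" and c: "\<And>t. \<bar>c t $ 1\<bar> = \<bar>t\<bar>" for c
  proof -
    obtain h h' where h: "homeomorphism UNIV UNIV h h'" "\<And>u. W u = c (h u)"
      using W unfolding parametrizes_def by blast
    have h': "continuous_on UNIV h'" "\<And>u. h' (h u) = u" using h(1) by (simp_all add: homeomorphism_def)
    have "compact (h' ` {- C..C})"
      by (intro compact_continuous_image continuous_on_subset[OF h'(1)]) auto
    then obtain B where B: "\<And>v. v \<in> h' ` {- C..C} \<Longrightarrow> \<bar>v\<bar> \<le> B"
      using compact_imp_bounded bounded_iff by (metis real_norm_def)
    have "\<bar>u\<bar> \<le> B" if "\<bar>W u $ 1\<bar> \<le> C" for u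
    proof (rule B)
      have "h u \<in> {- C..C}" using that c[of "h u"] h(2)[of u] by (simp add: abs_le_iff)
      then show "u \<in> h' ` {- C..C}" using h'(2)[of u] by (intro image_eqI[of _ _ "h u"]) simp_all
    qed
    then show ?thesis by blast
  qed
  show ?thesis
    using assms *[of "graph_curve _"] *[of "two_branch_curve _ _"]
    unfolding normal_form_def by (auto simp: graph_curve_def two_branch_curve_def)
qed

lemma height_curve_proper:
  assumes fl: "angle_flow \<theta> \<phi> x"
  shows "\<exists>B. \<forall>u. \<bar>x u\<bar> \<le> C \<longrightarrow> \<bar>u\<bar> \<le> B"
proof -
  obtain \<phi>' b where "normal_form (height_curve \<phi>' (\<lambda>t. x t + b)) UNIV"
    using height_curve_normal_form[OF fl] by blast
  from normal_form_proper[OF this, of "C + \<bar>b\<bar>"]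
  obtain B where B: "\<And>u. \<bar>x u + b\<bar> \<le> C + \<bar>b\<bar> \<Longrightarrow> \<bar>u\<bar> \<le> B" by (auto simp: height_curve_def)
  have "\<bar>u\<bar> \<le> B" if "\<bar>x u\<bar> \<le> C" for u using that by (intro B) linarith
  then show ?thesis by blast
qed

text \<open>The arbitrary clock \<open>p\<close> is there because maximality is also claimed for the
  reflected and translated curve in the parametrization of the given one.\<close>

lemma maximal_height_curve:
  assumes fl: "angle_flow \<theta> \<phi> x" and I: "open I" "connected I" "I \<noteq> {}"
    and r: "smooth_on I r" "\<And>u. u \<in> I \<Longrightarrow> 0 < r u"
    and p: "\<And>u. u \<in> I \<Longrightarrow> (p has_real_derivative r u) (at u)" and hom: "homeomorphism I UNIV p q"
  shows "maximal_solution I (\<lambda>u. height_curve \<phi> x (p u))"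
proof -
  have sys: "angle_system I r (\<lambda>u. \<theta> (p u)) (\<lambda>u. \<phi> (p u)) (\<lambda>u. x (p u))"
    unfolding angle_system_def
  proof (intro ballI conjI)
    fix u assume u: "u \<in> I"
    show "((\<lambda>u. \<theta> (p u)) has_real_derivative r u * - (sin (\<theta> (p u) + \<phi> (p u)) ^ 3)) (at u)"
      using DERIV_chain2[OF angle_flowD(1)[OF fl] p[OF u]] by (simp add: mult.commute)
    show "((\<lambda>u. \<phi> (p u)) has_real_derivative r u * (sin (\<theta> (p u)) * cos (\<phi> (p u)) ^ 5)) (at u)"
      using DERIV_chain2[OF angle_flowD(2)[OF fl] p[OF u]] by (simp add: mult_ac)
    show "((\<lambda>u. x (p u)) has_real_derivative r u * (cos (\<theta> (p u)) * cos (\<phi> (p u)) ^ 3)) (at u)"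
      using DERIV_chain2[OF angle_flowD(3)[OF fl] p[OF u]] by (simp add: mult_ac)
    show "\<bar>\<phi> (p u)\<bar> < pi / 2" using angle_flowD(5,6)[OF fl, of "p u"] by linarith
  qed
  have eq: "height_curve (\<lambda>u. \<phi> (p u)) (\<lambda>u. x (p u)) = (\<lambda>u. height_curve \<phi> x (p u))"
    by (simp add: height_curve_def fun_eq_iff)
  show ?thesis
  proof (rule maximal_solution_of_proper[OF _ hom])
    show "solution I (\<lambda>u. height_curve \<phi> x (p u))"
      using solution_height_curve[OF I sys r] unfolding eq .
    fix C
    obtain B where "\<And>u. \<bar>x u\<bar> \<le> C \<Longrightarrow> \<bar>u\<bar> \<le> B" using height_curve_proper[OF fl, of C] by blast
    then show "\<exists>B. \<forall>u\<in>I. \<bar>height_curve \<phi> x (p u) $ 1\<bar> \<le> C \<longrightarrow> \<bar>p u\<bar> \<le> B"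
      by (auto simp: height_curve_def)
  qed
qed

lemma smooth_on_const: "smooth_on UNIV (\<lambda>u. c)"
  using ck_on_const smooth_on_iff_ck_on[OF open_UNIV] by blast

lemma maximal_height_curve_UNIV:
  assumes "angle_flow \<theta> \<phi> x"
  shows "maximal_solution UNIV (height_curve \<phi> x)"
  using maximal_height_curve[OF assms open_UNIV connected_UNIV UNIV_not_empty, of "\<lambda>_. 1" "\<lambda>u. u" "\<lambda>u. u"]
  by (simp add: smooth_on_const homeomorphism_ident)

text \<open>The complete flow line through a point of the curve is a solution that contains it, so
  maximality forces the clock to run through the whole line.\<close>

lemma maximal_solution_factor:
  assumes max: "maximal_solution I Y"
  obtains \<theta> \<phi> x p q r where "angle_flow \<theta> \<phi> x" "open I" "connected I" "I \<noteq> {}" "smooth_on I r"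
    "\<And>u. u \<in> I \<Longrightarrow> 0 < r u" "\<And>u. u \<in> I \<Longrightarrow> (p has_real_derivative r u) (at u)"
    "homeomorphism I UNIV p q" "\<And>u. u \<in> I \<Longrightarrow> Y u = height_curve \<phi> x (p u)"
proof -
  have sol: "solution I Y" using max by (simp add: maximal_solution_def)
  then have I: "open I" "connected I" "I \<noteq> {}" by (auto simp: solution_def immersed_curve_def)
  obtain r \<theta>1 \<phi>1 x1 where sys: "angle_system I r \<theta>1 \<phi>1 x1" and r: "smooth_on I r" "\<And>u. u \<in> I \<Longrightarrow> 0 < r u"
    and Y: "\<And>u. u \<in> I \<Longrightarrow> Y u = height_curve \<phi>1 x1 u"
    using solution_angle_system[OF sol] by blast
  have ckr: "ck_on n I r" for n using r(1) unfolding smooth_on_iff_ck_on[OF I(1)] by blast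
  have cont: "continuous_on I r"
  proof (intro continuous_at_imp_continuous_on ballI)
    fix u assume "u \<in> I"
    then have "r differentiable (at u)" using ckr[of 0] by simp
    then show "isCont r u" by (rule differentiable_imp_continuous_within)
  qed
  obtain u0 where u0: "u0 \<in> I" using I(3) by blast
  obtain p where p0: "p u0 = 0" and p': "\<And>u. u \<in> I \<Longrightarrow> (p has_vector_derivative r u) (at u)"
    using antiderivative_exists[OF I(1,2) cont u0] by blast
  have p: "(p has_real_derivative r u) (at u)" if "u \<in> I" for u
    using p'[OF that] by (simp add: has_real_derivative_iff_has_vector_derivative)
  have "\<bar>\<phi>1 u0\<bar> < pi / 2" using sys u0 by (simp add: angle_system_def)
  then obtain \<theta> \<phi> x where fl: "angle_flow \<theta> \<phi> x" and init: "\<theta> 0 = \<theta>1 u0" "\<phi> 0 = \<phi>1 u0" "x 0 = x1 u0"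
    by (rule angle_flow_exists)
  have eq: "\<theta>1 u = \<theta> (p u) \<and> \<phi>1 u = \<phi> (p u) \<and> x1 u = x (p u)" if "u \<in> I" for u
    by (rule angle_system_factor[OF I(2) u0 that sys _ p fl]) (use r(2) init p0 in \<open>auto intro: less_imp_le\<close>)
  have YZ: "Y u = height_curve \<phi> x (p u)" if "u \<in> I" for u
    using Y[OF that] eq[OF that] by (simp add: height_curve_def)
  have "ck_on (Suc n) I p" for n unfolding ck_on.simps using p' ckr by blast
  then have "ck_on n I p" for n by (rule ck_on_SucD)
  then have smp: "smooth_on I p" unfolding smooth_on_iff_ck_on[OF I(1)] by blast
  have vp: "vderiv p u \<noteq> 0" if "u \<in> I" for u using vderiv_eqI[OF p'[OF that]] r(2)[OF that] by simp
  have "solution UNIV (height_curve \<phi> x)"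
    using maximal_height_curve_UNIV[OF fl] by (simp add: maximal_solution_def)
  then have img: "p ` I = UNIV" using max smp vp YZ unfolding maximal_solution_def by blast
  have cp: "continuous_on I p"
    by (intro continuous_at_imp_continuous_on ballI) (erule DERIV_isCont[OF p])
  have "inj_on p I"
  proof (rule linorder_inj_onI)
    fix u v assume uv: "u < v" "u \<in> I" "v \<in> I"
    then have sub: "{u..v} \<subseteq> I" using connected_contains_Icc[OF I(2)] by blast
    have "p u < p v"
    proof (rule DERIV_pos_imp_increasing[OF uv(1)])
      fix z assume "u \<le> z" "z \<le> v"
      then have "z \<in> I" using sub by auto
      then show "\<exists>y. (p has_real_derivative y) (at z) \<and> 0 < y" using p r(2) by blast
    qed
    then show "p u \<noteq> p v" by simp
  qed auto
  then obtain q where hom: "homeomorphism I UNIV p q"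
    using invariance_of_domain_homeomorphism[OF I(1) cp] img by auto
  show ?thesis
    by (rule that[OF fl I r(1) _ _ hom]) (rule r(2), assumption, rule p, assumption, rule YZ, assumption)
qed

theorem theorem3p5:
  shows "(\<forall>I Y. maximal_solution I Y \<longrightarrow>
           (\<exists>\<rho>\<in>{id, reflect_x}. \<exists>v. \<exists>Y'. Y' = (\<lambda>u. \<rho> (Y u) + v) \<and> maximal_solution I Y' \<and>
              (parametrizes I Y' (graph_curve (\<lambda>t. 0)) \<or>
               (\<exists>f1 f2. two_branch_profile f1 f2 \<and> parametrizes I Y' (two_branch_curve f1 f2)) \<or>
               (\<exists>f. entire_profile f \<and> parametrizes I Y' (graph_curve f))))) \<and>
         maximal_solution UNIV (graph_curve (\<lambda>t. 0)) \<and>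
         (\<forall>a\<ge>0. \<exists>I Y f1 f2. maximal_solution I Y \<and> two_branch_profile f1 f2 \<and> f1 0 = a \<and>
            parametrizes I Y (two_branch_curve f1 f2)) \<and>
         (\<exists>I Y f. maximal_solution I Y \<and> entire_profile f \<and> parametrizes I Y (graph_curve f))"
proof (intro conjI allI impI)
  fix I Y assume "maximal_solution I Y"
  then obtain \<theta> \<phi> x p q r where fl: "angle_flow \<theta> \<phi> x" and I: "open I" "connected I" "I \<noteq> {}"
    and r: "smooth_on I r" "\<And>u. u \<in> I \<Longrightarrow> 0 < r u" "\<And>u. u \<in> I \<Longrightarrow> (p has_real_derivative r u) (at u)"
    and hom: "homeomorphism I UNIV p q" and Y: "\<And>u. u \<in> I \<Longrightarrow> Y u = height_curve \<phi> x (p u)"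
    by (rule maximal_solution_factor) (rule that, assumption+)
  obtain \<phi>' b where \<phi>': "\<phi>' \<in> {\<phi>, \<lambda>t. - \<phi> t}" and nf: "normal_form (height_curve \<phi>' (\<lambda>t. x t + b)) UNIV"
    using height_curve_normal_form[OF fl] by (elim bexE exE)
  define \<rho> :: "real^2 \<Rightarrow> real^2" where "\<rho> = (if \<phi>' = \<phi> then id else reflect_x)"
  \<comment> \<open>The equation involves the height but not the abscissa; a horizontal translation
    preserves it and is enough here.\<close>
  define Y' where "Y' = (\<lambda>u. \<rho> (Y u) + vector [b, 0])"
  have Y': "height_curve \<phi>' (\<lambda>t. x t + b) (p u) = Y' u" if "u \<in> I" for u
    using \<phi>' Y[OF that]
    by (auto simp: Y'_def \<rho>_def height_curve_def reflect_x_def vec_eq_iff forall_2)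
  obtain \<theta>' where "angle_flow \<theta>' \<phi>' x" using fl angle_system_reflect[OF fl] \<phi>' by blast
  then have fl': "angle_flow \<theta>' \<phi>' (\<lambda>t. x t + b)" by (rule angle_system_translate)
  have max: "maximal_solution I Y'"
    by (rule maximal_solution_cong[OF maximal_height_curve[OF fl' I r hom] Y'])
  have "normal_form Y' I" by (rule normal_form_compose[OF nf hom]) (rule Y'[symmetric])
  then show "\<exists>\<rho>\<in>{id, reflect_x}. \<exists>v. \<exists>Y'. Y' = (\<lambda>u. \<rho> (Y u) + v) \<and> maximal_solution I Y' \<and>
      (parametrizes I Y' (graph_curve (\<lambda>t. 0)) \<or>
       (\<exists>f1 f2. two_branch_profile f1 f2 \<and> parametrizes I Y' (two_branch_curve f1 f2)) \<or>
       (\<exists>f. entire_profile f \<and> parametrizes I Y' (graph_curve f)))"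
    unfolding normal_form_def using max
    by (intro bexI[of _ \<rho>] exI[of _ "vector [b, 0]"] exI[of _ Y'] conjI) (auto simp: Y'_def \<rho>_def)
next
  have "angle_flow (\<lambda>_. 0) (\<lambda>_. 0) (\<lambda>t. t)" by (simp add: angle_system_def)
  from maximal_height_curve_UNIV[OF this]
  show "maximal_solution UNIV (graph_curve (\<lambda>t. 0))"
    by (simp add: height_curve_def[abs_def] graph_curve_def[abs_def])
next
  fix a :: real assume a: "0 \<le> a"
  \<comment> \<open>Every height a \<ge> 0 occurs as that of a vertical tangent: the flow line is
    started there with the angle pi / 2.\<close>
  have "\<bar>arctan a\<bar> < pi / 2" using arctan_lbound[of a] arctan_ubound[of a] by linarith
  then obtain \<theta> \<phi> x where fl: "angle_flow \<theta> \<phi> x" and init: "\<theta> 0 = pi / 2" "\<phi> 0 = arctan a" "x 0 = 0"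
    by (rule angle_flow_exists)
  have "0 \<le> \<phi> 0" using a init by simp
  from vertical_tangent_classification[OF fl init(1,3) this]
  obtain f1 f2 where "two_branch_profile f1 f2" "f1 0 = a" "parametrizes UNIV (height_curve \<phi> x) (two_branch_curve f1 f2)"
    by (auto simp: init tan_arctan)
  then show "\<exists>I Y f1 f2. maximal_solution I Y \<and> two_branch_profile f1 f2 \<and> f1 0 = a \<and>
      parametrizes I Y (two_branch_curve f1 f2)"
    using maximal_height_curve_UNIV[OF fl] by blast
next
  obtain \<theta> \<phi> x where "strip_flow \<theta> \<phi> x" using strip_flow_exists by blast
  then interpret strip_flow \<theta> \<phi> x .
  obtain \<phi>' b f where \<phi>': "\<phi>' \<in> {\<phi>, \<lambda>t. - \<phi> t}" and f: "entire_profile f"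
    "parametrizes UNIV (height_curve \<phi>' (\<lambda>t. x t + b)) (graph_curve f)"
    using entire_classification by blast
  obtain \<theta>' where "angle_flow \<theta>' \<phi>' x" using fl angle_system_reflect[OF fl] \<phi>' by blast
  then have "maximal_solution UNIV (height_curve \<phi>' (\<lambda>t. x t + b))"
    by (intro maximal_height_curve_UNIV angle_system_translate)
  then show "\<exists>I Y f. maximal_solution I Y \<and> entire_profile f \<and> parametrizes I Y (graph_curve f)"
    using f by blast
qed

end
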